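(* Let $T_1,\ldots ,T_n$ be commuting contractions on a complex Hilbert space $\mathcal H$ and let their product $T=\prod_{i=1}^n T_i$ be a $C_{\cdot 0}$ contraction. Then $(T_1^*, \dots, T_n^* )\equiv (V_1^*|_{\mathcal{H}}, \dots , V_n^*|_{\mathcal{H}})$ for a model $n$-isometry $(V_1, \dots , V_n)$ on $H^2(\mathcal D_{T^*})$ if and only if there exist unique orthogonal projections $P_1, \dots , P_n$ and unique commuting unitaries $U_1, \dots , U_n$ in $\mathcal B(\mathcal D_{T^*})$ such that $\prod_{i=1}^n U_i=I_{\mathcal D_{T^*}}$ and the following conditions are satisfied for all $i,j\in\{1,\dots,n\}$: (1) $D_{T^*}T_i^*=P_i^{\perp}U_i^*D_{T^*}+P_iU_i^*D_{T^*}T^*$, (2) $P_i^{\perp}U_i^*P_j^{\perp}U_j^*=P_j^{\perp}U_j^*P_i^{\perp}U_i^*$, (3) $U_iP_iU_jP_j=U_jP_jU_iP_i$, (4) $P_1+U_1^*P_2U_1+U_1^*U_2^*P_3U_2U_1+\ldots +U_1^*U_2^*\ldots U_{n-1}^*P_nU_{n-1}\ldots U_2U_1 =I_{\mathcal{D}_{T^*}}$.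
   Context: All operators are bounded operators on complex Hilbert spaces. A contraction is an operator of norm at most $1$. A contraction $T$ is a $C_{\cdot 0}$ contraction if ${T^*}^k\to 0$ strongly as $k\to\infty$. For a contraction $T$ on $\mathcal H$, $D_{T^*}=(I-TT^* )^{1/2}$ and $\mathcal D_{T^*}=\overline{\mathrm{Ran}}\,D_{T^*}$. For an orthogonal projection $P$, $P^\perp=I-P$. For a Hilbert space $E$, $H^2(E)$ is the Hardy space of $E$-valued analytic functions on the unit disk with square summable power series coefficients, and $M_\phi$ denotes multiplication by the operator-valued function $\phi$. A model $n$-isometry on $H^2(E)$ is a tuple of commuting isometries $(V_1,\dots,V_n)$ such that each $V_i=M_{U_iP_i^{\perp}+zU_iP_i}$ for some orthogonal projections $P_1,\dots,P_n$ and unitaries $U_1,\dots,U_n$ on $E$, and $\prod_{i=1}^nV_i=M_z$. The relation $(T_1^*, \dots, T_n^* )\equiv (V_1^*|_{\mathcal{H}}, \dots , V_n^*|_{\mathcal{H}})$ means that $\mathcal H$ is identified with a closed subspace of $H^2(\mathcal D_{T^*})$ invariant under all $V_i^*$ in such a way that $T_i^*$ corresponds to the restriction of $V_i^*$; i.e. there is an isometry $W:\mathcal H\to H^2(\mathcal D_{T^*})$ with $V_i^*W=WT_i^*$ for $1\le i\le n$.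
   Formalization: The relation ≡ also requires the isometry W to be minimal (the functions z^k Wh span a dense subspace of H^2(D_{T*})); without this the "only if" part fails, e.g. for T_1=T_2=0 on an infinite-dimensional space. Minimality is automatic if D_{T*} is finite-dimensional. *)

theory Defs
  imports "HOL-Analysis.Analysis"
begin

section \<open>Complex Hilbert spaces\<close>

text \<open>Norm and topology are those of the underlying real inner product space; the complex inner
  product is linear in its first argument.\<close>

class complex_inner = real_inner +
  fixes scaleC :: "complex \<Rightarrow> 'a \<Rightarrow> 'a"  (infixr "*\<^sub>C" 75)
    and cinner :: "'a \<Rightarrow> 'a \<Rightarrow> complex"
  assumes scaleR_scaleC: "r *\<^sub>R x = complex_of_real r *\<^sub>C x"
    and scaleC_add_right: "c *\<^sub>C (x + y) = c *\<^sub>C x + c *\<^sub>C y"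
    and scaleC_add_left: "(c + d) *\<^sub>C x = c *\<^sub>C x + d *\<^sub>C x"
    and scaleC_scaleC: "c *\<^sub>C (d *\<^sub>C x) = (c * d) *\<^sub>C x"
    and cinner_commute: "cinner x y = cnj (cinner y x)"
    and cinner_add_left: "cinner (x + y) z = cinner x z + cinner y z"
    and cinner_scaleC_left: "cinner (c *\<^sub>C x) y = c * cinner x y"
    and inner_eq_Re_cinner: "inner x y = Re (cinner x y)"

class chilbert_space = complex_inner + complete_space

instantiation complex :: chilbert_space
begin

definition scaleC_complex :: "complex \<Rightarrow> complex \<Rightarrow> complex"
  where "scaleC_complex c x = c * x"

definition cinner_complex :: "complex \<Rightarrow> complex \<Rightarrow> complex"
  where "cinner_complex x y = x * cnj y"

instance
  by standard
    (auto simp: scaleC_complex_def cinner_complex_def scaleR_conv_of_real inner_complex_def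
      algebra_simps)

end

section \<open>Operators\<close>

text \<open>An operator on a closed subspace \<open>E\<close> is represented by a function on the whole type of which
  only the values on \<open>E\<close> matter; operators on the whole space are the case \<open>E = UNIV\<close>.\<close>

definition bounded_op_on :: "'a::complex_inner set \<Rightarrow> ('a \<Rightarrow> 'a) \<Rightarrow> bool"
  where "bounded_op_on E A \<longleftrightarrow>
    (\<forall>x\<in>E. A x \<in> E) \<and>
    (\<forall>x\<in>E. \<forall>y\<in>E. A (x + y) = A x + A y) \<and>
    (\<forall>c. \<forall>x\<in>E. A (c *\<^sub>C x) = c *\<^sub>C A x) \<and>
    (\<exists>K. \<forall>x\<in>E. norm (A x) \<le> K * norm x)"

text \<open>The adjoint of \<open>A\<close> on \<open>S\<close> with respect to the inner product \<open>ip\<close>. The vector described exists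
  and is unique for bounded \<open>A\<close> when \<open>S\<close> is a Hilbert space under \<open>ip\<close>. The inner product is a
  parameter because the Hardy space below is a set of functions with its own inner product.\<close>

definition adjoint_wrt :: "('v \<Rightarrow> 'v \<Rightarrow> complex) \<Rightarrow> 'v set \<Rightarrow> ('v \<Rightarrow> 'v) \<Rightarrow> 'v \<Rightarrow> 'v"
  where "adjoint_wrt ip S A y = (THE z. z \<in> S \<and> (\<forall>x\<in>S. ip (A x) y = ip x z))"

abbreviation adj_on :: "'a::complex_inner set \<Rightarrow> ('a \<Rightarrow> 'a) \<Rightarrow> 'a \<Rightarrow> 'a"
  where "adj_on \<equiv> adjoint_wrt cinner"

abbreviation adj :: "('a::complex_inner \<Rightarrow> 'a) \<Rightarrow> 'a \<Rightarrow> 'a"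
  where "adj \<equiv> adj_on UNIV"

definition orth_projection_on :: "'a::complex_inner set \<Rightarrow> ('a \<Rightarrow> 'a) \<Rightarrow> bool"
  where "orth_projection_on E P \<longleftrightarrow> bounded_op_on E P \<and>
    (\<forall>x\<in>E. P (P x) = P x) \<and> (\<forall>x\<in>E. adj_on E P x = P x)"

definition perp :: "('a::complex_inner \<Rightarrow> 'a) \<Rightarrow> 'a \<Rightarrow> 'a"
  where "perp P x = x - P x"

definition unitary_on :: "'a::complex_inner set \<Rightarrow> ('a \<Rightarrow> 'a) \<Rightarrow> bool"
  where "unitary_on E U \<longleftrightarrow> bounded_op_on E U \<and>
    (\<forall>x\<in>E. adj_on E U (U x) = x \<and> U (adj_on E U x) = x)"

definition contraction :: "('a::complex_inner \<Rightarrow> 'a) \<Rightarrow> bool"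
  where "contraction T \<longleftrightarrow> bounded_op_on UNIV T \<and> onorm T \<le> 1"

definition C_dot_0_contraction :: "('a::complex_inner \<Rightarrow> 'a) \<Rightarrow> bool"
  where "C_dot_0_contraction T \<longleftrightarrow>
    contraction T \<and> (\<forall>x. (\<lambda>k. (adj T ^^ k) x) \<longlonglongrightarrow> 0)"

definition positive_op :: "('a::complex_inner \<Rightarrow> 'a) \<Rightarrow> bool"
  where "positive_op A \<longleftrightarrow> bounded_op_on UNIV A \<and>
    (\<forall>x. Im (cinner (A x) x) = 0 \<and> 0 \<le> Re (cinner (A x) x))"

definition positive_sqrt :: "('a::complex_inner \<Rightarrow> 'a) \<Rightarrow> 'a \<Rightarrow> 'a"
  where "positive_sqrt A = (THE S. positive_op S \<and> S \<circ> S = A)"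

text \<open>These are \<open>D\<close> and its closed range for the adjoint of \<open>T\<close>.\<close>

definition defect_op_star :: "('a::complex_inner \<Rightarrow> 'a) \<Rightarrow> 'a \<Rightarrow> 'a"
  where "defect_op_star T = positive_sqrt (\<lambda>x. x - T (adj T x))"

definition defect_space_star :: "('a::complex_inner \<Rightarrow> 'a) \<Rightarrow> 'a set"
  where "defect_space_star T = closure (range (defect_op_star T))"

text \<open>Products of \<open>n\<close> operators indexed by \<open>1, \<dots>, n\<close> are written with the list combinators:
  \<open>foldr A [1..<Suc n]\<close> is \<open>A 1 \<circ> A 2 \<circ> \<dots> \<circ> A n\<close>, and \<open>fold A [1..<i]\<close> is
  \<open>A (i - 1) \<circ> \<dots> \<circ> A 1\<close>; empty products are the identity.\<close>

section \<open>The Hardy space of a closed subspace\<close>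

text \<open>Functions on the unit disk are extended by \<open>0\<close>, so that equality of functions is equality on
  the disk.\<close>

definition hardy :: "'a::complex_inner set \<Rightarrow> (complex \<Rightarrow> 'a) set"
  where "hardy E = {f. (\<exists>a. (\<forall>k. a k \<in> E) \<and> summable (\<lambda>k. (norm (a k))\<^sup>2) \<and>
      (\<forall>z. cmod z < 1 \<longrightarrow> (\<lambda>k. z ^ k *\<^sub>C a k) sums f z)) \<and>
    (\<forall>z. \<not> cmod z < 1 \<longrightarrow> f z = 0)}"

definition hardy_coeff :: "(complex \<Rightarrow> 'a::complex_inner) \<Rightarrow> nat \<Rightarrow> 'a"
  where "hardy_coeff f = (THE a. \<forall>z. cmod z < 1 \<longrightarrow> (\<lambda>k. z ^ k *\<^sub>C a k) sums f z)"

definition hardy_inner :: "(complex \<Rightarrow> 'a::complex_inner) \<Rightarrow> (complex \<Rightarrow> 'a) \<Rightarrow> complex"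
  where "hardy_inner f g = (\<Sum>k. cinner (hardy_coeff f k) (hardy_coeff g k))"

definition hardy_norm :: "(complex \<Rightarrow> 'a::complex_inner) \<Rightarrow> real"
  where "hardy_norm f = sqrt (\<Sum>k. (norm (hardy_coeff f k))\<^sup>2)"

abbreviation hardy_adj ::
    "'a::complex_inner set \<Rightarrow> ((complex \<Rightarrow> 'a) \<Rightarrow> complex \<Rightarrow> 'a) \<Rightarrow> (complex \<Rightarrow> 'a) \<Rightarrow> complex \<Rightarrow> 'a"
  where "hardy_adj E \<equiv> adjoint_wrt hardy_inner (hardy E)"

definition mult_op :: "(complex \<Rightarrow> 'a \<Rightarrow> 'a) \<Rightarrow> (complex \<Rightarrow> 'a) \<Rightarrow> complex \<Rightarrow> 'a"
  where "mult_op \<phi> f = (\<lambda>z. \<phi> z (f z))"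

abbreviation mult_z :: "(complex \<Rightarrow> 'a::complex_inner) \<Rightarrow> complex \<Rightarrow> 'a"
  where "mult_z \<equiv> mult_op (\<lambda>z x. z *\<^sub>C x)"

definition hardy_isometry ::
    "'a::complex_inner set \<Rightarrow> ((complex \<Rightarrow> 'a) \<Rightarrow> complex \<Rightarrow> 'a) \<Rightarrow> bool"
  where "hardy_isometry E V \<longleftrightarrow>
    (\<forall>f\<in>hardy E. V f \<in> hardy E) \<and>
    (\<forall>f\<in>hardy E. \<forall>g\<in>hardy E. V (\<lambda>z. f z + g z) = (\<lambda>z. V f z + V g z)) \<and>
    (\<forall>c. \<forall>f\<in>hardy E. V (\<lambda>z. c *\<^sub>C f z) = (\<lambda>z. c *\<^sub>C V f z)) \<and>
    (\<forall>f\<in>hardy E. hardy_norm (V f) = hardy_norm f)"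

definition isometry_into_hardy ::
    "'a::complex_inner set \<Rightarrow> ('a \<Rightarrow> complex \<Rightarrow> 'a) \<Rightarrow> bool"
  where "isometry_into_hardy E W \<longleftrightarrow>
    (\<forall>x. W x \<in> hardy E) \<and>
    (\<forall>x y. W (x + y) = (\<lambda>z. W x z + W y z)) \<and>
    (\<forall>c x. W (c *\<^sub>C x) = (\<lambda>z. c *\<^sub>C W x z)) \<and>
    (\<forall>x. hardy_norm (W x) = norm x)"

definition model_isometry ::
    "nat \<Rightarrow> 'a::complex_inner set \<Rightarrow> (nat \<Rightarrow> (complex \<Rightarrow> 'a) \<Rightarrow> complex \<Rightarrow> 'a) \<Rightarrow> bool"
  where "model_isometry n E V \<longleftrightarrow>
    (\<forall>i\<in>{1..n}. hardy_isometry E (V i)) \<and>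
    (\<forall>i\<in>{1..n}. \<forall>j\<in>{1..n}. \<forall>f\<in>hardy E. V i (V j f) = V j (V i f)) \<and>
    (\<exists>P U. \<forall>i\<in>{1..n}. orth_projection_on E (P i) \<and> unitary_on E (U i) \<and>
      (\<forall>f\<in>hardy E. V i f = mult_op (\<lambda>z x. U i (perp (P i) x) + z *\<^sub>C U i (P i x)) f)) \<and>
    (\<forall>f\<in>hardy E. foldr V [1..<Suc n] f = mult_z f)"

section \<open>Identification with a compression of a model\<close>

text \<open>\<open>W\<close> identifies the whole space with a subspace of the Hardy space of \<open>E\<close> so that the adjoint of
  \<open>T i\<close> becomes the restriction of the adjoint of \<open>V i\<close>.\<close>

definition intertwining_isometry ::
    "nat \<Rightarrow> (nat \<Rightarrow> 'a::complex_inner \<Rightarrow> 'a) \<Rightarrow> 'a set \<Rightarrow>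
      (nat \<Rightarrow> (complex \<Rightarrow> 'a) \<Rightarrow> complex \<Rightarrow> 'a) \<Rightarrow> ('a \<Rightarrow> complex \<Rightarrow> 'a) \<Rightarrow> bool"
  where "intertwining_isometry n T E V W \<longleftrightarrow> isometry_into_hardy E W \<and>
    (\<forall>i\<in>{1..n}. \<forall>x. hardy_adj E (V i) (W x) = W (adj (T i) x))"

text \<open>The identification is the Sz.-Nagy--Foias one (up to a unitary of \<open>E\<close>), that is, \<open>mult_z\<close> on
  the Hardy space of \<open>E\<close> is the minimal isometric dilation of the product: the functions
  \<open>z ^ k W x\<close> span a dense subspace. For \<open>E\<close> the defect space this is automatic if \<open>E\<close> is
  finite-dimensional, but not otherwise: take \<open>n = 2\<close>, \<open>T 1 = T 2 = 0\<close> on an infinite-dimensional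
  separable space, which embeds into a space of constants annihilated by the adjoints of both
  members of a model pair, so that an intertwining isometry exists although no projections and
  unitaries satisfy the conditions characterizing the model. (Finite sums of \<open>z ^ k W (h k)\<close> are all
  of the span, since \<open>W\<close> is linear.)\<close>

definition minimal_embedding :: "'a::complex_inner set \<Rightarrow> ('a \<Rightarrow> complex \<Rightarrow> 'a) \<Rightarrow> bool"
  where "minimal_embedding E W \<longleftrightarrow>
    (\<forall>f\<in>hardy E. \<forall>e>0. \<exists>N h. hardy_norm (\<lambda>z. f z - (\<Sum>k<N. (mult_z ^^ k) (W (h k)) z)) < e)"

definition has_model ::
    "nat \<Rightarrow> (nat \<Rightarrow> 'a::complex_inner \<Rightarrow> 'a) \<Rightarrow> 'a set \<Rightarrow>
      (nat \<Rightarrow> (complex \<Rightarrow> 'a) \<Rightarrow> complex \<Rightarrow> 'a) \<Rightarrow> bool"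
  where "has_model n T E V \<longleftrightarrow>
    (\<exists>W. intertwining_isometry n T E V W \<and> minimal_embedding E W)"

section \<open>The conditions on projections and unitaries\<close>

definition model_conditions ::
    "nat \<Rightarrow> (nat \<Rightarrow> 'a::complex_inner \<Rightarrow> 'a) \<Rightarrow> (nat \<Rightarrow> 'a \<Rightarrow> 'a) \<Rightarrow> (nat \<Rightarrow> 'a \<Rightarrow> 'a) \<Rightarrow> bool"
  where "model_conditions n T P U \<longleftrightarrow>
    (let S = foldr T [1..<Suc n]; D = defect_op_star S; E = defect_space_star S;
         Us = (\<lambda>i. adj_on E (U i)) in
      (\<forall>i\<in>{1..n}. orth_projection_on E (P i)) \<and>
      (\<forall>i\<in>{1..n}. unitary_on E (U i)) \<and>
      (\<forall>i\<in>{1..n}. \<forall>j\<in>{1..n}. \<forall>x\<in>E. U i (U j x) = U j (U i x)) \<and>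
      (\<forall>x\<in>E. foldr U [1..<Suc n] x = x) \<and>
      (\<forall>i\<in>{1..n}. \<forall>x.
        D (adj (T i) x) = perp (P i) (Us i (D x)) + P i (Us i (D (adj S x)))) \<and>
      (\<forall>i\<in>{1..n}. \<forall>j\<in>{1..n}. \<forall>x\<in>E.
        perp (P i) (Us i (perp (P j) (Us j x))) = perp (P j) (Us j (perp (P i) (Us i x)))) \<and>
      (\<forall>i\<in>{1..n}. \<forall>j\<in>{1..n}. \<forall>x\<in>E. U i (P i (U j (P j x))) = U j (P j (U i (P i x)))) \<and>
      (\<forall>x\<in>E. (\<Sum>i=1..n. foldr Us [1..<i] (P i (fold U [1..<i] x))) = x))"

end

theory Submission
  imports Defs
begin

text \<open>Write \<open>S\<close> for the product of the \<open>T i\<close>, \<open>D\<close> for the defect operator of \<open>S\<^sup>*\<close> and \<open>E\<close> for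
  the closure of its range. The operator-valued function of a model isometry, its symbol, is
  \<open>A i + z B i\<close> with \<open>A i = U i (1 - P i)\<close> and \<open>B i = U i P i\<close>, and its adjoint acts on power series
  coefficients as the weighted backward shift \<open>(A i)\<^sup>* f k + (B i)\<^sup>* f (k + 1)\<close>. There are three parts.

  The symbols commute and multiply to \<open>z\<close> if and only if projections and unitaries satisfy the
  conditions that do not mention the \<open>T i\<close> (\<open>symbol_relations_imp_tuple\<close>,
  \<open>symbol_tuple_imp_relations\<close>). Commutation is a comparison of the coefficients of a quadratic
  polynomial in \<open>z\<close>. For the product, expand around \<open>z = 1\<close>, where the symbols are the unitaries \<open>U i\<close>:
  with \<open>R i = U (i - 1) \<dots> U 1\<close> and \<open>Q i = (R i)\<^sup>* P i R i\<close> the product is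
  \<open>R (n + 1) (1 + (z - 1) (\<Sum>i. Q i))\<close> up to terms of higher order in \<open>z - 1\<close>. If it is \<open>z = 1 + (z - 1)\<close>,
  then \<open>R (n + 1) = 1\<close> and the \<open>Q i\<close> add up to the identity. Conversely, projections that add up to the
  identity are mutually orthogonal, and then there are no terms of higher order.

  If moreover the relations between \<open>D\<close> and the \<open>T i\<close> hold, the Sz.-Nagy--Foias embedding, which sends
  \<open>x\<close> to the function with coefficients \<open>D (S\<^sup>*) ^ k x\<close>, intertwines (\<open>model_of_conditions\<close>): it is
  isometric because \<open>norm (D x) ^ 2 = norm x ^ 2 - norm (S\<^sup>* x) ^ 2\<close> and the powers of \<open>S\<^sup>*\<close> tend to
  zero, and minimal because \<open>D h\<close> is the embedding of \<open>h\<close> minus \<open>z\<close> times that of \<open>S\<^sup>* h\<close>. Conversely, in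
  any minimal model the constant coefficient \<open>w x\<close> of the embedding of \<open>x\<close> determines the others and
  satisfies \<open>norm (w x) = norm (D x)\<close>, so a unitary of \<open>E\<close> carries \<open>D\<close> to \<open>w\<close>; conjugating the symbols
  by it gives the conditions (\<open>conditions_of_model\<close>).

  Uniqueness (\<open>model_conditions_unique\<close>) needs a second relation. The product of the model isometries
  other than the \<open>i\<close>-th has symbol \<open>(B i)\<^sup>* + z (A i)\<^sup>*\<close>, which gives
  \<open>B i D + A i D S\<^sup>* = D C\<close> with \<open>C\<close> the product of the other \<open>(T j)\<^sup>*\<close>. Subtracting these relations, and
  those for \<open>T i\<close>, for two solutions shows that the difference \<open>a\<close> of the operators \<open>A i\<close> satisfies
  \<open>cinner (a (D x)) (D y) = cinner (a (D (S\<^sup>* x))) (D (S\<^sup>* y))\<close>, and iterating drives this to zero.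

  The underlying theory of Hilbert spaces is developed as far as this needs it: adjoints through the
  Riesz representation, the positive square root through the binomial series, and the Hardy space
  through the uniqueness of power series coefficients.\<close>

section \<open>Complex inner product spaces\<close>

lemma scaleC_one [simp]: "1 *\<^sub>C x = (x::'a::complex_inner)"
  using scaleR_scaleC[of 1 x] by simp

lemma scaleC_zero_left [simp]: "0 *\<^sub>C x = (0::'a::complex_inner)"
  using scaleR_scaleC[of 0 x] by simp

lemma cinner_add_right: "cinner x (y + z) = cinner x y + cinner x (z::'a::complex_inner)"
  by (metis cinner_add_left cinner_commute complex_cnj_add)

lemma cinner_scaleC_right: "cinner x (c *\<^sub>C y) = cnj c * cinner x (y::'a::complex_inner)"
  by (metis cinner_commute cinner_scaleC_left complex_cnj_mult)

lemma cinner_self: "cinner x x = complex_of_real ((norm (x::'a::complex_inner))\<^sup>2)"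
proof (rule complex_eqI)
  show "Re (cinner x x) = Re (complex_of_real ((norm x)\<^sup>2))"
    using inner_eq_Re_cinner[of x x] by (simp add: power2_norm_eq_inner)
  have "Im (cinner x x) = - Im (cinner x x)"
    by (metis cinner_commute complex_cnj cnj.simps(2))
  then show "Im (cinner x x) = Im (complex_of_real ((norm x)\<^sup>2))" by simp
qed

lemma Re_cinner: "Re (cinner x y) = inner x (y::'a::complex_inner)"
  by (simp add: inner_eq_Re_cinner)

lemma Im_cinner: "Im (cinner x y) = inner x (\<i> *\<^sub>C (y::'a::complex_inner))"
  by (simp add: inner_eq_Re_cinner cinner_scaleC_right)

lemma norm_scaleC: "norm (c *\<^sub>C x) = cmod c * norm (x::'a::complex_inner)"
proof -
  have "complex_of_real ((norm (c *\<^sub>C x))\<^sup>2) = c * cnj c * complex_of_real ((norm x)\<^sup>2)"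
    by (simp only: cinner_self[symmetric] cinner_scaleC_left cinner_scaleC_right mult_ac)
  also have "\<dots> = complex_of_real ((cmod c * norm x)\<^sup>2)"
    by (simp add: complex_norm_square[symmetric] power_mult_distrib)
  finally have "(norm (c *\<^sub>C x))\<^sup>2 = (cmod c * norm x)\<^sup>2" by (simp only: of_real_eq_iff)
  then show ?thesis by (simp add: power2_eq_iff_nonneg)
qed

text \<open>A phase makes the inner product real and nonnegative, which reduces the claim to the real
  Cauchy--Schwarz inequality.\<close>

lemma norm_cinner_le: "cmod (cinner x y) \<le> norm x * norm (y::'a::complex_inner)"
proof (cases "cinner x y = 0")
  case False
  define c where "c = cnj (sgn (cinner x y))"
  have c: "cmod c = 1" using False by (simp add: c_def norm_sgn)
  have "complex_of_real (cmod (cinner x y)) = c * cinner x y"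
    using False unfolding c_def
    by (simp add: sgn_eq field_simps complex_norm_square[symmetric] power2_eq_square[symmetric])
  then have "cmod (cinner x y) = Re (cinner (c *\<^sub>C x) y)"
    by (metis Re_complex_of_real cinner_scaleC_left)
  also have "\<dots> \<le> norm (c *\<^sub>C x) * norm y"
    unfolding Re_cinner by (rule norm_cauchy_schwarz)
  finally show ?thesis using c by (simp add: norm_scaleC)
qed simp

lemma bounded_bilinear_cinner: "bounded_bilinear (cinner :: 'a::complex_inner \<Rightarrow> _)"
proof
  fix r x y
  show "cinner (r *\<^sub>R x) (y::'a) = r *\<^sub>R cinner x y"
    by (simp add: scaleR_scaleC[of r x] cinner_scaleC_left scaleR_conv_of_real)
  show "cinner (x::'a) (r *\<^sub>R y) = r *\<^sub>R cinner x y"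
    by (simp add: scaleR_scaleC[of r y] cinner_scaleC_right scaleR_conv_of_real)
  show "\<exists>K. \<forall>a b. cmod (cinner (a::'a) b) \<le> norm a * norm b * K"
    by (rule exI[of _ 1]) (simp add: norm_cinner_le)
qed (simp_all add: cinner_add_left cinner_add_right)

lemma bounded_bilinear_scaleC: "bounded_bilinear (scaleC :: complex \<Rightarrow> 'a::complex_inner \<Rightarrow> 'a)"
proof
  fix r c and x :: 'a
  show "(r *\<^sub>R c) *\<^sub>C x = r *\<^sub>R c *\<^sub>C x"
    by (simp add: scaleR_scaleC[of r "c *\<^sub>C x"] scaleC_scaleC scaleR_conv_of_real)
  show "c *\<^sub>C r *\<^sub>R x = r *\<^sub>R c *\<^sub>C x"
    by (simp add: scaleR_scaleC scaleC_scaleC mult.commute)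
  show "\<exists>K. \<forall>a b. norm (a *\<^sub>C (b::'a)) \<le> norm a * norm b * K"
    by (rule exI[of _ 1]) (simp add: norm_scaleC)
qed (simp_all add: scaleC_add_left scaleC_add_right)

lemmas cinner_zero_left [simp] = bounded_bilinear.zero_left[OF bounded_bilinear_cinner]
lemmas cinner_zero_right [simp] = bounded_bilinear.zero_right[OF bounded_bilinear_cinner]
lemmas cinner_minus_left = bounded_bilinear.minus_left[OF bounded_bilinear_cinner]
lemmas cinner_minus_right = bounded_bilinear.minus_right[OF bounded_bilinear_cinner]
lemmas cinner_diff_left = bounded_bilinear.diff_left[OF bounded_bilinear_cinner]
lemmas cinner_diff_right = bounded_bilinear.diff_right[OF bounded_bilinear_cinner]
lemmas cinner_sum_left = bounded_bilinear.sum_left[OF bounded_bilinear_cinner]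
lemmas tendsto_cinner = bounded_bilinear.tendsto[OF bounded_bilinear_cinner]
lemmas bounded_linear_cinner_left = bounded_bilinear.bounded_linear_left[OF bounded_bilinear_cinner]
lemmas scaleC_zero_right [simp] = bounded_bilinear.zero_right[OF bounded_bilinear_scaleC]
lemmas scaleC_minus_left = bounded_bilinear.minus_left[OF bounded_bilinear_scaleC]
lemmas scaleC_diff_left = bounded_bilinear.diff_left[OF bounded_bilinear_scaleC]
lemmas scaleC_diff_right = bounded_bilinear.diff_right[OF bounded_bilinear_scaleC]
lemmas scaleC_sum_right = bounded_bilinear.sum_right[OF bounded_bilinear_scaleC]
lemmas bounded_linear_scaleC_right = bounded_bilinear.bounded_linear_right[OF bounded_bilinear_scaleC]

lemmas cinner_simps = cinner_add_left cinner_add_right cinner_diff_left cinner_diff_right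
  cinner_scaleC_left cinner_scaleC_right cinner_minus_left cinner_minus_right

lemma cinner_eq_zero_iff [simp]: "cinner x x = 0 \<longleftrightarrow> x = (0::'a::complex_inner)"
  by (simp add: cinner_self)

lemma cinner_real_symmetric: "Im (cinner x y) = 0 \<Longrightarrow> cinner y x = cinner x (y::'a::complex_inner)"
  by (subst cinner_commute) (simp add: complex_eq_iff)

section \<open>Closed subspaces and their operators\<close>

definition closed_csubspace :: "'a::complex_inner set \<Rightarrow> bool"
  where "closed_csubspace E \<longleftrightarrow> closed E \<and> 0 \<in> E \<and>
    (\<forall>x\<in>E. \<forall>y\<in>E. x + y \<in> E) \<and> (\<forall>c. \<forall>x\<in>E. c *\<^sub>C x \<in> E)"

lemma closed_csubspace_UNIV [simp]: "closed_csubspace UNIV"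
  by (simp add: closed_csubspace_def)

lemma csubspace_closed: "closed_csubspace E \<Longrightarrow> closed E"
  and csubspace_zero: "closed_csubspace E \<Longrightarrow> 0 \<in> E"
  and csubspace_add: "closed_csubspace E \<Longrightarrow> x \<in> E \<Longrightarrow> y \<in> E \<Longrightarrow> x + y \<in> E"
  and csubspace_scaleC: "closed_csubspace E \<Longrightarrow> x \<in> E \<Longrightarrow> c *\<^sub>C x \<in> E"
  by (auto simp: closed_csubspace_def)

lemma csubspace_scaleR: "closed_csubspace E \<Longrightarrow> x \<in> E \<Longrightarrow> r *\<^sub>R x \<in> E"
  by (simp add: scaleR_scaleC csubspace_scaleC)

lemma csubspace_diff: "closed_csubspace E \<Longrightarrow> x \<in> E \<Longrightarrow> y \<in> E \<Longrightarrow> x - y \<in> E"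
  using csubspace_add[of E x "(-1) *\<^sub>C y"] csubspace_scaleC[of E y "-1"]
  by (simp add: scaleC_minus_left)

lemma csubspace_sum: "closed_csubspace E \<Longrightarrow> (\<And>i. i \<in> I \<Longrightarrow> f i \<in> E) \<Longrightarrow> sum f I \<in> E"
  by (induction I rule: infinite_finite_induct) (auto simp: csubspace_zero csubspace_add)


lemma csubspace_cinner_eqI:
  assumes "closed_csubspace E" "x \<in> E" "y \<in> E" "\<And>e. e \<in> E \<Longrightarrow> cinner e x = cinner e y"
  shows "x = y"
proof -
  have "cinner (x - y) (x - y) = 0"
    using assms(4)[OF csubspace_diff[OF assms(1-3)]] by (simp add: cinner_diff_right)
  then show ?thesis by simp
qed

lemma op_closed: "bounded_op_on E A \<Longrightarrow> x \<in> E \<Longrightarrow> A x \<in> E"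
  and op_add: "bounded_op_on E A \<Longrightarrow> x \<in> E \<Longrightarrow> y \<in> E \<Longrightarrow> A (x + y) = A x + A y"
  and op_scaleC: "bounded_op_on E A \<Longrightarrow> x \<in> E \<Longrightarrow> A (c *\<^sub>C x) = c *\<^sub>C A x"
  and op_bounded: "bounded_op_on E A \<Longrightarrow> \<exists>K. \<forall>x\<in>E. norm (A x) \<le> K * norm x"
  by (auto simp: bounded_op_on_def)

lemma op_zero: "bounded_op_on E A \<Longrightarrow> closed_csubspace E \<Longrightarrow> A 0 = 0"
  using op_scaleC[of E A 0 0] csubspace_zero[of E] by simp

lemma op_diff:
  assumes "bounded_op_on E A" "closed_csubspace E" "x \<in> E" "y \<in> E"
  shows "A (x - y) = A x - A y"
  using op_add[OF assms(1,3), of "(-1) *\<^sub>C y"] csubspace_scaleC[OF assms(2,4), of "-1"]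
    op_scaleC[OF assms(1,4), of "-1"]
  by (simp add: scaleC_minus_left)

lemma op_sum:
  assumes "bounded_op_on E A" "closed_csubspace E" "\<And>i. i \<in> I \<Longrightarrow> f i \<in> E"
  shows "A (sum f I) = (\<Sum>i\<in>I. A (f i))"
  using assms(3) by (induction I rule: infinite_finite_induct)
    (auto simp: op_zero[OF assms(1,2)] op_add[OF assms(1)] csubspace_sum[OF assms(2)])

lemma op_norm_bound:
  assumes "bounded_op_on E A"
  obtains K where "0 < K" "\<And>x. x \<in> E \<Longrightarrow> norm (A x) \<le> K * norm x"
proof -
  obtain K where K: "\<forall>x\<in>E. norm (A x) \<le> K * norm x" using op_bounded[OF assms] by blast
  have "norm (A x) \<le> (\<bar>K\<bar> + 1) * norm x" if "x \<in> E" for x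
  proof -
    have "K * norm x \<le> (\<bar>K\<bar> + 1) * norm x" by (rule mult_right_mono) auto
    then show ?thesis using K that by force
  qed
  then show ?thesis using that[of "\<bar>K\<bar> + 1"] by force
qed

lemma op_continuous_on:
  assumes "bounded_op_on E A" "closed_csubspace E"
  shows "continuous_on E A"
proof -
  obtain K where K: "0 < K" "\<And>x. x \<in> E \<Longrightarrow> norm (A x) \<le> K * norm x"
    using op_norm_bound[OF assms(1)] by blast
  have "K-lipschitz_on E A"
  proof (rule lipschitz_onI)
    fix x y assume "x \<in> E" "y \<in> E"
    then show "dist (A x) (A y) \<le> K * dist x y"
      using K(2)[OF csubspace_diff[OF assms(2)], of x y]
      by (simp add: dist_norm op_diff[OF assms])
  qed (use K in simp)
  then show ?thesis by (rule lipschitz_on_continuous_on)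
qed

lemma bounded_op_on_UNIV_linear: "bounded_op_on UNIV A \<Longrightarrow> bounded_linear A"
proof -
  assume A: "bounded_op_on UNIV A"
  then obtain K where K: "\<forall>x. norm (A x) \<le> K * norm x" using op_bounded[OF A] by blast
  show ?thesis
  proof
    show "A (x + y) = A x + A y" for x y using op_add[OF A] by simp
    show "A (r *\<^sub>R x) = r *\<^sub>R A x" for r x using op_scaleC[OF A] by (simp add: scaleR_scaleC)
    show "\<exists>K. \<forall>x. norm (A x) \<le> norm x * K" using K by (auto simp: mult.commute)
  qed
qed

lemma op_compose:
  assumes "bounded_op_on E A" "bounded_op_on E B"
  shows "bounded_op_on E (\<lambda>x. A (B x))"
proof -
  obtain K where K: "0 < K" "\<And>x. x \<in> E \<Longrightarrow> norm (A x) \<le> K * norm x"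
    using op_norm_bound[OF assms(1)] by blast
  obtain L where L: "0 < L" "\<And>x. x \<in> E \<Longrightarrow> norm (B x) \<le> L * norm x"
    using op_norm_bound[OF assms(2)] by blast
  have "norm (A (B x)) \<le> (K * L) * norm x" if "x \<in> E" for x
  proof -
    have "norm (A (B x)) \<le> K * norm (B x)" using K that op_closed[OF assms(2)] by blast
    also have "\<dots> \<le> K * (L * norm x)" using K(1) L(2)[OF that] by simp
    finally show ?thesis by (simp add: mult.assoc)
  qed
  then show ?thesis unfolding bounded_op_on_def
    using assms by (auto simp: op_closed op_add op_scaleC)
qed

lemma op_diff_op:
  assumes "bounded_op_on E A" "bounded_op_on E B" "closed_csubspace E"
  shows "bounded_op_on E (\<lambda>x. A x - B x)"
proof -
  obtain K where K: "0 < K" "\<And>x. x \<in> E \<Longrightarrow> norm (A x) \<le> K * norm x"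
    using op_norm_bound[OF assms(1)] by blast
  obtain L where L: "0 < L" "\<And>x. x \<in> E \<Longrightarrow> norm (B x) \<le> L * norm x"
    using op_norm_bound[OF assms(2)] by blast
  have "norm (A x - B x) \<le> (K + L) * norm x" if "x \<in> E" for x
    using norm_triangle_ineq4[of "A x" "B x"] K(2)[OF that] L(2)[OF that]
    by (simp add: distrib_right)
  then show ?thesis unfolding bounded_op_on_def
    using assms by (auto simp: op_closed op_add op_scaleC csubspace_diff scaleC_diff_right)
qed

lemma op_id: "bounded_op_on E (\<lambda>x. x)"
  unfolding bounded_op_on_def by (auto intro!: exI[of _ 1])

lemma op_perp: "bounded_op_on E P \<Longrightarrow> closed_csubspace E \<Longrightarrow> bounded_op_on E (perp P)"
  using op_diff_op[OF op_id] unfolding perp_def .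

text \<open>Operators on the defect space are compared on the range of the defect operator, where their
  values are known.\<close>

lemma op_eq_on_closure:
  assumes A: "bounded_op_on E A" "bounded_op_on E B" "closed_csubspace E"
    and "E = closure R" "\<And>x. x \<in> R \<Longrightarrow> A x = B x" "x \<in> E"
  shows "A x = B x"
proof -
  have "continuous_on (closure R) (\<lambda>x. A x - B x)"
    using op_continuous_on[OF op_diff_op[OF A] A(3)] assms(4) by simp
  then have "A x - B x = 0"
    by (rule continuous_constant_on_closure) (use assms in auto)
  then show ?thesis by simp
qed

section \<open>Adjoints\<close>

text \<open>The representing vector minimizes \<open>norm x ^ 2 - 2 * f x\<close>. By the parallelogram law any minimizing
  sequence is Cauchy, and the first variation at the limit vanishes.\<close>

lemma riesz_on_subspace:
  fixes E :: "'a::chilbert_space set"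
  assumes E: "closed_csubspace E"
    and add: "\<And>x y. x \<in> E \<Longrightarrow> y \<in> E \<Longrightarrow> f (x + y) = f x + f y"
    and scale: "\<And>r x. x \<in> E \<Longrightarrow> f (r *\<^sub>R x) = r * f x"
    and bound: "\<And>x. x \<in> E \<Longrightarrow> \<bar>f x\<bar> \<le> K * norm x"
  shows "\<exists>z\<in>E. \<forall>x\<in>E. f x = inner x z"
proof -
  define q where "q x = (norm x)\<^sup>2 - 2 * f x" for x
  have q_lower: "- K\<^sup>2 \<le> q x" if "x \<in> E" for x
  proof -
    have "0 \<le> (norm x - K)\<^sup>2" by simp
    then show ?thesis using bound[OF that] unfolding q_def power2_eq_square
      by (simp add: algebra_simps)
  qed
  define m where "m = (INF x\<in>E. q x)"
  have bdd: "bdd_below (q ` E)" using q_lower by (intro bdd_belowI2) auto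
  have m_le: "m \<le> q x" if "x \<in> E" for x unfolding m_def by (rule cINF_lower[OF bdd that])
  have "\<exists>x\<in>E. q x < m + inverse (real (Suc k))" for k
    using cInf_lessD[of "q ` E" "m + inverse (real (Suc k))"] csubspace_zero[OF E]
    unfolding m_def by force
  then obtain X where X: "\<And>k. X k \<in> E" "\<And>k. q (X k) < m + inverse (real (Suc k))" by metis
  have fdiff: "f (x - y) = f x - f y" if "x \<in> E" "y \<in> E" for x y
    using add[of x "(-1) *\<^sub>R y"] scale[of y "-1"] csubspace_scaleR[OF E that(2), of "-1"] that
    by simp
  have para: "(norm (x - y))\<^sup>2 \<le> 2 * (q x - m) + 2 * (q y - m)" if "x \<in> E" "y \<in> E" for x y
  proof -
    have mem: "(1/2) *\<^sub>R (x + y) \<in> E" using that by (intro csubspace_scaleR[OF E] csubspace_add[OF E])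
    have half: "f ((1/2) *\<^sub>R (x + y)) = (1/2) * (f x + f y)"
      by (simp only: scale[OF csubspace_add[OF E that]] add[OF that])
    have "(norm (x - y))\<^sup>2 = 2 * (norm x)\<^sup>2 + 2 * (norm y)\<^sup>2 - 4 * (norm ((1/2) *\<^sub>R (x + y)))\<^sup>2"
      unfolding power2_norm_eq_inner by (simp add: algebra_simps inner_commute)
    also have "\<dots> = 2 * q x + 2 * q y - 4 * q ((1/2) *\<^sub>R (x + y))"
      unfolding q_def half by argo
    also have "\<dots> \<le> 2 * (q x - m) + 2 * (q y - m)" using m_le[OF mem] by simp
    finally show ?thesis .
  qed
  have "Cauchy X"
  proof (rule metric_CauchyI)
    fix e :: real assume "0 < e"
    then obtain M where M: "inverse (real (Suc M)) < e\<^sup>2 / 4" using reals_Archimedean[of "e\<^sup>2/4"] by auto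
    have "dist (X i) (X j) < e" if "M \<le> i" "M \<le> j" for i j
    proof -
      have "q (X k) - m < e\<^sup>2 / 4" if "M \<le> k" for k
      proof -
        have "inverse (real (Suc k)) \<le> inverse (real (Suc M))" using that by (auto simp: field_simps)
        then show ?thesis using X(2)[of k] M by argo
      qed
      from this[OF that(1)] this[OF that(2)] have "(norm (X i - X j))\<^sup>2 < e\<^sup>2"
        using para[OF X(1) X(1), of i j] by argo
      then show ?thesis unfolding dist_norm using \<open>0 < e\<close> by (simp add: power_less_imp_less_base)
    qed
    then show "\<exists>M. \<forall>i\<ge>M. \<forall>j\<ge>M. dist (X i) (X j) < e" by blast
  qed
  then obtain z where z: "X \<longlonglongrightarrow> z" using Cauchy_convergent convergent_def by blast
  have zE: "z \<in> E" using closed_sequentially[OF csubspace_closed[OF E] _ z] X(1) by blast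
  have "(\<lambda>k. f (X k)) \<longlonglongrightarrow> f z"
  proof (rule LIM_zero_cancel, rule Lim_null_comparison)
    show "\<forall>\<^sub>F k in sequentially. norm (f (X k) - f z) \<le> K * norm (X k - z)"
      using bound[OF csubspace_diff[OF E X(1) zE]] by (simp add: fdiff X(1) zE)
    show "(\<lambda>k. K * norm (X k - z)) \<longlonglongrightarrow> 0"
      using tendsto_mult_right[OF tendsto_norm_zero[OF LIM_zero[OF z]], of K] by (simp add: mult.commute)
  qed
  then have q_lim: "(\<lambda>k. q (X k)) \<longlonglongrightarrow> q z" unfolding q_def by (intro tendsto_intros z)
  have m_lim: "(\<lambda>k. m + inverse (real (Suc k))) \<longlonglongrightarrow> m + 0"
    by (intro tendsto_intros LIMSEQ_inverse_real_of_nat)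
  have "q z \<le> m + 0" by (rule LIMSEQ_le[OF q_lim m_lim]) (use X(2) in \<open>auto intro: less_imp_le\<close>)
  then have qz: "q z \<le> m" by simp
  have "f x = inner x z" if x: "x \<in> E" for x
  proof (rule ccontr)
    define d where "d = inner x z - f x"
    define N where "N = (norm x)\<^sup>2"
    \<comment> \<open>Nearly the minimizer \<open>- d / N\<close> of \<open>2 * t * d + t\<^sup>2 * N\<close>; the summand \<open>1\<close> covers \<open>N = 0\<close>.\<close>
    define t where "t = - d / (N + 1)"
    assume "f x \<noteq> inner x z"
    then have d: "d \<noteq> 0" by (simp add: d_def)
    have N: "0 \<le> N" by (simp add: N_def)
    have "q z \<le> q (z + t *\<^sub>R x)" using qz m_le[of "z + t *\<^sub>R x"] x zE
      by (simp add: csubspace_add[OF E] csubspace_scaleR[OF E])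
    moreover have "(norm (z + t *\<^sub>R x))\<^sup>2 = (norm z)\<^sup>2 + 2 * t * inner x z + t\<^sup>2 * (norm x)\<^sup>2"
      unfolding power2_norm_eq_inner
      by (simp add: inner_commute[of z x] inner_add_left inner_add_right power2_eq_square algebra_simps)
    then have "q (z + t *\<^sub>R x) = q z + 2 * t * d + t\<^sup>2 * N"
      unfolding q_def d_def N_def using x zE
      by (simp add: add scale csubspace_scaleR[OF E] algebra_simps)
    moreover have "d = - t * (N + 1)" using N by (simp add: t_def)
    then have "2 * t * d + t\<^sup>2 * N = - (t\<^sup>2 * (N + 2))" by algebra
    moreover have "0 < t\<^sup>2 * (N + 2)" using d N by (simp add: t_def)
    ultimately show False by linarith
  qed
  then show ?thesis using zE by blast
qed

text \<open>Representing only the real part of \<open>cinner (A x) y\<close> suffices: the imaginary part is the real part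
  at \<open>- \<i> x\<close>.\<close>

lemma adjoint_exists:
  fixes E :: "'a::chilbert_space set"
  assumes E: "closed_csubspace E" and A: "bounded_op_on E A" and y: "y \<in> E"
  shows "\<exists>z\<in>E. \<forall>x\<in>E. cinner (A x) y = cinner x z"
proof -
  obtain K where K: "0 < K" "\<And>x. x \<in> E \<Longrightarrow> norm (A x) \<le> K * norm x"
    using op_norm_bound[OF A] by blast
  have "\<exists>z\<in>E. \<forall>x\<in>E. inner (A x) y = inner x z"
  proof (rule riesz_on_subspace[OF E, where K = "K * norm y"])
    fix x assume x: "x \<in> E"
    have "\<bar>inner (A x) y\<bar> \<le> norm (A x) * norm y" by (rule Cauchy_Schwarz_ineq2)
    also have "\<dots> \<le> (K * norm x) * norm y" using K(2)[OF x] by (simp add: mult_right_mono)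
    finally show "\<bar>inner (A x) y\<bar> \<le> K * norm y * norm x" by (simp add: mult_ac)
    show "inner (A (r *\<^sub>R x)) y = r * inner (A x) y" for r
      using op_scaleC[OF A x] by (metis inner_scaleR_left scaleR_scaleC)
  qed (simp add: op_add[OF A] inner_add_left)
  then obtain z where z: "z \<in> E" "\<And>x. x \<in> E \<Longrightarrow> inner (A x) y = inner x z" by blast
  have "cinner (A x) y = cinner x z" if x: "x \<in> E" for x
  proof (rule complex_eqI)
    show "Re (cinner (A x) y) = Re (cinner x z)" using z(2)[OF x] by (simp add: Re_cinner)
    have "Re (cinner (A (- \<i> *\<^sub>C x)) y) = Re (cinner (- \<i> *\<^sub>C x) z)"
      unfolding Re_cinner by (rule z(2)[OF csubspace_scaleC[OF E x]])
    then show "Im (cinner (A x) y) = Im (cinner x z)"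
      by (simp add: op_scaleC[OF A x] cinner_scaleC_left)
  qed
  then show ?thesis using z(1) by blast
qed

text \<open>The last premise says that \<open>ip\<close> separates the points of \<open>S\<close>, which makes the description of the
  adjoint determinate.\<close>

lemma adjoint_wrt_eqI:
  assumes "z \<in> S" "\<And>x. x \<in> S \<Longrightarrow> ip (A x) y = ip x z"
    and "\<And>u v. u \<in> S \<Longrightarrow> v \<in> S \<Longrightarrow> (\<And>x. x \<in> S \<Longrightarrow> ip x u = ip x v) \<Longrightarrow> u = v"
  shows "adjoint_wrt ip S A y = z"
  unfolding adjoint_wrt_def
proof (rule the_equality)
  show "z' = z" if "z' \<in> S \<and> (\<forall>x\<in>S. ip (A x) y = ip x z')" for z'
    using assms that by metis
qed (use assms in blast)

lemma adj_on_eqI: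
  assumes "closed_csubspace E" "z \<in> E" "\<And>x. x \<in> E \<Longrightarrow> cinner (A x) y = cinner x z"
  shows "adj_on E A y = z"
proof (rule adjoint_wrt_eqI)
  show "u = v" if "u \<in> E" "v \<in> E" "\<And>x. x \<in> E \<Longrightarrow> cinner x u = cinner x v" for u v
    by (rule csubspace_cinner_eqI[OF assms(1) that])
qed (use assms(2,3) in auto)

lemma projection_op: "orth_projection_on E P \<Longrightarrow> bounded_op_on E P"
  and projection_idem: "orth_projection_on E P \<Longrightarrow> x \<in> E \<Longrightarrow> P (P x) = P x"
  by (auto simp: orth_projection_on_def)

lemma unitary_op: "unitary_on E U \<Longrightarrow> bounded_op_on E U"
  and unitary_adj_left: "unitary_on E U \<Longrightarrow> x \<in> E \<Longrightarrow> adj_on E U (U x) = x"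
  and unitary_adj_right: "unitary_on E U \<Longrightarrow> x \<in> E \<Longrightarrow> U (adj_on E U x) = x"
  by (auto simp: unitary_on_def)

context
  fixes E :: "'a::chilbert_space set"
  assumes E: "closed_csubspace E"
begin

lemma adj_on_mem: "bounded_op_on E A \<Longrightarrow> y \<in> E \<Longrightarrow> adj_on E A y \<in> E"
  and cinner_adj_on: "bounded_op_on E A \<Longrightarrow> x \<in> E \<Longrightarrow> y \<in> E \<Longrightarrow> cinner (A x) y = cinner x (adj_on E A y)"
proof -
  assume A: "bounded_op_on E A" and y: "y \<in> E"
  obtain z where z: "z \<in> E" "\<And>x. x \<in> E \<Longrightarrow> cinner (A x) y = cinner x z"
    using adjoint_exists[OF E A y] by blast
  have *: "adj_on E A y = z" by (rule adj_on_eqI[where A = A and y = y, OF E z])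
  then show "adj_on E A y \<in> E" using z by simp
  show "x \<in> E \<Longrightarrow> cinner (A x) y = cinner x (adj_on E A y)" using z * by simp
qed

lemma cinner_adj_on_left: "bounded_op_on E A \<Longrightarrow> x \<in> E \<Longrightarrow> y \<in> E \<Longrightarrow> cinner (adj_on E A x) y = cinner x (A y)"
  by (metis cinner_adj_on cinner_commute)

lemma op_adj_on:
  assumes A: "bounded_op_on E A"
  shows "bounded_op_on E (adj_on E A)"
proof -
  obtain K where K: "0 < K" "\<And>x. x \<in> E \<Longrightarrow> norm (A x) \<le> K * norm x"
    using op_norm_bound[OF A] by blast
  have "norm (adj_on E A y) \<le> K * norm y" if y: "y \<in> E" for y
  proof -
    let ?z = "adj_on E A y"
    have z: "?z \<in> E" by (rule adj_on_mem[OF A y])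
    have "(norm ?z)\<^sup>2 = cmod (cinner ?z ?z)" by (simp add: cinner_self norm_power)
    also have "\<dots> = cmod (cinner (A ?z) y)" using cinner_adj_on[OF A z y] by simp
    also have "\<dots> \<le> norm (A ?z) * norm y" by (rule norm_cinner_le)
    also have "\<dots> \<le> (K * norm ?z) * norm y" using K(2)[OF z] by (simp add: mult_right_mono)
    finally have "norm ?z * norm ?z \<le> norm ?z * (K * norm y)" by (simp add: power2_eq_square mult_ac)
    then show ?thesis using K(1) by (cases "norm ?z = 0") (auto simp: mult_le_cancel_left)
  qed
  moreover have "adj_on E A (x + y) = adj_on E A x + adj_on E A y" if "x \<in> E" "y \<in> E" for x y
    using that by (intro adj_on_eqI[OF E])
      (auto simp: adj_on_mem[OF A] csubspace_add[OF E] cinner_add_right cinner_adj_on[OF A])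
  moreover have "adj_on E A (c *\<^sub>C x) = c *\<^sub>C adj_on E A x" if "x \<in> E" for x c
    using that by (intro adj_on_eqI[OF E])
      (auto simp: adj_on_mem[OF A] csubspace_scaleC[OF E] cinner_scaleC_right cinner_adj_on[OF A])
  ultimately show ?thesis unfolding bounded_op_on_def using adj_on_mem[OF A] by blast
qed

lemma projection_cinner:
  "orth_projection_on E P \<Longrightarrow> x \<in> E \<Longrightarrow> y \<in> E \<Longrightarrow> cinner (P x) y = cinner x (P y)"
  unfolding orth_projection_on_def using cinner_adj_on by metis

lemma projectionI:
  assumes "bounded_op_on E P" "\<And>x. x \<in> E \<Longrightarrow> P (P x) = P x"
    "\<And>x y. x \<in> E \<Longrightarrow> y \<in> E \<Longrightarrow> cinner (P x) y = cinner x (P y)"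
  shows "orth_projection_on E P"
  unfolding orth_projection_on_def using assms by (auto intro!: adj_on_eqI[OF E] simp: op_closed)

lemma projection_perp: "orth_projection_on E P \<Longrightarrow> orth_projection_on E (perp P)"
  by (rule projectionI)
    (auto simp: projection_op op_perp[OF _ E] perp_def projection_cinner cinner_diff_left cinner_diff_right
      op_diff[OF projection_op E] op_closed[OF projection_op] csubspace_diff[OF E] projection_idem)

lemma projection_pythagoras:
  assumes P: "orth_projection_on E P" and "x \<in> E" "y \<in> E"
  shows "(norm (perp P x + P y))\<^sup>2 = (norm (perp P x))\<^sup>2 + (norm (P y))\<^sup>2"
proof -
  have *: "cinner (perp P x) (P y) = 0"
    using assms by (simp add: perp_def cinner_diff_left projection_cinner[OF P, of _ "P y"]
      projection_cinner[OF P, of x y, symmetric] projection_idem[OF P] op_closed[OF projection_op[OF P]])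
  have "inner (perp P x) (P y) = 0" using * by (metis Re_cinner zero_complex.simps(1))
  then show ?thesis by (simp add: power2_norm_eq_inner inner_add_left inner_add_right inner_commute)
qed

lemma projection_norm_split:
  "orth_projection_on E P \<Longrightarrow> x \<in> E \<Longrightarrow> (norm x)\<^sup>2 = (norm (perp P x))\<^sup>2 + (norm (P x))\<^sup>2"
  using projection_pythagoras[of P x x] by (simp add: perp_def)

lemma unitary_norm: "unitary_on E U \<Longrightarrow> x \<in> E \<Longrightarrow> norm (U x) = norm x"
proof -
  assume U: "unitary_on E U" and x: "x \<in> E"
  have "cinner (U x) (U x) = cinner x x"
    using cinner_adj_on[OF unitary_op[OF U] x op_closed[OF unitary_op[OF U] x]]
    by (simp add: unitary_adj_left[OF U x])
  then have "(norm (U x))\<^sup>2 = (norm x)\<^sup>2" by (simp only: cinner_self of_real_eq_iff)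
  then show ?thesis by (simp add: power2_eq_iff_nonneg)
qed

lemma unitaryI:
  assumes U: "bounded_op_on E U" and V: "\<And>x. x \<in> E \<Longrightarrow> V x \<in> E \<and> V (U x) = x \<and> U (V x) = x"
    and "\<And>x y. x \<in> E \<Longrightarrow> y \<in> E \<Longrightarrow> cinner (U x) (U y) = cinner x y"
  shows "unitary_on E U" "\<And>x. x \<in> E \<Longrightarrow> adj_on E U x = V x"
proof -
  show *: "\<And>x. x \<in> E \<Longrightarrow> adj_on E U x = V x"
    using assms by (intro adj_on_eqI[OF E]) metis+
  show "unitary_on E U" unfolding unitary_on_def using assms * op_closed[OF U] by auto
qed

end

lemma unitary_adj_unitary:
  assumes E: "closed_csubspace (E::'a::chilbert_space set)" and U: "unitary_on E U"
  shows "unitary_on E (adj_on E U)"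
proof (rule unitaryI(1)[OF E, where V = U])
  show "bounded_op_on E (adj_on E U)" by (rule op_adj_on[OF E unitary_op[OF U]])
  show "cinner (adj_on E U x) (adj_on E U y) = cinner x y" if "x \<in> E" "y \<in> E" for x y
    using cinner_adj_on[OF E unitary_op[OF U], of "adj_on E U x" y] that
    by (simp add: adj_on_mem[OF E unitary_op[OF U]] unitary_adj_right[OF U])
qed (simp add: op_closed[OF unitary_op[OF U]] unitary_adj_left[OF U] unitary_adj_right[OF U])

section \<open>Positive square roots\<close>

instance chilbert_space \<subseteq> banach ..

lemma infsum_bounded_linear:
  "bounded_linear h \<Longrightarrow> f summable_on A \<Longrightarrow> infsum (\<lambda>x. h (f x)) A = h (infsum f A)"
  using has_sum_bounded_linear[OF _ has_sum_infsum] infsumI by blast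

text \<open>The Taylor coefficients of \<open>(1 - t)\<close> to the power \<open>1/2\<close>.\<close>

definition sqrt_coeff :: "nat \<Rightarrow> real"
  where "sqrt_coeff k = (- 1) ^ k * ((1/2) gchoose k)"

text \<open>By the Vandermonde identity the square of the series has the coefficients of \<open>(1 - t) ^ 1\<close>.\<close>

lemma sqrt_coeff_convolution:
  "(\<Sum>k\<le>m. sqrt_coeff k * sqrt_coeff (m - k)) = (if m = 0 then 1 else if m = 1 then - 1 else 0)"
proof -
  have "(\<Sum>k\<le>m. sqrt_coeff k * sqrt_coeff (m - k))
      = (\<Sum>k=0..m. (- 1) ^ m * (((1/2) gchoose k) * ((1/2) gchoose (m - k))))"
  proof (rule sum.cong)
    fix k assume "k \<in> {0..m}"
    then have "(- 1) ^ m = (- 1) ^ k * (- 1 :: real) ^ (m - k)" by (simp flip: power_add)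
    then show "sqrt_coeff k * sqrt_coeff (m - k) = (- 1) ^ m * (((1/2) gchoose k) * ((1/2) gchoose (m - k)))"
      by (simp add: sqrt_coeff_def mult_ac)
  qed auto
  also have "\<dots> = (- 1) ^ m * (1 gchoose m)"
    unfolding sum_distrib_left[symmetric] gbinomial_Vandermonde by simp
  also have "(1 gchoose m) = real (1 choose m)" using binomial_gbinomial[of 1 m, where 'a = real] by simp
  finally show ?thesis by (simp add: binomial_eq_0)
qed

lemma sqrt_coeff_0: "sqrt_coeff 0 = 1"
  by (simp add: sqrt_coeff_def)

lemma sqrt_coeff_Suc: "sqrt_coeff (Suc k) = sqrt_coeff k * ((real k - 1/2) / (real k + 1))"
  by (simp add: sqrt_coeff_def gbinomial_prod_rev field_simps)

lemma sqrt_coeff_nonpos: "sqrt_coeff (Suc k) \<le> 0"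
proof (induction k)
  case 0
  then show ?case by (simp add: sqrt_coeff_Suc sqrt_coeff_0)
next
  case (Suc k)
  then show ?case by (subst sqrt_coeff_Suc) (rule mult_nonpos_nonneg, simp_all)
qed

text \<open>All coefficients but the zeroth are nonpositive, while the partial sums have the closed form
  \<open>(- 1) ^ m * ((- 1/2) gchoose m) \<ge> 0\<close>. So the nonpositive coefficients add up to at least \<open>- 1\<close>.\<close>

lemma sum_abs_sqrt_coeff_le: "finite F \<Longrightarrow> (\<Sum>k\<in>F. \<bar>sqrt_coeff k\<bar>) \<le> 2"
proof -
  assume "finite F"
  then obtain m where m: "F \<subseteq> {..m}" using finite_nat_iff_bounded_le by blast
  have "\<bar>sqrt_coeff k\<bar> = (if k = 0 then 2 else 0) - sqrt_coeff k" for k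
    using sqrt_coeff_nonpos by (cases k) (auto simp: sqrt_coeff_0)
  then have "(\<Sum>k\<le>m. \<bar>sqrt_coeff k\<bar>) = 2 - (\<Sum>k\<le>m. sqrt_coeff k)"
    by (simp add: sum_subtractf)
  also have "(\<Sum>k\<le>m. sqrt_coeff k) = (- 1) ^ m * ((- 1/2) gchoose m)"
    using gbinomial_sum_lower_neg[of "1/2 :: real" m] by (simp add: sqrt_coeff_def mult.commute)
  also have "\<dots> = (\<Prod>i=0..<m. 1/2 + real i) / fact m"
  proof -
    have "(\<Prod>i=0..<m. - (1/2) - real i) = (- 1) ^ m * (\<Prod>i=0..<m. 1/2 + real i)"
      by (induction m) (auto simp: algebra_simps)
    then show ?thesis by (simp add: gbinomial_prod_rev flip: power_mult_distrib mult.assoc)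
  qed
  finally have "(\<Sum>k\<le>m. \<bar>sqrt_coeff k\<bar>) \<le> 2" by (simp add: prod_nonneg)
  moreover have "(\<Sum>k\<in>F. \<bar>sqrt_coeff k\<bar>) \<le> (\<Sum>k\<le>m. \<bar>sqrt_coeff k\<bar>)"
    using m by (intro sum_mono2) auto
  ultimately show ?thesis by linarith
qed

lemma sqrt_coeff_abs_summable: "(\<lambda>k. norm (sqrt_coeff k)) summable_on UNIV"
  by (rule nonneg_bdd_above_summable_on) (auto intro!: bdd_aboveI2[where M = 2] simp: sum_abs_sqrt_coeff_le)

lemma infsum_abs_sqrt_coeff_le: "(\<Sum>\<^sub>\<infinity>k. \<bar>sqrt_coeff k\<bar>) \<le> 2"
  by (rule infsum_le_finite_sums) (use sqrt_coeff_abs_summable sum_abs_sqrt_coeff_le in auto)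

text \<open>Because the coefficients are absolutely summable, the series converges for every operator of norm
  at most \<open>1\<close>.\<close>

definition sqrt_series :: "('a::chilbert_space \<Rightarrow> 'a) \<Rightarrow> 'a \<Rightarrow> 'a"
  where "sqrt_series A x = (\<Sum>\<^sub>\<infinity>k. sqrt_coeff k *\<^sub>R (A ^^ k) x)"

lemma op_power:
  assumes "bounded_op_on UNIV A"
  shows "bounded_op_on UNIV (A ^^ k)"
proof (induction k)
  case 0
  then show ?case using op_id by (simp add: id_def)
next
  case (Suc k)
  then show ?case using op_compose[OF assms Suc] by (simp add: o_def)
qed

context
  fixes A :: "'a::chilbert_space \<Rightarrow> 'a"
  assumes A: "bounded_op_on UNIV A" and contr: "\<And>x. norm (A x) \<le> norm x"
    and sym: "\<And>x y. cinner (A x) y = cinner x (A y)"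
begin

lemma op_power_norm: "norm ((A ^^ k) x) \<le> norm x"
  by (induction k) (auto intro: order_trans[OF contr])

lemma sqrt_series_abs_summable: "(\<lambda>k. norm (sqrt_coeff k *\<^sub>R (A ^^ k) x)) summable_on UNIV"
proof (rule Infinite_Sum.abs_summable_on_comparison_test[where g = "\<lambda>k. norm x * sqrt_coeff k"])
  show "(\<lambda>k. norm (norm x * sqrt_coeff k)) summable_on UNIV"
    using summable_on_cmult_right[OF sqrt_coeff_abs_summable, of "norm x"] by (simp add: abs_mult)
  show "norm (sqrt_coeff k *\<^sub>R (A ^^ k) x) \<le> norm (norm x * sqrt_coeff k)" for k
    using mult_right_mono[OF op_power_norm[of k x], of "\<bar>sqrt_coeff k\<bar>"] by (simp add: abs_mult mult.commute)
qed

lemmas sqrt_series_summable = abs_summable_summable[OF sqrt_series_abs_summable]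

text \<open>The series is a limit of polynomials in \<open>A\<close>.\<close>

lemma sqrt_series_commute:
  assumes "bounded_linear C" "\<And>x. C (A x) = A (C x)"
  shows "C (sqrt_series A x) = sqrt_series A (C x)"
proof -
  have "C ((A ^^ k) x) = (A ^^ k) (C x)" for k by (induction k) (simp_all add: assms(2))
  moreover have "C (r *\<^sub>R x) = r *\<^sub>R C x" for r x by (rule linear_simps(5)[OF assms(1)])
  ultimately show ?thesis unfolding sqrt_series_def
    using infsum_bounded_linear[OF assms(1) sqrt_series_summable[of x]] by simp
qed

lemma op_sqrt_series: "bounded_op_on UNIV (sqrt_series A)"
proof -
  have "sqrt_series A (x + y) = sqrt_series A x + sqrt_series A y" for x y
    unfolding sqrt_series_def using infsum_add[OF sqrt_series_summable sqrt_series_summable, of x y]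
    by (simp add: op_add[OF op_power[OF A]] scaleR_add_right)
  moreover have "sqrt_series A (c *\<^sub>C x) = c *\<^sub>C sqrt_series A x" for c x
    by (rule sqrt_series_commute[symmetric]) (auto simp: bounded_linear_scaleC_right op_scaleC[OF A])
  moreover have "norm (sqrt_series A x) \<le> 2 * norm x" for x
  proof -
    have "norm (sqrt_series A x) \<le> (\<Sum>\<^sub>\<infinity>k. norm (sqrt_coeff k *\<^sub>R (A ^^ k) x))"
      unfolding sqrt_series_def by (rule norm_infsum_bound[OF sqrt_series_abs_summable])
    also have "\<dots> \<le> (\<Sum>\<^sub>\<infinity>k. \<bar>sqrt_coeff k\<bar> * norm x)"
      using sqrt_coeff_abs_summable by (intro infsum_mono sqrt_series_abs_summable summable_on_cmult_left)
        (auto intro: mult_left_mono op_power_norm)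
    also have "\<dots> = (\<Sum>\<^sub>\<infinity>k. \<bar>sqrt_coeff k\<bar>) * norm x" by (rule infsum_cmult_left')
    finally show ?thesis using mult_right_mono[OF infsum_abs_sqrt_coeff_le, of "norm x"] by simp
  qed
  ultimately show ?thesis unfolding bounded_op_on_def by auto
qed

lemma op_power_sym: "cinner ((A ^^ k) x) y = cinner x ((A ^^ k) y)"
  by (induction k arbitrary: x y) (simp_all add: sym funpow_swap1)

text \<open>The term at \<open>k = 0\<close> is \<open>norm x ^ 2\<close>, and the other coefficients have absolute sum at most \<open>1\<close>.\<close>

lemma positive_sqrt_series: "positive_op (sqrt_series A)"
proof -
  have "Im (cinner (sqrt_series A x) x) = 0 \<and> 0 \<le> Re (cinner (sqrt_series A x) x)" for x
  proof -
    define t where "t k = Re (cinner ((A ^^ k) x) x)" for k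
    have real: "cinner ((A ^^ k) x) x = of_real (t k)" for k
    proof -
      have "cinner ((A ^^ k) x) x = cnj (cinner ((A ^^ k) x) x)"
        by (metis op_power_sym cinner_commute)
      then have "Im (cinner ((A ^^ k) x) x) = 0" by (metis Im_complex_of_real Reals_cnj_iff complex_is_Real_iff)
      then show ?thesis by (simp add: t_def complex_eq_iff)
    qed
    have bl: "bounded_linear (\<lambda>v. cinner v x)" by (rule bounded_linear_cinner_left)
    have scale: "cinner (r *\<^sub>R v) x = of_real r * cinner v x" for r v
      by (simp add: scaleR_scaleC cinner_scaleC_left)
    have eq: "cinner (sqrt_series A x) x = (\<Sum>\<^sub>\<infinity>k. of_real (sqrt_coeff k * t k))"
      unfolding sqrt_series_def
      using infsum_bounded_linear[OF bl sqrt_series_summable[of x]] by (simp add: scale real)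
    have summ: "(\<lambda>k. sqrt_coeff k * t k) summable_on UNIV"
      using summable_on_bounded_linear[OF bounded_linear_compose[OF bounded_linear_Re bl] sqrt_series_summable[of x]]
      by (simp add: scale real)
    have eq2: "cinner (sqrt_series A x) x = of_real (\<Sum>\<^sub>\<infinity>k. sqrt_coeff k * t k)"
      unfolding eq by (rule infsum_bounded_linear[OF bounded_linear_of_real summ])
    let ?N = "(norm x)\<^sup>2"
    have summ2: "(\<lambda>k. \<bar>sqrt_coeff k\<bar> * ?N) summable_on UNIV"
      using sqrt_coeff_abs_summable by (intro summable_on_cmult_left) auto
    have t_bound: "\<bar>t k\<bar> \<le> ?N" for k
    proof -
      have "\<bar>t k\<bar> \<le> norm ((A ^^ k) x) * norm x"
        using norm_cinner_le[of "(A ^^ k) x" x] by (simp add: real)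
      then show ?thesis using mult_right_mono[OF op_power_norm[of k x], of "norm x"] by (simp add: power2_eq_square)
    qed
    \<comment> \<open>Every term of the sum below is nonnegative, and the term at \<open>k = 0\<close> is already \<open>2 * ?N\<close>.\<close>
    have nonneg: "0 \<le> sqrt_coeff k * t k + \<bar>sqrt_coeff k\<bar> * ?N" for k
      using mult_left_mono[OF t_bound[of k], of "\<bar>sqrt_coeff k\<bar>"] abs_mult[of "sqrt_coeff k" "t k"] by linarith
    have "2 * ?N = (\<Sum>k\<in>{0}. sqrt_coeff k * t k + \<bar>sqrt_coeff k\<bar> * ?N)"
      by (simp add: sqrt_coeff_0 t_def cinner_self)
    also have "\<dots> \<le> (\<Sum>\<^sub>\<infinity>k. sqrt_coeff k * t k + \<bar>sqrt_coeff k\<bar> * ?N)"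
      by (rule finite_sum_le_infsum) (auto intro: nonneg summable_on_add summ summ2)
    also have "\<dots> = (\<Sum>\<^sub>\<infinity>k. sqrt_coeff k * t k) + (\<Sum>\<^sub>\<infinity>k. \<bar>sqrt_coeff k\<bar>) * ?N"
      by (simp add: infsum_add[OF summ summ2] infsum_cmult_left')
    also have "\<dots> \<le> (\<Sum>\<^sub>\<infinity>k. sqrt_coeff k * t k) + 2 * ?N"
      using mult_right_mono[OF infsum_abs_sqrt_coeff_le, of ?N] by simp
    finally have "0 \<le> (\<Sum>\<^sub>\<infinity>k. sqrt_coeff k * t k)" by simp
    then show ?thesis unfolding eq2 by simp
  qed
  then show ?thesis unfolding positive_op_def using op_sqrt_series by blast
qed

text \<open>The double series is rearranged along its antidiagonals, on which the powers of \<open>A\<close> agree.\<close>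

lemma sqrt_series_squared: "sqrt_series A (sqrt_series A x) = x - A x"
proof -
  define f where "f = (\<lambda>(j, k). (sqrt_coeff j * sqrt_coeff k) *\<^sub>R (A ^^ (j + k)) x)"
  have inner: "sqrt_coeff j *\<^sub>R (A ^^ j) (sqrt_series A x) = (\<Sum>\<^sub>\<infinity>k. f (j, k))" for j
  proof -
    have bl: "bounded_linear (\<lambda>v. sqrt_coeff j *\<^sub>R (A ^^ j) v)"
      by (rule bounded_linear_compose[OF bounded_linear_scaleR_right bounded_op_on_UNIV_linear[OF op_power[OF A]]])
    have "(A ^^ j) (r *\<^sub>R v) = r *\<^sub>R (A ^^ j) v" for r v
      by (rule linear_simps(5)[OF bounded_op_on_UNIV_linear[OF op_power[OF A]]])
    then show ?thesis
      using infsum_bounded_linear[OF bl sqrt_series_summable[of x]]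
      unfolding sqrt_series_def f_def by (simp add: funpow_add)
  qed
  have "(\<lambda>p. norm (case p of (j, k) \<Rightarrow> sqrt_coeff j * sqrt_coeff k)) summable_on UNIV \<times> UNIV"
    using sqrt_coeff_abs_summable
    by (subst Infinite_Sum.abs_summable_on_Sigma_iff) (auto simp: abs_mult infsum_cmult_right' intro!: summable_on_cmult_right summable_on_cmult_left)
  then have "(\<lambda>p. norm (norm x * (case p of (j, k) \<Rightarrow> sqrt_coeff j * sqrt_coeff k))) summable_on UNIV \<times> UNIV"
    using summable_on_cmult_right[of _ _ "norm x"] by (simp add: abs_mult)
  then have "(\<lambda>p. norm (f p)) summable_on UNIV \<times> UNIV"
  proof (rule Infinite_Sum.abs_summable_on_comparison_test)
    fix p :: "nat \<times> nat"
    obtain j k where p: "p = (j, k)" by (cases p)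
    show "norm (f p) \<le> norm (norm x * (case p of (j, k) \<Rightarrow> sqrt_coeff j * sqrt_coeff k))"
      using mult_right_mono[OF op_power_norm[of "j + k" x], of "\<bar>sqrt_coeff j * sqrt_coeff k\<bar>"]
      by (simp add: f_def p abs_mult mult_ac)
  qed
  then have fsum: "f summable_on UNIV \<times> UNIV" by (rule abs_summable_summable)
  define S where "S = Sigma (UNIV :: nat set) (\<lambda>m. {..m})"
  define g where "g = (\<lambda>(m, k). f (m - k, k))"
  have gsum: "g summable_on S"
  proof -
    define h where "h = (\<lambda>(j, k). (j + k, k :: nat))"
    have img: "h ` (UNIV \<times> UNIV) = S"
      unfolding S_def h_def by (auto simp: image_iff) (metis add.commute le_Suc_ex)
    have inj: "inj_on h (UNIV \<times> UNIV)" by (auto simp: inj_on_def h_def)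
    have "g \<circ> h = f" by (auto simp: g_def h_def)
    then show ?thesis using fsum summable_on_reindex[OF inj, of g] img by simp
  qed
  have "sqrt_series A (sqrt_series A x) = (\<Sum>\<^sub>\<infinity>j. \<Sum>\<^sub>\<infinity>k. f (j, k))"
    unfolding inner[symmetric] by (simp add: sqrt_series_def)
  also have "\<dots> = infsum f (UNIV \<times> UNIV)" using infsum_Sigma_banach[OF fsum] by simp
  also have "\<dots> = infsum g S"
    by (rule infsum_reindex_bij_witness[where i = "\<lambda>(m, k). (m - k, k)" and j = "\<lambda>(j, k). (j + k, k)"])
      (auto simp: S_def g_def)
  also have "\<dots> = (\<Sum>\<^sub>\<infinity>m. \<Sum>\<^sub>\<infinity>k\<in>{..m}. g (m, k))" unfolding S_def
    by (rule infsum_Sigma_banach[symmetric]) (use gsum S_def in simp)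
  also have "\<dots> = (\<Sum>\<^sub>\<infinity>m. (\<Sum>k\<le>m. sqrt_coeff k * sqrt_coeff (m - k)) *\<^sub>R (A ^^ m) x)"
    unfolding scaleR_sum_left by (rule infsum_cong) (auto simp: g_def f_def mult.commute intro!: sum.cong)
  also have "\<dots> = infsum (\<lambda>m. (if m = 0 then 1 else if m = 1 then - 1 else 0) *\<^sub>R (A ^^ m) x) {0, 1}"
    unfolding sqrt_coeff_convolution by (rule infsum_cong_neutral) auto
  also have "\<dots> = x - A x" by simp
  finally show ?thesis .
qed

end

text \<open>Polarization. This fails over the reals: the imaginary unit in the second expansion is what makes a
  real quadratic form come from a symmetric operator.\<close>

lemma positive_op_sym:
  assumes "positive_op S"
  shows "cinner (S x) y = cinner x (S y)"
proof -
  have S: "bounded_op_on UNIV S" using assms by (simp add: positive_op_def)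
  have real: "cinner (S v) v = cinner v (S v)" for v
    using assms by (metis cinner_real_symmetric positive_op_def)
  have 1: "cinner (S x) y + cinner (S y) x = cinner x (S y) + cinner y (S x)"
    using real[of "x + y"] real[of x] real[of y] op_add[OF S]
    by (simp add: cinner_simps algebra_simps)
  have 2: "- \<i> * cinner (S x) y + \<i> * cinner (S y) x = - \<i> * cinner x (S y) + \<i> * cinner y (S x)"
    using real[of "x + \<i> *\<^sub>C y"] real[of x] real[of y]
    by (simp add: cinner_simps op_add[OF S] op_scaleC[OF S] algebra_simps)
  then have "\<i> * (cinner (S y) x - cinner (S x) y) = \<i> * (cinner y (S x) - cinner x (S y))"
    by (simp add: algebra_simps)
  then have "cinner (S y) x - cinner (S x) y = cinner y (S x) - cinner x (S y)"
    by (simp only: mult_cancel_left complex_i_not_zero simp_thms)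
  with 1 have "2 * cinner (S x) y = 2 * cinner x (S y)" by algebra
  then show ?thesis by simp
qed

text \<open>Otherwise the quadratic form would be negative at \<open>y + t * S y\<close> for some small negative \<open>t\<close>.\<close>

lemma positive_op_null:
  assumes pos: "positive_op S" and y: "cinner (S y) y = 0"
  shows "S y = 0"
proof -
  have S: "bounded_op_on UNIV S" using pos by (simp add: positive_op_def)
  define v where "v = S y"
  define a where "a = (norm v)\<^sup>2"
  define b where "b = Re (cinner (S v) v)"
  have b: "0 \<le> b" using pos by (simp add: positive_op_def b_def)
  have expand: "0 \<le> 2 * t * a + t\<^sup>2 * b" for t :: real
  proof -
    have vy: "cinner (S v) y = cinner v v" by (simp add: positive_op_sym[OF pos] v_def)
    have "cinner (S (y + of_real t *\<^sub>C v)) (y + of_real t *\<^sub>C v)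
        = of_real (2 * t * a) + of_real (t\<^sup>2) * cinner (S v) v"
      using y by (simp add: op_add[OF S] op_scaleC[OF S] cinner_simps vy v_def[symmetric] cinner_self a_def
        power2_eq_square algebra_simps)
    then have "Re (cinner (S (y + of_real t *\<^sub>C v)) (y + of_real t *\<^sub>C v)) = 2 * t * a + t\<^sup>2 * b"
      by (simp add: b_def)
    then show ?thesis using pos by (metis positive_op_def)
  qed
  define t where "t = - a / (b + 1)"
  have a: "a = - t * (b + 1)" using b by (simp add: t_def)
  have "2 * t * a + t\<^sup>2 * b = - (t\<^sup>2 * (b + 2))" using a by algebra
  with expand[of t] have "t\<^sup>2 * (b + 2) \<le> 0" by linarith
  moreover have "0 < b + 2" using b by linarith
  ultimately have "t\<^sup>2 \<le> 0" by (metis mult_le_0_iff not_less)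
  then have "t = 0" by simp
  then have "a = 0" using a by simp
  then show ?thesis by (simp add: a_def v_def)
qed

text \<open>A positive square root \<open>S\<close> of \<open>I - A\<close> commutes with \<open>A\<close> and hence with the series \<open>D\<close>. So
  \<open>D\<^sup>2 = S\<^sup>2\<close> gives \<open>(D + S) (D - S) = 0\<close>, and positivity makes both \<open>D\<close> and \<open>S\<close> vanish on the range
  of \<open>D - S\<close>. Then \<open>(D - S)\<^sup>2 = 0\<close>, and \<open>D - S\<close> is symmetric.\<close>

lemma positive_sqrt_unique:
  fixes A :: "'a::chilbert_space \<Rightarrow> 'a"
  assumes A: "bounded_op_on UNIV A" "\<And>x. norm (A x) \<le> norm x" "\<And>x y. cinner (A x) y = cinner x (A y)"
    and S: "positive_op S" "\<And>x. S (S x) = x - A x"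
  shows "S = sqrt_series A"
proof
  fix x
  let ?D = "sqrt_series A"
  have D: "positive_op ?D" "\<And>x. ?D (?D x) = x - A x"
    using positive_sqrt_series[OF A] sqrt_series_squared[OF A] by blast+
  have opS: "bounded_op_on UNIV S" and opD: "bounded_op_on UNIV ?D"
    using S D by (simp_all add: positive_op_def)
  have "S (A v) = A (S v)" for v
  proof -
    have "S (v - A v) = S v - A (S v)" using S(2)[of "S v"] S(2)[of v] by metis
    then show ?thesis using op_diff[OF opS closed_csubspace_UNIV, of v "A v"] by simp
  qed
  then have comm: "S (?D v) = ?D (S v)" for v
    by (rule sqrt_series_commute[OF A bounded_op_on_UNIV_linear[OF opS]])
  define y where "y = ?D x - S x"
  have y: "?D y + S y = 0"
    by (simp add: y_def op_diff[OF opD closed_csubspace_UNIV] op_diff[OF opS closed_csubspace_UNIV] comm D S)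
  then have "cinner (?D y) y + cinner (S y) y = 0" by (metis cinner_add_left cinner_zero_left)
  moreover have "Im (cinner (?D y) y) = 0 \<and> 0 \<le> Re (cinner (?D y) y)"
    "Im (cinner (S y) y) = 0 \<and> 0 \<le> Re (cinner (S y) y)"
    using D(1) S(1) by (simp_all add: positive_op_def)
  ultimately have "cinner (?D y) y = 0" "cinner (S y) y = 0" by (auto simp: complex_eq_iff)
  then have "?D y = 0" "S y = 0" using positive_op_null D(1) S(1) by blast+
  then have "cinner y y = 0"
    by (subst (1) y_def) (simp add: cinner_diff_left positive_op_sym[OF D(1)] positive_op_sym[OF S(1)])
  then show "S x = ?D x" by (simp add: y_def)
qed

lemma closure_limI:
  fixes x :: "'a::real_normed_vector"
  assumes "\<And>k. u k \<in> R" "u \<longlonglongrightarrow> x"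
  shows "x \<in> closure R"
  unfolding closure_sequential using assms by (intro exI[of _ u]) simp

section \<open>Contractions and their defect operators\<close>

lemma contraction_op: "contraction T \<Longrightarrow> bounded_op_on UNIV T"
  by (simp add: contraction_def)

lemma contraction_norm:
  assumes "contraction T"
  shows "norm (T x) \<le> norm x"
proof -
  have "norm (T x) \<le> onorm T * norm x"
    using assms by (intro onorm bounded_op_on_UNIV_linear) (simp add: contraction_def)
  also have "\<dots> \<le> 1 * norm x" using assms by (intro mult_right_mono) (auto simp: contraction_def)
  finally show ?thesis by simp
qed

lemma cinner_adj: "bounded_op_on UNIV T \<Longrightarrow> cinner (T x) y = cinner x (adj T (y::'a::chilbert_space))"
  by (rule cinner_adj_on) auto

lemma op_adj: "bounded_op_on UNIV T \<Longrightarrow> bounded_op_on UNIV (adj (T::'a::chilbert_space \<Rightarrow> 'a))"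
  by (rule op_adj_on) auto

lemma adj_norm_le:
  assumes T: "contraction (T::'a::chilbert_space \<Rightarrow> 'a)"
  shows "norm (adj T x) \<le> norm x"
proof -
  have "(norm (adj T x))\<^sup>2 = cmod (cinner (T (adj T x)) x)"
    by (simp add: cinner_adj[OF contraction_op[OF T]] cinner_self norm_power)
  also have "\<dots> \<le> norm (T (adj T x)) * norm x" by (rule norm_cinner_le)
  also have "\<dots> \<le> norm (adj T x) * norm x" using contraction_norm[OF T] by (simp add: mult_right_mono)
  finally show ?thesis by (cases "norm (adj T x) = 0") (auto simp: power2_eq_square mult_le_cancel_left)
qed

context
  fixes T :: "'a::chilbert_space \<Rightarrow> 'a"
  assumes T: "contraction T"
begin

lemma
  shows defect_positive: "positive_op (defect_op_star T)"
    and defect_squared: "defect_op_star T (defect_op_star T x) = x - T (adj T x)"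
proof -
  define A where "A = (\<lambda>x. T (adj T x))"
  have opT: "bounded_op_on UNIV T" by (rule contraction_op[OF T])
  have A: "bounded_op_on UNIV A" "\<And>x. norm (A x) \<le> norm x" "\<And>x y. cinner (A x) y = cinner x (A y)"
  proof -
    show "bounded_op_on UNIV A" unfolding A_def by (rule op_compose[OF opT op_adj[OF opT]])
    show "norm (A x) \<le> norm x" for x
      unfolding A_def using contraction_norm[OF T] adj_norm_le[OF T] order_trans by blast
    show "cinner (A x) y = cinner x (A y)" for x y
      unfolding A_def by (metis cinner_adj[OF opT] cinner_commute)
  qed
  have pos: "positive_op (sqrt_series A)" by (rule positive_sqrt_series[OF A])
  have sq: "sqrt_series A (sqrt_series A x) = x - T (adj T x)" for x
    using sqrt_series_squared[OF A, of x] by (simp add: A_def)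
  have "defect_op_star T = sqrt_series A"
    unfolding defect_op_star_def positive_sqrt_def
  proof (rule the_equality)
    show "positive_op (sqrt_series A) \<and> sqrt_series A \<circ> sqrt_series A = (\<lambda>x. x - T (adj T x))"
      using pos sq by auto
    show "S = sqrt_series A" if "positive_op S \<and> S \<circ> S = (\<lambda>x. x - T (adj T x))" for S
      using that by (intro positive_sqrt_unique[OF A]) (auto simp: A_def dest: fun_cong)
  qed
  then show "positive_op (defect_op_star T)" "defect_op_star T (defect_op_star T x) = x - T (adj T x)"
    using pos sq by simp_all
qed

lemma op_defect: "bounded_op_on UNIV (defect_op_star T)"
  using defect_positive by (simp add: positive_op_def)

lemma norm_defect: "(norm (defect_op_star T x))\<^sup>2 = (norm x)\<^sup>2 - (norm (adj T x))\<^sup>2"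
proof -
  have "complex_of_real ((norm (defect_op_star T x))\<^sup>2) = cinner (x - T (adj T x)) x"
    by (simp only: cinner_self[symmetric] defect_squared[symmetric] positive_op_sym[OF defect_positive])
  also have "\<dots> = of_real ((norm x)\<^sup>2 - (norm (adj T x))\<^sup>2)"
    by (simp add: cinner_diff_left cinner_adj[OF contraction_op[OF T]] cinner_self)
  finally show ?thesis by (simp only: of_real_eq_iff)
qed

lemma defect_mem: "defect_op_star T x \<in> defect_space_star T"
  unfolding defect_space_star_def by (rule subsetD[OF closure_subset rangeI])

lemma defect_space_csubspace: "closed_csubspace (defect_space_star T)"
  unfolding closed_csubspace_def
proof (intro conjI ballI allI)
  let ?R = "range (defect_op_star T)"
  show "closed (defect_space_star T)" by (simp add: defect_space_star_def)
  show "0 \<in> defect_space_star T" using defect_mem[of 0] op_zero[OF op_defect] by simp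
  fix x assume x: "x \<in> defect_space_star T"
  then obtain u where u: "\<And>k. u k \<in> ?R" "u \<longlonglongrightarrow> x"
    unfolding defect_space_star_def closure_sequential by blast
  show "c *\<^sub>C x \<in> defect_space_star T" for c
  proof -
    have "\<exists>w. c *\<^sub>C u k = defect_op_star T w" for k
      using u(1)[of k] op_scaleC[OF op_defect, of _ c] by (metis UNIV_I imageE)
    then have "\<And>k. c *\<^sub>C u k \<in> ?R" by auto
    moreover have "(\<lambda>k. c *\<^sub>C u k) \<longlonglongrightarrow> c *\<^sub>C x"
      by (rule bounded_linear.tendsto[OF bounded_linear_scaleC_right u(2)])
    ultimately show ?thesis unfolding defect_space_star_def by (rule closure_limI)
  qed
  fix y assume "y \<in> defect_space_star T"
  then obtain v where v: "\<And>k. v k \<in> ?R" "v \<longlonglongrightarrow> y"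
    unfolding defect_space_star_def closure_sequential by blast
  have "\<exists>w. u k + v k = defect_op_star T w" for k
    using u(1)[of k] v(1)[of k] op_add[OF op_defect] by (metis UNIV_I imageE)
  then have "\<And>k. u k + v k \<in> ?R" by auto
  moreover have "(\<lambda>k. u k + v k) \<longlonglongrightarrow> x + y" by (rule tendsto_add[OF u(2) v(2)])
  ultimately show "x + y \<in> defect_space_star T" unfolding defect_space_star_def by (rule closure_limI)
qed

end

section \<open>The Hardy space as a sequence space\<close>

definition square_summable :: "'a::complex_inner set \<Rightarrow> (nat \<Rightarrow> 'a) \<Rightarrow> bool"
  where "square_summable E a \<longleftrightarrow> (\<forall>k. a k \<in> E) \<and> summable (\<lambda>k. (norm (a k))\<^sup>2)"

definition shift_seq :: "(nat \<Rightarrow> 'a::zero) \<Rightarrow> nat \<Rightarrow> 'a"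
  where "shift_seq a k = (case k of 0 \<Rightarrow> 0 | Suc j \<Rightarrow> a j)"

lemma shift_seq_simps [simp]: "shift_seq a 0 = 0" "shift_seq a (Suc k) = a k"
  by (simp_all add: shift_seq_def)

lemma power_series_coeff_zero:
  fixes c :: "nat \<Rightarrow> complex"
  assumes "\<And>z. cmod z < 1 \<Longrightarrow> (\<lambda>k. c k * z ^ k) sums 0"
  shows "c k = 0"
proof -
  define F where "F = Abs_fps c"
  have "cmod (1/2) < 1" by simp
  from assms[OF this] have "conv_radius c \<ge> norm (1/2 :: complex)"
    by (intro conv_radius_geI) (auto simp: sums_iff)
  moreover have "(0::ereal) < ereal (norm (1/2 :: complex))" by simp
  ultimately have "0 < conv_radius c" by (metis less_le_trans)
  then have rad: "fps_conv_radius F > 0" by (simp add: F_def fps_conv_radius_def)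
  have "eventually (\<lambda>z. z \<in> ball 0 1) (nhds (0::complex))" by (rule eventually_nhds_in_open) auto
  then have ev: "eventually (\<lambda>z. eval_fps F z = eval_fps 0 z) (nhds 0)"
  proof eventually_elim
    case (elim z)
    then show ?case using assms[of z] by (simp add: eval_fps_def F_def sums_iff)
  qed
  have "F = 0" by (rule eval_fps_eqD[OF rad _ ev]) simp
  then have "fps_nth F k = 0" by simp
  then show ?thesis by (simp add: F_def)
qed

text \<open>Pairing with the difference of the \<open>k\<close>-th coefficients turns the vector-valued series into scalar
  ones.\<close>

lemma power_series_coeff_unique:
  fixes a b :: "nat \<Rightarrow> 'a::complex_inner"
  assumes "\<And>z. cmod z < 1 \<Longrightarrow> (\<lambda>k. z ^ k *\<^sub>C a k) sums f z" "\<And>z. cmod z < 1 \<Longrightarrow> (\<lambda>k. z ^ k *\<^sub>C b k) sums f z"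
  shows "a = b"
proof
  fix k
  have "cinner (a k - b k) (a k - b k) = 0"
  proof (rule power_series_coeff_zero[of "\<lambda>j. cinner (a j - b j) (a k - b k)" k])
    fix z :: complex assume z: "cmod z < 1"
    have "(\<lambda>j. z ^ j *\<^sub>C a j - z ^ j *\<^sub>C b j) sums (f z - f z)"
      by (rule sums_diff) (use assms z in auto)
    from bounded_linear.sums[OF bounded_linear_cinner_left this, of "a k - b k"]
    show "(\<lambda>j. cinner (a j - b j) (a k - b k) * z ^ j) sums 0"
      by (simp add: cinner_scaleC_left mult.commute flip: scaleC_diff_right)
  qed
  then show "a k = b k" by simp
qed

lemma square_summable_power_series:
  assumes a: "square_summable E (a :: nat \<Rightarrow> 'a::chilbert_space)" and z: "cmod z < 1"
  shows "summable (\<lambda>k. z ^ k *\<^sub>C a k)"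
proof (rule summable_comparison_test')
  have "\<bar>(cmod z)\<^sup>2\<bar> < 1" using z by (simp add: power_less_one_iff)
  then have "summable (\<lambda>k. ((cmod z)\<^sup>2) ^ k)" by (simp add: summable_geometric)
  then show "summable (\<lambda>k. ((cmod z)\<^sup>2) ^ k + (norm (a k))\<^sup>2)"
    using a by (intro summable_add) (simp_all add: square_summable_def)
  fix k :: nat
  have "0 \<le> (cmod z ^ k - norm (a k))\<^sup>2" by simp
  then have "2 * (cmod z ^ k * norm (a k)) \<le> (cmod z ^ k)\<^sup>2 + (norm (a k))\<^sup>2"
    by (simp add: power2_diff)
  moreover have "0 \<le> cmod z ^ k * norm (a k)" by simp
  ultimately have "cmod z ^ k * norm (a k) \<le> (cmod z ^ k)\<^sup>2 + (norm (a k))\<^sup>2" by linarith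
  moreover have "(cmod z ^ k)\<^sup>2 = ((cmod z)\<^sup>2) ^ k" by (simp add: power_mult[symmetric] mult.commute)
  ultimately show "norm (z ^ k *\<^sub>C a k) \<le> ((cmod z)\<^sup>2) ^ k + (norm (a k))\<^sup>2"
    by (simp add: norm_scaleC norm_power)
qed

text \<open>The description of \<open>hardy_coeff\<close> ranges over all sequences, not only those in \<open>E\<close>; by uniqueness any
  expansion that is found is the one described.\<close>

lemma hardy_coeffI:
  assumes "square_summable E a" "\<And>z. cmod z < 1 \<Longrightarrow> (\<lambda>k. z ^ k *\<^sub>C a k) sums f z"
    "\<And>z. \<not> cmod z < 1 \<Longrightarrow> f z = 0"
  shows "f \<in> hardy E" "hardy_coeff f = a"
proof -
  show "f \<in> hardy E" using assms unfolding hardy_def square_summable_def by blast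
  show "hardy_coeff f = a" unfolding hardy_coeff_def
    by (rule the_equality) (use assms(2) power_series_coeff_unique[of _ f a] in blast)+
qed

lemma hardyD:
  assumes "f \<in> hardy E"
  shows hardy_coeff_square_summable: "square_summable E (hardy_coeff f)"
    and hardy_sums: "cmod z < 1 \<Longrightarrow> (\<lambda>k. z ^ k *\<^sub>C hardy_coeff f k) sums f z"
    and hardy_outside: "\<not> cmod z < 1 \<Longrightarrow> f z = 0"
proof -
  obtain a where a: "square_summable E a" "\<And>z. cmod z < 1 \<Longrightarrow> (\<lambda>k. z ^ k *\<^sub>C a k) sums f z"
      "\<And>z. \<not> cmod z < 1 \<Longrightarrow> f z = 0"
    using assms unfolding hardy_def square_summable_def by blast
  with hardy_coeffI(2)[OF a] show "square_summable E (hardy_coeff f)"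
    "cmod z < 1 \<Longrightarrow> (\<lambda>k. z ^ k *\<^sub>C hardy_coeff f k) sums f z" "\<not> cmod z < 1 \<Longrightarrow> f z = 0" by auto
qed

lemma hardy_coeff_mem: "f \<in> hardy E \<Longrightarrow> hardy_coeff f k \<in> E"
  using hardy_coeff_square_summable unfolding square_summable_def by blast

lemma hardy_coeff_summable: "f \<in> hardy E \<Longrightarrow> summable (\<lambda>k. (norm (hardy_coeff f k))\<^sup>2)"
  using hardy_coeff_square_summable unfolding square_summable_def by blast

lemma hardy_eqI:
  assumes "f \<in> hardy E" "g \<in> hardy E" "\<And>k. hardy_coeff f k = hardy_coeff g k"
  shows "f = g"
proof
  fix z
  show "f z = g z"
    using hardy_sums[OF assms(1), of z] hardy_sums[OF assms(2), of z] hardy_outside[OF assms(1), of z]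
      hardy_outside[OF assms(2), of z] assms(3) sums_unique2 by (cases "cmod z < 1") auto
qed

definition hardy_of_seq :: "(nat \<Rightarrow> 'a::complex_inner) \<Rightarrow> complex \<Rightarrow> 'a"
  where "hardy_of_seq a z = (if cmod z < 1 then \<Sum>k. z ^ k *\<^sub>C a k else 0)"

lemma hardy_of_seq:
  assumes "square_summable E (a :: nat \<Rightarrow> 'a::chilbert_space)"
  shows "hardy_of_seq a \<in> hardy E" "hardy_coeff (hardy_of_seq a) = a"
  using hardy_coeffI[OF assms, of "hardy_of_seq a"] square_summable_power_series[OF assms]
  by (auto simp: hardy_of_seq_def summable_sums)

lemma square_summable_finite:
  "(\<And>k. a k \<in> E) \<Longrightarrow> (\<And>k. N \<le> k \<Longrightarrow> a k = 0) \<Longrightarrow> square_summable E a"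
  unfolding square_summable_def using summable_finite[of "{..<N}" "\<lambda>k. (norm (a k))\<^sup>2"] by force

section \<open>Linear structure, multiplication operators and inner product of the Hardy space\<close>

context
  fixes E :: "'a::chilbert_space set"
  assumes E: "closed_csubspace E"
begin

lemma square_summable_add:
  assumes "square_summable E a" "square_summable E b"
  shows "square_summable E (\<lambda>k. a k + b k)"
proof -
  have "summable (\<lambda>k. (norm (a k + b k))\<^sup>2)"
  proof (rule summable_comparison_test')
    show "summable (\<lambda>k. 2 * (norm (a k))\<^sup>2 + 2 * (norm (b k))\<^sup>2)"
      using assms by (intro summable_add summable_mult) (auto simp: square_summable_def)
    fix k
    have "(norm (a k + b k))\<^sup>2 + (norm (a k - b k))\<^sup>2 = 2 * (norm (a k))\<^sup>2 + 2 * (norm (b k))\<^sup>2"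
      by (simp add: power2_norm_eq_inner inner_add_left inner_add_right inner_diff_left inner_diff_right)
    then have "(norm (a k + b k))\<^sup>2 \<le> 2 * (norm (a k))\<^sup>2 + 2 * (norm (b k))\<^sup>2"
      using zero_le_power2[of "norm (a k - b k)"] by linarith
    then show "norm ((norm (a k + b k))\<^sup>2) \<le> 2 * (norm (a k))\<^sup>2 + 2 * (norm (b k))\<^sup>2" by simp
  qed
  then show ?thesis using assms csubspace_add[OF E] by (simp add: square_summable_def)
qed

lemma square_summable_op:
  assumes A: "bounded_op_on E A" and a: "square_summable E a"
  shows "square_summable E (\<lambda>k. A (a k))"
proof -
  obtain K where K: "0 < K" "\<And>x. x \<in> E \<Longrightarrow> norm (A x) \<le> K * norm x"
    using op_norm_bound[OF A] by blast
  have "summable (\<lambda>k. (norm (A (a k)))\<^sup>2)"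
  proof (rule summable_comparison_test')
    show "summable (\<lambda>k. K\<^sup>2 * (norm (a k))\<^sup>2)"
      using a by (intro summable_mult) (auto simp: square_summable_def)
    show "norm ((norm (A (a k)))\<^sup>2) \<le> K\<^sup>2 * (norm (a k))\<^sup>2" for k
      using power_mono[OF K(2)[of "a k"], of 2] a by (simp add: square_summable_def power_mult_distrib)
  qed
  then show ?thesis using a op_closed[OF A] by (simp add: square_summable_def)
qed

lemma square_summable_shift:
  assumes "square_summable E a"
  shows "square_summable E (shift_seq a)"
proof -
  have "summable (\<lambda>k. (norm (shift_seq a (Suc k)))\<^sup>2)" using assms by (simp add: square_summable_def)
  then have "summable (\<lambda>k. (norm (shift_seq a k))\<^sup>2)" by (subst (asm) summable_Suc_iff)
  moreover have "shift_seq a k \<in> E" for k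
    using assms csubspace_zero[OF E] by (cases k) (auto simp: square_summable_def)
  ultimately show ?thesis by (simp add: square_summable_def)
qed

lemma hardy_add:
  assumes f: "f \<in> hardy E" and g: "g \<in> hardy E"
  shows "(\<lambda>z. f z + g z) \<in> hardy E" "hardy_coeff (\<lambda>z. f z + g z) = (\<lambda>k. hardy_coeff f k + hardy_coeff g k)"
proof -
  have sums: "(\<lambda>k. z ^ k *\<^sub>C (hardy_coeff f k + hardy_coeff g k)) sums (f z + g z)" if "cmod z < 1" for z
    unfolding scaleC_add_right by (intro sums_add hardy_sums[OF f that] hardy_sums[OF g that])
  show "(\<lambda>z. f z + g z) \<in> hardy E" "hardy_coeff (\<lambda>z. f z + g z) = (\<lambda>k. hardy_coeff f k + hardy_coeff g k)"
    by (rule hardy_coeffI[OF square_summable_add[OF hardy_coeff_square_summable[OF f]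
      hardy_coeff_square_summable[OF g]] sums]; simp add: hardy_outside[OF f] hardy_outside[OF g])+
qed

lemma hardy_mem:
  assumes f: "f \<in> hardy E"
  shows "f z \<in> E"
proof (cases "cmod z < 1")
  case True
  have lim: "(\<lambda>n. \<Sum>k<n. z ^ k *\<^sub>C hardy_coeff f k) \<longlonglongrightarrow> f z" using hardy_sums[OF f True] by (simp add: sums_def)
  have "(\<Sum>k<n. z ^ k *\<^sub>C hardy_coeff f k) \<in> E" for n
    by (intro csubspace_sum[OF E] csubspace_scaleC[OF E] hardy_coeff_mem[OF f])
  then show ?thesis by (rule closed_sequentially[OF csubspace_closed[OF E] _ lim])
qed (use hardy_outside[OF f] csubspace_zero[OF E] in simp)

text \<open>The values of \<open>A\<close> matter on \<open>E\<close> only, so that \<open>A\<close> must be moved past the infinite sum by continuity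
  on \<open>E\<close>.\<close>

lemma hardy_op:
  assumes A: "bounded_op_on E A" and f: "f \<in> hardy E"
  shows "(\<lambda>z. A (f z)) \<in> hardy E" "hardy_coeff (\<lambda>z. A (f z)) = (\<lambda>k. A (hardy_coeff f k))"
proof -
  have c: "hardy_coeff f k \<in> E" for k by (rule hardy_coeff_mem[OF f])
  have sums: "(\<lambda>k. z ^ k *\<^sub>C A (hardy_coeff f k)) sums A (f z)" if z: "cmod z < 1" for z
  proof -
    have "(\<lambda>n. A (\<Sum>k<n. z ^ k *\<^sub>C hardy_coeff f k)) \<longlonglongrightarrow> A (f z)"
    proof (rule continuous_on_tendsto_compose[OF op_continuous_on[OF A E]])
      show "(\<lambda>n. \<Sum>k<n. z ^ k *\<^sub>C hardy_coeff f k) \<longlonglongrightarrow> f z"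
        using hardy_sums[OF f z] by (simp add: sums_def)
    qed (auto intro!: always_eventually hardy_mem[OF f] csubspace_sum[OF E] csubspace_scaleC[OF E] c)
    moreover have "A (\<Sum>k<n. z ^ k *\<^sub>C hardy_coeff f k) = (\<Sum>k<n. z ^ k *\<^sub>C A (hardy_coeff f k))" for n
      by (subst op_sum[OF A E]) (auto intro!: csubspace_scaleC[OF E] c sum.cong simp: op_scaleC[OF A c])
    ultimately show ?thesis by (simp add: sums_def)
  qed
  show "(\<lambda>z. A (f z)) \<in> hardy E" "hardy_coeff (\<lambda>z. A (f z)) = (\<lambda>k. A (hardy_coeff f k))"
    by (rule hardy_coeffI[OF square_summable_op[OF A hardy_coeff_square_summable[OF f]] sums];
      simp add: hardy_outside[OF f] op_zero[OF A E])+
qed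

lemma hardy_scaleC:
  assumes "f \<in> hardy E"
  shows "(\<lambda>z. c *\<^sub>C f z) \<in> hardy E" "hardy_coeff (\<lambda>z. c *\<^sub>C f z) = (\<lambda>k. c *\<^sub>C hardy_coeff f k)"
proof -
  have "bounded_op_on E (\<lambda>x. c *\<^sub>C x)"
    unfolding bounded_op_on_def
    by (auto simp: csubspace_scaleC[OF E] scaleC_add_right scaleC_scaleC mult.commute norm_scaleC
      intro!: exI[of _ "cmod c"])
  from hardy_op[OF this assms] show "(\<lambda>z. c *\<^sub>C f z) \<in> hardy E"
    "hardy_coeff (\<lambda>z. c *\<^sub>C f z) = (\<lambda>k. c *\<^sub>C hardy_coeff f k)" by simp_all
qed

lemma hardy_diff:
  assumes "f \<in> hardy E" "g \<in> hardy E"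
  shows "(\<lambda>z. f z - g z) \<in> hardy E" "hardy_coeff (\<lambda>z. f z - g z) = (\<lambda>k. hardy_coeff f k - hardy_coeff g k)"
  using hardy_add[OF assms(1) hardy_scaleC(1)[OF assms(2), of "-1"]] hardy_scaleC(2)[OF assms(2), of "-1"]
  by (simp_all add: scaleC_minus_left)

lemma hardy_sum:
  assumes "\<And>i. i \<in> I \<Longrightarrow> F i \<in> hardy E" "finite I"
  shows "(\<lambda>z. \<Sum>i\<in>I. F i z) \<in> hardy E \<and> (\<forall>k. hardy_coeff (\<lambda>z. \<Sum>i\<in>I. F i z) k = (\<Sum>i\<in>I. hardy_coeff (F i) k))"
  using assms(2,1)
proof (induction I rule: finite_induct)
  case empty
  have "square_summable E (\<lambda>k. 0)" by (simp add: square_summable_def csubspace_zero[OF E])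
  from hardy_coeffI[OF this, of "\<lambda>z. 0"] show ?case by simp
next
  case (insert i I)
  then show ?case using hardy_add[of "F i" "\<lambda>z. \<Sum>i\<in>I. F i z"] by simp
qed

lemma hardy_mult_z:
  assumes f: "f \<in> hardy E"
  shows "mult_z f \<in> hardy E" "hardy_coeff (mult_z f) = shift_seq (hardy_coeff f)"
proof -
  have sums: "(\<lambda>k. z ^ k *\<^sub>C shift_seq (hardy_coeff f) k) sums mult_z f z" if z: "cmod z < 1" for z
  proof -
    have "(\<lambda>k. z *\<^sub>C z ^ k *\<^sub>C hardy_coeff f k) sums (z *\<^sub>C f z)"
      by (rule bounded_linear.sums[OF bounded_linear_scaleC_right hardy_sums[OF f z]])
    then have "(\<lambda>k. z ^ Suc k *\<^sub>C shift_seq (hardy_coeff f) (Suc k)) sums mult_z f z"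
      by (simp add: scaleC_scaleC mult_op_def)
    from sums_Suc[OF this] show ?thesis by simp
  qed
  show "mult_z f \<in> hardy E" "hardy_coeff (mult_z f) = shift_seq (hardy_coeff f)"
    by (rule hardy_coeffI[OF square_summable_shift[OF hardy_coeff_square_summable[OF f]] sums];
      simp add: hardy_outside[OF f] mult_op_def)+
qed

lemma hardy_mult_z_power:
  assumes f: "f \<in> hardy E"
  shows "(mult_z ^^ k) f \<in> hardy E"
    and "hardy_coeff ((mult_z ^^ k) f) j = (if j < k then 0 else hardy_coeff f (j - k))"
proof -
  have *: "(mult_z ^^ k) f \<in> hardy E" for k by (induction k) (simp_all add: f hardy_mult_z)
  show "(mult_z ^^ k) f \<in> hardy E" by (rule *)
  show "hardy_coeff ((mult_z ^^ k) f) j = (if j < k then 0 else hardy_coeff f (j - k))"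
  proof (induction k arbitrary: j)
    case (Suc k)
    then show ?case by (cases j) (simp_all add: hardy_mult_z(2)[OF *])
  qed simp
qed

definition monomial :: "nat \<Rightarrow> 'a \<Rightarrow> complex \<Rightarrow> 'a"
  where "monomial k e = hardy_of_seq (\<lambda>j. if j = k then e else 0)"

lemma monomial:
  assumes "e \<in> E"
  shows "monomial k e \<in> hardy E" "hardy_coeff (monomial k e) = (\<lambda>j. if j = k then e else 0)"
proof -
  have *: "square_summable E (\<lambda>j. if j = k then e else 0)"
    by (rule square_summable_finite[where N = "Suc k"]) (use assms csubspace_zero[OF E] in auto)
  show "monomial k e \<in> hardy E" "hardy_coeff (monomial k e) = (\<lambda>j. if j = k then e else 0)"
    unfolding monomial_def by (rule hardy_of_seq[OF *])+
qed

lemma mult_z_monomial: "e \<in> E \<Longrightarrow> mult_z (monomial k e) = monomial (Suc k) e"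
  by (rule hardy_eqI[of _ E]) (auto simp: hardy_mult_z monomial shift_seq_def split: nat.splits)

lemma monomial_0_apply: "e \<in> E \<Longrightarrow> cmod z < 1 \<Longrightarrow> monomial 0 e z = e"
  using hardy_sums[OF monomial(1)[of e 0], of z] sums_single[of 0 "\<lambda>k. z ^ k *\<^sub>C e"]
  by (auto simp: monomial(2) if_distrib[of "\<lambda>x. _ *\<^sub>C x"] cong: if_cong intro: sums_unique2)

lemma hardy_inner_summable:
  assumes f: "f \<in> hardy E" and g: "g \<in> hardy E"
  shows "summable (\<lambda>k. cinner (hardy_coeff f k) (hardy_coeff g k))"
proof (rule summable_comparison_test')
  show "summable (\<lambda>k. (norm (hardy_coeff f k))\<^sup>2 + (norm (hardy_coeff g k))\<^sup>2)"
    by (intro summable_add hardy_coeff_summable[OF f] hardy_coeff_summable[OF g])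
  fix k
  have "0 \<le> (norm (hardy_coeff f k) - norm (hardy_coeff g k))\<^sup>2" by simp
  then have "2 * (norm (hardy_coeff f k) * norm (hardy_coeff g k))
      \<le> (norm (hardy_coeff f k))\<^sup>2 + (norm (hardy_coeff g k))\<^sup>2"
    by (simp add: power2_diff)
  moreover have "0 \<le> norm (hardy_coeff f k) * norm (hardy_coeff g k)" by simp
  ultimately show "norm (cinner (hardy_coeff f k) (hardy_coeff g k))
      \<le> (norm (hardy_coeff f k))\<^sup>2 + (norm (hardy_coeff g k))\<^sup>2"
    using norm_cinner_le[of "hardy_coeff f k" "hardy_coeff g k"] by linarith
qed

text \<open>Pairing with monomials reads off coefficients, so functions that pair equally with all of them are
  equal.\<close>

lemma hardy_inner_monomial: "e \<in> E \<Longrightarrow> hardy_inner (monomial k e) g = cinner e (hardy_coeff g k)"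
  unfolding hardy_inner_def
  by (subst suminf_finite[of "{k}"]) (auto simp: monomial(2))

lemma hardy_inner_eqI:
  assumes f: "f \<in> hardy E" and g: "g \<in> hardy E" and eq: "\<And>h. h \<in> hardy E \<Longrightarrow> hardy_inner h f = hardy_inner h g"
  shows "f = g"
proof (rule hardy_eqI[OF f g])
  fix k
  show "hardy_coeff f k = hardy_coeff g k"
    by (rule csubspace_cinner_eqI[OF E hardy_coeff_mem[OF f] hardy_coeff_mem[OF g]])
      (use eq[OF monomial(1)] hardy_inner_monomial in metis)
qed

lemma hardy_adj_eqI:
  assumes "g' \<in> hardy E" "\<And>f. f \<in> hardy E \<Longrightarrow> hardy_inner (V f) g = hardy_inner f g'"
  shows "hardy_adj E V g = g'"
  by (rule adjoint_wrt_eqI[where ip = hardy_inner]) (use assms hardy_inner_eqI in auto)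

lemma norm_hardy_coeff_le:
  assumes f: "f \<in> hardy E"
  shows "norm (hardy_coeff f k) \<le> hardy_norm f"
proof -
  have "(norm (hardy_coeff f k))\<^sup>2 \<le> (\<Sum>k. (norm (hardy_coeff f k))\<^sup>2)"
    using sum_le_suminf[OF hardy_coeff_summable[OF f], of "{k}"] by simp
  then show ?thesis unfolding hardy_norm_def by (rule real_le_rsqrt)
qed

lemma hardy_norm_zero: "f \<in> hardy E \<Longrightarrow> hardy_norm f = 0 \<Longrightarrow> hardy_coeff f k = 0"
  using norm_hardy_coeff_le[of f k] by simp

end

section \<open>Symbols\<close>

text \<open>The operator-valued function of a model isometry.\<close>

definition symbol :: "('a \<Rightarrow> 'a) \<Rightarrow> ('a \<Rightarrow> 'a) \<Rightarrow> complex \<Rightarrow> 'a::complex_inner \<Rightarrow> 'a"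
  where "symbol P U z x = U (perp P x) + z *\<^sub>C U (P x)"

text \<open>The properties of a model isometry in terms of the values of its symbols at single points of the
  disk. This form passes to unitary conjugates at once.\<close>

definition symbol_tuple :: "nat \<Rightarrow> 'a::complex_inner set \<Rightarrow> (nat \<Rightarrow> 'a \<Rightarrow> 'a) \<Rightarrow> (nat \<Rightarrow> 'a \<Rightarrow> 'a) \<Rightarrow> bool"
  where "symbol_tuple n E P U \<longleftrightarrow>
    (\<forall>i\<in>{1..n}. orth_projection_on E (P i) \<and> unitary_on E (U i)) \<and>
    (\<forall>i\<in>{1..n}. \<forall>j\<in>{1..n}. \<forall>z. cmod z < 1 \<longrightarrow> (\<forall>x\<in>E.
      symbol (P i) (U i) z (symbol (P j) (U j) z x) = symbol (P j) (U j) z (symbol (P i) (U i) z x))) \<and>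
    (\<forall>z. cmod z < 1 \<longrightarrow> (\<forall>x\<in>E. foldr (\<lambda>i. symbol (P i) (U i) z) [1..<Suc n] x = z *\<^sub>C x))"

text \<open>The part of the model conditions that concerns an arbitrary space \<open>E\<close> and no operators \<open>T i\<close>.\<close>

definition symbol_relations :: "nat \<Rightarrow> 'a::complex_inner set \<Rightarrow> (nat \<Rightarrow> 'a \<Rightarrow> 'a) \<Rightarrow> (nat \<Rightarrow> 'a \<Rightarrow> 'a) \<Rightarrow> bool"
  where "symbol_relations n E P U \<longleftrightarrow> (let Us = (\<lambda>i. adj_on E (U i)) in
      (\<forall>i\<in>{1..n}. orth_projection_on E (P i)) \<and>
      (\<forall>i\<in>{1..n}. unitary_on E (U i)) \<and>
      (\<forall>i\<in>{1..n}. \<forall>j\<in>{1..n}. \<forall>x\<in>E. U i (U j x) = U j (U i x)) \<and>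
      (\<forall>x\<in>E. foldr U [1..<Suc n] x = x) \<and>
      (\<forall>i\<in>{1..n}. \<forall>j\<in>{1..n}. \<forall>x\<in>E.
        perp (P i) (Us i (perp (P j) (Us j x))) = perp (P j) (Us j (perp (P i) (Us i x)))) \<and>
      (\<forall>i\<in>{1..n}. \<forall>j\<in>{1..n}. \<forall>x\<in>E. U i (P i (U j (P j x))) = U j (P j (U i (P i x)))) \<and>
      (\<forall>x\<in>E. (\<Sum>i=1..n. foldr Us [1..<i] (P i (fold U [1..<i] x))) = x))"

text \<open>The summands of the resolution of the identity in \<open>symbol_relations\<close>: each is \<open>P i\<close> conjugated by
  the unitary \<open>U (i - 1) \<dots> U 1\<close>.\<close>

definition conj_proj ::
    "'a::complex_inner set \<Rightarrow> (nat \<Rightarrow> 'a \<Rightarrow> 'a) \<Rightarrow> (nat \<Rightarrow> 'a \<Rightarrow> 'a) \<Rightarrow> nat \<Rightarrow> 'a \<Rightarrow> 'a"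
  where "conj_proj E P U i x = foldr (\<lambda>i. adj_on E (U i)) [1..<i] (P i (fold U [1..<i] x))"

lemma foldr_mem: "(\<And>i x. i \<in> set is \<Longrightarrow> x \<in> E \<Longrightarrow> f i x \<in> E) \<Longrightarrow> x \<in> E \<Longrightarrow> foldr f is x \<in> E"
  by (induction "is") auto

lemma fold_commute_single:
  assumes "\<And>i x. i \<in> set is \<Longrightarrow> x \<in> E \<Longrightarrow> f i x \<in> E" "\<And>i x. i \<in> set is \<Longrightarrow> x \<in> E \<Longrightarrow> g (f i x) = f i (g x)"
    and "x \<in> E"
  shows "g (fold f is x) = fold f is (g x)"
  using assms by (induction "is" arbitrary: x) auto

lemma foldr_eq_fold_if_commute:
  assumes "\<And>i x. i \<in> set is \<Longrightarrow> x \<in> E \<Longrightarrow> f i x \<in> E"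
    and "\<And>i j x. i \<in> set is \<Longrightarrow> j \<in> set is \<Longrightarrow> x \<in> E \<Longrightarrow> f i (f j x) = f j (f i x)" and "x \<in> E"
  shows "foldr f is x = fold f is x"
  using assms
proof (induction "is" arbitrary: x)
  case (Cons i "is")
  have "foldr f (i # is) x = f i (fold f is x)" using Cons by simp
  also have "\<dots> = fold f is (f i x)" using Cons.prems by (intro fold_commute_single[where E = E]) auto
  finally show ?case by simp
qed simp

lemma vector_polynomial_eq:
  fixes c d :: "nat \<Rightarrow> 'a::complex_inner"
  assumes S: "infinite S" and eq: "\<And>w. w \<in> S \<Longrightarrow> (\<Sum>k\<le>n. w ^ k *\<^sub>C c k) = (\<Sum>k\<le>n. w ^ k *\<^sub>C d k)" and k: "k \<le> n"
  shows "c k = d k"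
proof -
  let ?p = "\<lambda>j. cinner (c j - d j) (c k - d k)"
  have "S \<subseteq> {w. (\<Sum>j\<le>n. ?p j * w ^ j) = 0}"
  proof
    fix w assume "w \<in> S"
    have "(\<Sum>j\<le>n. ?p j * w ^ j) = cinner ((\<Sum>k\<le>n. w ^ k *\<^sub>C c k) - (\<Sum>k\<le>n. w ^ k *\<^sub>C d k)) (c k - d k)"
      by (simp add: cinner_sum_left cinner_diff_left cinner_scaleC_left sum_subtractf[symmetric] algebra_simps)
    then show "w \<in> {w. (\<Sum>j\<le>n. ?p j * w ^ j) = 0}" using eq[OF \<open>w \<in> S\<close>] by simp
  qed
  then have "infinite {w. (\<Sum>j\<le>n. ?p j * w ^ j) = 0}" using S infinite_super by blast
  then have "?p k = 0" using polyfun_finite_roots[of ?p n] k by blast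
  then show ?thesis by simp
qed

text \<open>Needed for comparing coefficients of polynomials in \<open>z - a\<close>; only \<open>a = 0\<close> and \<open>a = 1\<close> occur.\<close>

lemma infinite_shifted_unit_disk: "infinite ((\<lambda>z. z - a) ` {z::complex. cmod z < 1})"
proof -
  have "{z::complex. cmod z < 1} = ball 0 1" by (auto simp: dist_norm)
  then have "infinite {z::complex. cmod z < 1}"
    using uncountable_ball[of 1 "0::complex"] countable_finite by auto
  then show ?thesis by (simp add: finite_image_iff inj_on_def)
qed

context
  fixes E :: "'a::chilbert_space set"
  assumes E: "closed_csubspace E"
begin

context
  fixes P U :: "'a \<Rightarrow> 'a"
  assumes P: "orth_projection_on E P" and U: "unitary_on E U"
begin

lemma op_perp_part: "bounded_op_on E (\<lambda>x. U (perp P x))"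
  by (rule op_compose[OF unitary_op[OF U] op_perp[OF projection_op[OF P] E]])

lemma op_proj_part: "bounded_op_on E (\<lambda>x. U (P x))"
  by (rule op_compose[OF unitary_op[OF U] projection_op[OF P]])

lemma symbol_parts_add: "x \<in> E \<Longrightarrow> U (perp P x) + U (P x) = U x"
  using op_add[OF unitary_op[OF U] op_closed[OF op_perp[OF projection_op[OF P] E]] op_closed[OF projection_op[OF P]], of x x]
  by (simp add: perp_def)

text \<open>At \<open>z = 1\<close> the two parts of the symbol add up to the unitary.\<close>

lemma symbol_around_1: "x \<in> E \<Longrightarrow> symbol P U z x = U x + (z - 1) *\<^sub>C U (P x)"
  using symbol_parts_add[of x] by (simp add: symbol_def scaleC_diff_left algebra_simps)

lemma symbol_1: "x \<in> E \<Longrightarrow> symbol P U 1 x = U x"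
  using symbol_around_1[of x 1] by simp

lemma symbol_mem: "x \<in> E \<Longrightarrow> symbol P U z x \<in> E"
  unfolding symbol_def using op_closed[OF op_perp_part] op_closed[OF op_proj_part] csubspace_add[OF E] csubspace_scaleC[OF E]
  by blast

lemma symbol_add: "x \<in> E \<Longrightarrow> y \<in> E \<Longrightarrow> symbol P U z (x + y) = symbol P U z x + symbol P U z y"
  using op_add[OF op_perp_part, of x y] op_add[OF op_proj_part, of x y]
  by (simp add: symbol_def scaleC_add_right algebra_simps)

lemma symbol_scaleC: "x \<in> E \<Longrightarrow> symbol P U z (c *\<^sub>C x) = c *\<^sub>C symbol P U z x"
  using op_scaleC[OF op_perp_part, of x c] op_scaleC[OF op_proj_part, of x c]
  by (simp add: symbol_def scaleC_add_right scaleC_scaleC mult.commute)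

lemma symbol_zero: "symbol P U z 0 = 0"
  using symbol_scaleC[OF csubspace_zero[OF E], of z 0] by simp

lemma cinner_perp_part:
  "x \<in> E \<Longrightarrow> y \<in> E \<Longrightarrow> cinner (U (perp P x)) y = cinner x (perp P (adj_on E U y))"
  using cinner_adj_on[OF E unitary_op[OF U]] projection_cinner[OF E projection_perp[OF E P]]
    op_closed[OF op_perp[OF projection_op[OF P] E]] adj_on_mem[OF E unitary_op[OF U]] by metis

lemma cinner_proj_part:
  "x \<in> E \<Longrightarrow> y \<in> E \<Longrightarrow> cinner (U (P x)) y = cinner x (P (adj_on E U y))"
  using cinner_adj_on[OF E unitary_op[OF U]] projection_cinner[OF E P]
    op_closed[OF projection_op[OF P]] adj_on_mem[OF E unitary_op[OF U]] by metis

lemma op_perp_part_adj: "bounded_op_on E (\<lambda>x. perp P (adj_on E U x))"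
  by (rule op_compose[OF op_perp[OF projection_op[OF P] E] op_adj_on[OF E unitary_op[OF U]]])

lemma op_proj_part_adj: "bounded_op_on E (\<lambda>x. P (adj_on E U x))"
  by (rule op_compose[OF projection_op[OF P] op_adj_on[OF E unitary_op[OF U]]])

end

lemma symbol_symbol:
  assumes P: "orth_projection_on E P" and U: "unitary_on E U"
    and P': "orth_projection_on E P'" and U': "unitary_on E U'" and x: "x \<in> E"
  shows "symbol P U z (symbol P' U' z x) = U (perp P (U' (perp P' x)))
    + z *\<^sub>C (U (perp P (U' (P' x))) + U (P (U' (perp P' x)))) + z\<^sup>2 *\<^sub>C U (P (U' (P' x)))"
proof -
  let ?a = "U' (perp P' x)" and ?b = "U' (P' x)"
  have a: "?a \<in> E" by (rule op_closed[OF op_perp_part[OF P' U'] x])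
  have b: "?b \<in> E" by (rule op_closed[OF op_proj_part[OF P' U'] x])
  have "symbol P U z (symbol P' U' z x) = symbol P U z ?a + z *\<^sub>C symbol P U z ?b"
    unfolding symbol_def[of P' U'] by (simp add: symbol_add[OF P U] symbol_scaleC[OF P U] a b csubspace_scaleC[OF E])
  then show ?thesis
    by (simp add: symbol_def scaleC_add_right scaleC_scaleC power2_eq_square algebra_simps)
qed

lemma adjoint_commute:
  assumes A: "bounded_op_on E A" and B: "bounded_op_on E B" and A': "bounded_op_on E A'" and B': "bounded_op_on E B'"
    and adjA: "\<And>x y. x \<in> E \<Longrightarrow> y \<in> E \<Longrightarrow> cinner (A x) y = cinner x (A' y)"
    and adjB: "\<And>x y. x \<in> E \<Longrightarrow> y \<in> E \<Longrightarrow> cinner (B x) y = cinner x (B' y)"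
    and comm: "\<And>x. x \<in> E \<Longrightarrow> A (B x) = B (A x)" and y: "y \<in> E"
  shows "A' (B' y) = B' (A' y)"
proof (rule csubspace_cinner_eqI[OF E])
  show "A' (B' y) \<in> E" "B' (A' y) \<in> E" using y op_closed[OF A'] op_closed[OF B'] by auto
  fix x assume x: "x \<in> E"
  have "cinner x (A' (B' y)) = cinner (B (A x)) y" "cinner x (B' (A' y)) = cinner (A (B x)) y"
    using x y op_closed[OF A'] op_closed[OF B'] op_closed[OF A] op_closed[OF B] adjA adjB by metis+
  then show "cinner x (A' (B' y)) = cinner x (B' (A' y))" using comm[OF x] by simp
qed

section \<open>Products of unitaries\<close>

context
  fixes U :: "nat \<Rightarrow> 'a \<Rightarrow> 'a" and "is" :: "nat list"
  assumes U: "\<And>i. i \<in> set is \<Longrightarrow> unitary_on E (U i)"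
begin

lemma op_fold: "bounded_op_on E (fold U is)"
  using U
proof (induction "is")
  case Nil
  then show ?case using op_id by (simp add: id_def)
next
  case (Cons i "is")
  then show ?case using op_compose[OF _ unitary_op, of E "fold U is" "U i"] by (simp add: o_def)
qed

lemma op_foldr_adj: "bounded_op_on E (foldr (\<lambda>i. adj_on E (U i)) is)"
  using U
proof (induction "is")
  case Nil
  then show ?case using op_id by (simp add: id_def)
next
  case (Cons i "is")
  then show ?case
    using op_compose[of E "adj_on E (U i)" "foldr (\<lambda>i. adj_on E (U i)) is"] op_adj_on[OF E unitary_op]
    by (simp add: o_def)
qed

lemma fold_foldr_adj:
  assumes "x \<in> E"
  shows "fold U is (foldr (\<lambda>i. adj_on E (U i)) is x) = x"
  using U
proof (induction "is")
  case (Cons i "is")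
  have "foldr (\<lambda>i. adj_on E (U i)) is x \<in> E"
    using Cons.prems by (intro foldr_mem assms adj_on_mem[OF E unitary_op]) auto
  then show ?case using Cons by (simp add: unitary_adj_right)
qed simp

lemma cinner_fold: "x \<in> E \<Longrightarrow> y \<in> E \<Longrightarrow> cinner (fold U is x) y = cinner x (foldr (\<lambda>i. adj_on E (U i)) is y)"
  using U
proof (induction "is" arbitrary: x)
  case (Cons i "is")
  have "foldr (\<lambda>i. adj_on E (U i)) is y \<in> E"
    using Cons.prems by (intro foldr_mem adj_on_mem[OF E unitary_op]) auto
  then show ?case using Cons by (simp add: op_closed[OF unitary_op] cinner_adj_on[OF E unitary_op])
qed simp

lemma projection_conjugate:
  assumes P: "orth_projection_on E P"
  shows "orth_projection_on E (\<lambda>x. foldr (\<lambda>i. adj_on E (U i)) is (P (fold U is x)))"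
proof (rule projectionI[OF E])
  let ?R = "fold U is" and ?R' = "foldr (\<lambda>i. adj_on E (U i)) is"
  have R: "x \<in> E \<Longrightarrow> ?R x \<in> E" and R': "x \<in> E \<Longrightarrow> ?R' x \<in> E" and Pm: "x \<in> E \<Longrightarrow> P x \<in> E" for x
    using op_closed[OF op_fold] op_closed[OF op_foldr_adj] op_closed[OF projection_op[OF P]] by auto
  show "bounded_op_on E (\<lambda>x. ?R' (P (?R x)))"
    by (rule op_compose[OF op_foldr_adj op_compose[OF projection_op[OF P] op_fold]])
  show "?R' (P (?R (?R' (P (?R x))))) = ?R' (P (?R x))" if "x \<in> E" for x
    using that by (simp add: fold_foldr_adj R Pm projection_idem[OF P])
  show "cinner (?R' (P (?R x))) y = cinner x (?R' (P (?R y)))" if "x \<in> E" "y \<in> E" for x y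
  proof -
    have "cinner (?R' (P (?R x))) y = cnj (cinner (?R y) (P (?R x)))"
      by (subst cinner_commute) (simp add: cinner_fold R Pm that)
    also have "\<dots> = cinner (P (?R x)) (?R y)" by (rule cinner_commute[symmetric])
    also have "\<dots> = cinner x (?R' (P (?R y)))"
      by (simp add: projection_cinner[OF E P] cinner_fold R Pm that)
    finally show ?thesis .
  qed
qed

end

text \<open>If \<open>y\<close> is in the range of \<open>Q j\<close>, then \<open>norm y ^ 2 = (\<Sum>k. norm (Q k y) ^ 2)\<close> is already exhausted by
  the \<open>j\<close>-th term.\<close>

lemma projections_sum_to_id_orthogonal:
  assumes I: "finite I" and Q: "\<And>i. i \<in> I \<Longrightarrow> orth_projection_on E (Q i)"
    and sum: "\<And>x. x \<in> E \<Longrightarrow> (\<Sum>i\<in>I. Q i x) = x" and ij: "i \<in> I" "j \<in> I" "i \<noteq> j" and x: "x \<in> E"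
  shows "Q i (Q j x) = 0"
proof -
  define y where "y = Q j x"
  have y: "y \<in> E" unfolding y_def by (rule op_closed[OF projection_op[OF Q[OF ij(2)]] x])
  have norm: "cinner (Q k y) y = of_real ((norm (Q k y))\<^sup>2)" if "k \<in> I" for k
    using projection_cinner[OF E Q[OF that], of "Q k y" y] op_closed[OF projection_op[OF Q[OF that]] y]
    by (simp add: y projection_idem[OF Q[OF that]] cinner_self)
  have "complex_of_real ((norm y)\<^sup>2) = (\<Sum>k\<in>I. cinner (Q k y) y)"
    using sum[OF y] by (simp only: cinner_self[symmetric] cinner_sum_left[symmetric])
  also have "\<dots> = of_real (\<Sum>k\<in>I. (norm (Q k y))\<^sup>2)" by (simp add: norm)
  finally have "(norm y)\<^sup>2 = (\<Sum>k\<in>I. (norm (Q k y))\<^sup>2)" by (simp only: of_real_eq_iff)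
  also have "\<dots> = (norm (Q j y))\<^sup>2 + (\<Sum>k\<in>I - {j}. (norm (Q k y))\<^sup>2)"
    by (rule sum.remove[OF I ij(2)])
  also have "Q j y = y" unfolding y_def by (rule projection_idem[OF Q[OF ij(2)] x])
  finally have "(\<Sum>k\<in>I - {j}. (norm (Q k y))\<^sup>2) = 0" by simp
  then have "(norm (Q i y))\<^sup>2 = 0" using I ij by (subst (asm) sum_nonneg_eq_0_iff) auto
  then show ?thesis by (simp add: y_def)
qed

section \<open>Symbol tuples and the relations between projections and unitaries\<close>

context
  fixes n :: nat and P U :: "nat \<Rightarrow> 'a \<Rightarrow> 'a"
  assumes P: "\<And>i. i \<in> {1..n} \<Longrightarrow> orth_projection_on E (P i)" and U: "\<And>i. i \<in> {1..n} \<Longrightarrow> unitary_on E (U i)"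
begin

lemma conj_proj_projection: "i \<in> {1..n} \<Longrightarrow> orth_projection_on E (conj_proj E P U i)"
  unfolding conj_proj_def[abs_def] by (rule projection_conjugate[OF _ P]) (auto intro: U)

lemma conj_proj_mem: "i \<in> {1..n} \<Longrightarrow> x \<in> E \<Longrightarrow> conj_proj E P U i x \<in> E"
  by (rule op_closed[OF projection_op[OF conj_proj_projection]])

lemma fold_conj_proj:
  assumes i: "i \<in> {1..n}" and x: "x \<in> E"
  shows "fold U [1..<i] (conj_proj E P U i x) = P i (fold U [1..<i] x)"
  unfolding conj_proj_def
proof (rule fold_foldr_adj)
  show "P i (fold U [1..<i] x) \<in> E"
    using i x by (intro op_closed[OF projection_op[OF P]] op_closed[OF op_fold]) (auto intro: U)
qed (use i U in auto)

lemma op_fold_upt: "m \<le> n \<Longrightarrow> bounded_op_on E (fold U [1..<Suc m])"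
  by (rule op_fold) (auto intro: U)

lemma sum_conj_proj_mem: "m \<le> n \<Longrightarrow> x \<in> E \<Longrightarrow> (\<Sum>i=1..m. conj_proj E P U i x) \<in> E"
  by (intro csubspace_sum[OF E] conj_proj_mem) auto

text \<open>Each factor adds one summand \<open>(z - 1) * conj_proj i x\<close>. The projection in the next factor would
  contribute terms with higher powers of \<open>z - 1\<close>, but it annihilates the summands collected so far.\<close>

lemma fold_symbol_if_orthogonal:
  assumes orth: "\<And>i j x. i \<in> {1..n} \<Longrightarrow> j \<in> {1..n} \<Longrightarrow> i \<noteq> j \<Longrightarrow> x \<in> E \<Longrightarrow> conj_proj E P U i (conj_proj E P U j x) = 0"
    and x: "x \<in> E"
  shows "m \<le> n \<Longrightarrow> fold (\<lambda>i. symbol (P i) (U i) z) [1..<Suc m] x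
    = fold U [1..<Suc m] (x + (z - 1) *\<^sub>C (\<Sum>i=1..m. conj_proj E P U i x))"
proof (induction m)
  case (Suc m)
  let ?i = "Suc m"
  define s where "s = (\<Sum>i=1..m. conj_proj E P U i x)"
  define y where "y = x + (z - 1) *\<^sub>C s"
  have i: "?i \<in> {1..n}" using Suc.prems by simp
  have s: "s \<in> E" unfolding s_def using Suc.prems by (intro sum_conj_proj_mem x) simp
  have y: "y \<in> E" unfolding y_def by (intro csubspace_add[OF E] csubspace_scaleC[OF E] x s)
  let ?R = "fold U [1..<Suc m]"
  have R: "bounded_op_on E ?R" using Suc.prems by (intro op_fold_upt) simp
  have opQ: "bounded_op_on E (conj_proj E P U ?i)" by (rule projection_op[OF conj_proj_projection[OF i]])
  have "conj_proj E P U ?i s = (\<Sum>j=1..m. conj_proj E P U ?i (conj_proj E P U j x))"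
    unfolding s_def using Suc.prems x by (intro op_sum[OF opQ E] conj_proj_mem) auto
  also have "\<dots> = 0" using Suc.prems x by (intro sum.neutral ballI orth) auto
  finally have Qy: "conj_proj E P U ?i y = conj_proj E P U ?i x"
    using x s by (simp add: y_def op_add[OF opQ] op_scaleC[OF opQ] csubspace_scaleC[OF E])
  have PR: "P ?i (?R y) = ?R (conj_proj E P U ?i x)" using fold_conj_proj[OF i y] Qy by simp
  have Qx: "conj_proj E P U ?i x \<in> E" by (rule conj_proj_mem[OF i x])
  have Ry: "?R y \<in> E" by (rule op_closed[OF R y])
  have "fold (\<lambda>i. symbol (P i) (U i) z) [1..<Suc ?i] x = symbol (P ?i) (U ?i) z (?R y)"
    using Suc unfolding y_def s_def by simp
  also have "\<dots> = U ?i (?R y) + (z - 1) *\<^sub>C U ?i (?R (conj_proj E P U ?i x))"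
    using symbol_around_1[OF P[OF i] U[OF i] Ry] PR by simp
  also have "\<dots> = fold U [1..<Suc ?i] y + (z - 1) *\<^sub>C fold U [1..<Suc ?i] (conj_proj E P U ?i x)"
    by simp
  also have "\<dots> = fold U [1..<Suc ?i] (y + (z - 1) *\<^sub>C conj_proj E P U ?i x)"
    using op_fold_upt[OF Suc.prems] y Qx
    by (simp only: op_add[OF op_fold_upt[OF Suc.prems]] op_scaleC[OF op_fold_upt[OF Suc.prems]] csubspace_scaleC[OF E])
  also have "y + (z - 1) *\<^sub>C conj_proj E P U ?i x = x + (z - 1) *\<^sub>C (\<Sum>i=1..?i. conj_proj E P U i x)"
    by (simp add: y_def s_def scaleC_add_right add.assoc)
  finally show ?case .
qed simp

text \<open>Without orthogonality the product is a polynomial in \<open>z - 1\<close> whose coefficients of order \<open>0\<close> and \<open>1\<close>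
  are still those of the affine function above: passing from one factor to the next, \<open>c k\<close> is replaced
  by \<open>U (c k) + U (P (c (k - 1)))\<close>.\<close>

lemma fold_symbol_expansion:
  assumes x: "x \<in> E"
  shows "m \<le> n \<Longrightarrow> \<exists>c. (\<forall>k. c k \<in> E) \<and> (\<forall>k>m. c k = 0)
    \<and> (\<forall>z. fold (\<lambda>i. symbol (P i) (U i) z) [1..<Suc m] x = (\<Sum>k\<le>m. (z - 1) ^ k *\<^sub>C c k))
    \<and> c 0 = fold U [1..<Suc m] x \<and> c 1 = fold U [1..<Suc m] (\<Sum>i=1..m. conj_proj E P U i x)"
proof (induction m)
  case 0
  show ?case by (rule exI[of _ "\<lambda>k. if k = 0 then x else 0"]) (auto simp: x csubspace_zero[OF E])
next
  case (Suc m)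
  let ?i = "Suc m"
  have i: "?i \<in> {1..n}" using Suc.prems by simp
  obtain c where c: "\<And>k. c k \<in> E" "\<And>k. k > m \<Longrightarrow> c k = 0"
    "\<And>z. fold (\<lambda>i. symbol (P i) (U i) z) [1..<Suc m] x = (\<Sum>k\<le>m. (z - 1) ^ k *\<^sub>C c k)"
    "c 0 = fold U [1..<Suc m] x" "c 1 = fold U [1..<Suc m] (\<Sum>i=1..m. conj_proj E P U i x)"
    using Suc by force
  have opU: "bounded_op_on E (U ?i)" by (rule unitary_op[OF U[OF i]])
  have opB: "bounded_op_on E (\<lambda>x. U ?i (P ?i x))" by (rule op_proj_part[OF P[OF i] U[OF i]])
  define c' where "c' k = U ?i (c k) + shift_seq (\<lambda>k. U ?i (P ?i (c k))) k" for k
  have "c' k \<in> E" for k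
    unfolding c'_def using csubspace_zero[OF E]
    by (cases k) (auto intro!: csubspace_add[OF E] op_closed[OF opU] op_closed[OF opB] c)
  moreover have "c' k = 0" if "k > ?i" for k
    using that c(2) by (cases k) (auto simp: c'_def op_zero[OF opU E] op_zero[OF opB E])
  moreover have "fold (\<lambda>i. symbol (P i) (U i) z) [1..<Suc ?i] x = (\<Sum>k\<le>?i. (z - 1) ^ k *\<^sub>C c' k)" for z
  proof -
    let ?s = "\<Sum>k\<le>m. (z - 1) ^ k *\<^sub>C c k"
    have s: "?s \<in> E" by (intro csubspace_sum[OF E] csubspace_scaleC[OF E] c)
    have Us: "U ?i ?s = (\<Sum>k\<le>m. (z - 1) ^ k *\<^sub>C U ?i (c k))"
      by (subst op_sum[OF opU E]) (auto intro!: csubspace_scaleC[OF E] c sum.cong simp: op_scaleC[OF opU c(1)])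
    have Bs: "U ?i (P ?i ?s) = (\<Sum>k\<le>m. (z - 1) ^ k *\<^sub>C U ?i (P ?i (c k)))"
      by (subst op_sum[OF opB E]) (auto intro!: csubspace_scaleC[OF E] c sum.cong simp: op_scaleC[OF opB c(1)])
    have "(\<Sum>k\<le>?i. (z - 1) ^ k *\<^sub>C c' k) = (\<Sum>k\<le>?i. (z - 1) ^ k *\<^sub>C U ?i (c k))
        + (\<Sum>k\<le>?i. (z - 1) ^ k *\<^sub>C shift_seq (\<lambda>k. U ?i (P ?i (c k))) k)"
      by (simp only: c'_def scaleC_add_right sum.distrib)
    also have "(\<Sum>k\<le>?i. (z - 1) ^ k *\<^sub>C U ?i (c k)) = U ?i ?s"
      unfolding Us by (simp add: c(2) op_zero[OF opU E])
    also have "(\<Sum>k\<le>?i. (z - 1) ^ k *\<^sub>C shift_seq (\<lambda>k. U ?i (P ?i (c k))) k)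
        = (\<Sum>k\<le>m. (z - 1) ^ Suc k *\<^sub>C U ?i (P ?i (c k)))"
      by (simp add: sum.atMost_Suc_shift del: sum.atMost_Suc)
    also have "\<dots> = (z - 1) *\<^sub>C U ?i (P ?i ?s)"
      unfolding Bs by (simp add: scaleC_sum_right scaleC_scaleC)
    finally show ?thesis using c(3)[of z] symbol_around_1[OF P[OF i] U[OF i] s] by simp
  qed
  moreover have "c' 0 = fold U [1..<Suc ?i] x" by (simp add: c'_def c)
  moreover have "c' 1 = fold U [1..<Suc ?i] (\<Sum>i=1..?i. conj_proj E P U i x)"
  proof -
    let ?s = "\<Sum>i=1..m. conj_proj E P U i x"
    have s: "?s \<in> E" using Suc.prems by (intro sum_conj_proj_mem x) simp
    have R: "bounded_op_on E (fold U [1..<Suc m])" using Suc.prems by (intro op_fold_upt) simp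
    have "c' 1 = U ?i (fold U [1..<Suc m] ?s) + U ?i (fold U [1..<Suc m] (conj_proj E P U ?i x))"
      using fold_conj_proj[OF i x] c(4,5) by (simp add: c'_def)
    also have "\<dots> = U ?i (fold U [1..<Suc m] (?s + conj_proj E P U ?i x))"
      using op_add[OF R s conj_proj_mem[OF i x]] op_add[OF opU op_closed[OF R s] op_closed[OF R conj_proj_mem[OF i x]]]
      by simp
    finally show ?thesis by simp
  qed
  ultimately show ?case by (intro exI[of _ c']) blast
qed

end

text \<open>Commutation of the outer coefficients of the symbols is assumed, in adjoint form for the constant
  ones. As the \<open>U i\<close> commute, and \<open>U i * U j\<close> is the sum of all three coefficients of the product of two
  symbols, the middle coefficient is symmetric as well.\<close>

lemma symbol_relations_imp_tuple:
  assumes rel: "symbol_relations n E P U"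
  shows "symbol_tuple n E P U"
proof -
  have P: "orth_projection_on E (P i)" and U: "unitary_on E (U i)" if "i \<in> {1..n}" for i
    using rel that by (auto simp: symbol_relations_def Let_def)
  have Ucomm: "U i (U j x) = U j (U i x)" if "i \<in> {1..n}" "j \<in> {1..n}" "x \<in> E" for i j x
    using rel that by (auto simp: symbol_relations_def Let_def)
  have comm: "symbol (P i) (U i) z (symbol (P j) (U j) z x) = symbol (P j) (U j) z (symbol (P i) (U i) z x)"
    if i: "i \<in> {1..n}" and j: "j \<in> {1..n}" and x: "x \<in> E" for i j z x
  proof -
    have A: "U i (perp (P i) (U j (perp (P j) x))) = U j (perp (P j) (U i (perp (P i) x)))"
    proof (rule adjoint_commute[OF op_perp_part_adj[OF P U] op_perp_part_adj[OF P U] op_perp_part[OF P U] op_perp_part[OF P U]])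
      show "cinner (perp (P i) (adj_on E (U i) x)) y = cinner x (U i (perp (P i) y))" if "x \<in> E" "y \<in> E" for x y
        using cinner_perp_part[OF P[OF i] U[OF i] that(2,1)] by (metis cinner_commute)
      show "cinner (perp (P j) (adj_on E (U j) x)) y = cinner x (U j (perp (P j) y))" if "x \<in> E" "y \<in> E" for x y
        using cinner_perp_part[OF P[OF j] U[OF j] that(2,1)] by (metis cinner_commute)
      show "perp (P i) (adj_on E (U i) (perp (P j) (adj_on E (U j) x)))
          = perp (P j) (adj_on E (U j) (perp (P i) (adj_on E (U i) x)))" if "x \<in> E" for x
        using rel i j that by (auto simp: symbol_relations_def Let_def)
    qed (use i j x in auto)
    have B: "U i (P i (U j (P j x))) = U j (P j (U i (P i x)))"
      using rel i j x by (auto simp: symbol_relations_def Let_def)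
    have split: "U i' (U j' x) = U i' (perp (P i') (U j' (perp (P j') x)))
        + (U i' (perp (P i') (U j' (P j' x))) + U i' (P i' (U j' (perp (P j') x)))) + U i' (P i' (U j' (P j' x)))"
      if i': "i' \<in> {1..n}" and j': "j' \<in> {1..n}" for i' j'
      using symbol_symbol[OF P[OF i'] U[OF i'] P[OF j'] U[OF j'] x, of 1]
      by (simp add: symbol_1[OF P[OF j'] U[OF j'] x] symbol_1[OF P[OF i'] U[OF i'] op_closed[OF unitary_op[OF U[OF j']] x]])
    have "U i (perp (P i) (U j (P j x))) + U i (P i (U j (perp (P j) x)))
        = U j (perp (P j) (U i (P i x))) + U j (P j (U i (perp (P i) x)))"
      using split[OF i j] split[OF j i] Ucomm[OF i j x] A B by simp
    then show ?thesis using symbol_symbol[OF P[OF i] U[OF i] P[OF j] U[OF j] x, of z]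
      symbol_symbol[OF P[OF j] U[OF j] P[OF i] U[OF i] x, of z] A B by simp
  qed
  have prod: "foldr (\<lambda>i. symbol (P i) (U i) z) [1..<Suc n] x = z *\<^sub>C x" if x: "x \<in> E" for z x
  proof -
    have sum: "(\<Sum>i=1..n. conj_proj E P U i x) = x" if "x \<in> E" for x
      using rel that unfolding symbol_relations_def Let_def conj_proj_def by blast
    have orth: "conj_proj E P U i (conj_proj E P U j x) = 0"
      if "i \<in> {1..n}" "j \<in> {1..n}" "i \<noteq> j" "x \<in> E" for i j x
      by (rule projections_sum_to_id_orthogonal[where I = "{1..n}"])
        (use that sum conj_proj_projection[where n = n and P = P and U = U, OF P U] in auto)
    have id: "fold U [1..<Suc n] x = x" if "x \<in> E" for x
    proof -
      have "foldr U [1..<Suc n] x = fold U [1..<Suc n] x"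
        by (rule foldr_eq_fold_if_commute[where E = E]) (auto simp: that Ucomm intro: op_closed[OF unitary_op[OF U]])
      then show ?thesis using rel that by (simp add: symbol_relations_def Let_def)
    qed
    have "foldr (\<lambda>i. symbol (P i) (U i) z) [1..<Suc n] x = fold (\<lambda>i. symbol (P i) (U i) z) [1..<Suc n] x"
      by (rule foldr_eq_fold_if_commute[where E = E]) (use x comm symbol_mem[OF P U] in auto)
    also have "\<dots> = fold U [1..<Suc n] (x + (z - 1) *\<^sub>C x)"
      using fold_symbol_if_orthogonal[where n = n and P = P and U = U, OF P U orth x, of n z] sum[OF x] by simp
    also have "\<dots> = x + (z - 1) *\<^sub>C x" by (rule id) (intro csubspace_add[OF E] csubspace_scaleC[OF E] x)
    finally show ?thesis by (simp add: scaleC_diff_left)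
  qed
  show ?thesis unfolding symbol_tuple_def using P U comm prod by blast
qed

text \<open>All relations are comparisons of coefficients: in powers of \<open>z\<close> for the products of two symbols, in
  powers of \<open>z - 1\<close> for the product of all.\<close>

lemma symbol_tuple_imp_relations:
  assumes tup: "symbol_tuple n E P U" and n: "1 \<le> n"
  shows "symbol_relations n E P U"
proof -
  have P: "orth_projection_on E (P i)" and U: "unitary_on E (U i)" if "i \<in> {1..n}" for i
    using tup that by (auto simp: symbol_tuple_def)
  have comm: "symbol (P i) (U i) z (symbol (P j) (U j) z x) = symbol (P j) (U j) z (symbol (P i) (U i) z x)"
    if "i \<in> {1..n}" "j \<in> {1..n}" "cmod z < 1" "x \<in> E" for i j z x
    using tup that unfolding symbol_tuple_def by blast
  define A where "A i x = U i (perp (P i) x)" for i x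
  define B where "B i x = U i (P i x)" for i x
  define C where "C i j x = A i (B j x) + B i (A j x)" for i j x
  have coeffs: "A i (A j x) = A j (A i x) \<and> C i j x = C j i x \<and> B i (B j x) = B j (B i x)"
    if i: "i \<in> {1..n}" and j: "j \<in> {1..n}" and x: "x \<in> E" for i j x
  proof -
    define c where "c i j k = (if k = 0 then A i (A j x) else if k = 1 then C i j x else B i (B j x))" for i j and k :: nat
    have exp: "symbol (P i') (U i') z (symbol (P j') (U j') z x) = (\<Sum>k\<le>2. z ^ k *\<^sub>C c i' j' k)"
      if "i' \<in> {1..n}" "j' \<in> {1..n}" for i' j' z
      using symbol_symbol[OF P[OF that(1)] U[OF that(1)] P[OF that(2)] U[OF that(2)] x, of z]
      by (simp add: c_def A_def B_def C_def numeral_2_eq_2)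
    have eq: "c i j k = c j i k" if "k \<le> 2" for k
    proof (rule vector_polynomial_eq[OF infinite_shifted_unit_disk[of 0] _ that])
      fix w assume "w \<in> (\<lambda>z. z - 0) ` {z::complex. cmod z < 1}"
      then have "cmod w < 1" by auto
      then show "(\<Sum>k\<le>2. w ^ k *\<^sub>C c i j k) = (\<Sum>k\<le>2. w ^ k *\<^sub>C c j i k)"
        using comm[OF i j _ x, of w] exp[OF i j, of w] exp[OF j i, of w] by simp
    qed
    show ?thesis using eq[of 0] eq[of 1] eq[of 2] by (simp add: c_def)
  qed
  have Ucomm: "U i (U j x) = U j (U i x)" if i: "i \<in> {1..n}" and j: "j \<in> {1..n}" and x: "x \<in> E" for i j x
  proof -
    have "U i' (U j' x) = A i' (A j' x) + C i' j' x + B i' (B j' x)"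
      if "i' \<in> {1..n}" "j' \<in> {1..n}" for i' j'
      using symbol_symbol[OF P[OF that(1)] U[OF that(1)] P[OF that(2)] U[OF that(2)] x, of 1]
      by (simp add: A_def B_def C_def symbol_1[OF P[OF that(2)] U[OF that(2)] x]
        symbol_1[OF P[OF that(1)] U[OF that(1)] op_closed[OF unitary_op[OF U[OF that(2)]] x]])
    then show ?thesis using coeffs[OF i j x] i j by metis
  qed
  have expansion: "fold U [1..<Suc n] x = x \<and> fold U [1..<Suc n] (\<Sum>i=1..n. conj_proj E P U i x) = x"
    if x: "x \<in> E" for x
  proof -
    obtain c where c: "\<And>z. fold (\<lambda>i. symbol (P i) (U i) z) [1..<Suc n] x = (\<Sum>k\<le>n. (z - 1) ^ k *\<^sub>C c k)"
      "c 0 = fold U [1..<Suc n] x" "c 1 = fold U [1..<Suc n] (\<Sum>i=1..n. conj_proj E P U i x)"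
      using fold_symbol_expansion[where n = n and P = P and U = U, OF P U x order_refl] by blast
    \<comment> \<open>The coefficients of \<open>z x = x + (z - 1) x\<close>.\<close>
    define d where "d k = (if k \<le> 1 then x else 0)" for k :: nat
    have eq: "c k = d k" if "k \<le> n" for k
    proof (rule vector_polynomial_eq[OF infinite_shifted_unit_disk[of 1] _ that])
      fix w assume "w \<in> (\<lambda>z. z - 1) ` {z::complex. cmod z < 1}"
      then obtain z where z: "cmod z < 1" "w = z - 1" by auto
      have "foldr (\<lambda>i. symbol (P i) (U i) z) [1..<Suc n] x = fold (\<lambda>i. symbol (P i) (U i) z) [1..<Suc n] x"
        by (rule foldr_eq_fold_if_commute[where E = E]) (use x z(1) comm symbol_mem[OF P U] in auto)
      then have "(\<Sum>k\<le>n. w ^ k *\<^sub>C c k) = z *\<^sub>C x"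
        using tup z x c(1)[of z] by (simp add: symbol_tuple_def)
      moreover have "(\<Sum>k\<le>n. w ^ k *\<^sub>C d k) = (\<Sum>k\<in>{0, 1}. w ^ k *\<^sub>C d k)"
        using n by (intro sum.mono_neutral_right) (auto simp: d_def)
      ultimately show "(\<Sum>k\<le>n. w ^ k *\<^sub>C c k) = (\<Sum>k\<le>n. w ^ k *\<^sub>C d k)"
        using z(2) by (simp add: d_def scaleC_diff_left)
    qed
    show ?thesis using eq[of 0] eq[of 1] n c(2,3) by (simp add: d_def)
  qed
  show ?thesis
    unfolding symbol_relations_def Let_def
  proof (intro conjI ballI)
    fix i j x assume i: "i \<in> {1..n}" and j: "j \<in> {1..n}" and x: "x \<in> E"
    show "U i (U j x) = U j (U i x)" by (rule Ucomm[OF i j x])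
    show "U i (P i (U j (P j x))) = U j (P j (U i (P i x)))" using coeffs[OF i j x] by (simp add: B_def)
    have swap: "U i (perp (P i) (U j (perp (P j) y))) = U j (perp (P j) (U i (perp (P i) y)))" if "y \<in> E" for y
      using coeffs[OF i j that] by (simp add: A_def)
    show "perp (P i) (adj_on E (U i) (perp (P j) (adj_on E (U j) x)))
        = perp (P j) (adj_on E (U j) (perp (P i) (adj_on E (U i) x)))"
      by (rule adjoint_commute[OF op_perp_part[OF P[OF i] U[OF i]] op_perp_part[OF P[OF j] U[OF j]]
            op_perp_part_adj[OF P[OF i] U[OF i]] op_perp_part_adj[OF P[OF j] U[OF j]]
            cinner_perp_part[OF P[OF i] U[OF i]] cinner_perp_part[OF P[OF j] U[OF j]] swap x])
  next
    fix x assume x: "x \<in> E"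
    have "foldr U [1..<Suc n] x = fold U [1..<Suc n] x"
      by (rule foldr_eq_fold_if_commute[where E = E]) (auto simp: x Ucomm intro: op_closed[OF unitary_op[OF U]])
    then show "foldr U [1..<Suc n] x = x" using expansion[OF x] by simp
    have "(\<Sum>i=1..n. conj_proj E P U i x) \<in> E" by (rule sum_conj_proj_mem[where n = n and P = P and U = U, OF P U _ x]) auto
    then have "(\<Sum>i=1..n. conj_proj E P U i x) = x" using expansion x by metis
    then show "(\<Sum>i=1..n. foldr (\<lambda>i. adj_on E (U i)) [1..<i] (P i (fold U [1..<i] x))) = x"
      by (simp add: conj_proj_def)
  qed (use P U in auto)
qed

end

section \<open>Unitaries from isometries with dense range\<close>

lemma isometry_cinner:
  assumes L: "bounded_op_on E L" and E: "closed_csubspace (E::'a::complex_inner set)"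
    and norm: "\<And>x. x \<in> E \<Longrightarrow> norm (L x) = norm x" and x: "x \<in> E" and y: "y \<in> E"
  shows "cinner (L x) (L y) = cinner x y"
proof -
  have inner: "inner (L u) (L v) = inner u v" if u: "u \<in> E" and v: "v \<in> E" for u v
  proof -
    have "(norm (L u + L v))\<^sup>2 = (norm (u + v))\<^sup>2"
      using norm[OF csubspace_add[OF E u v]] by (simp add: op_add[OF L u v])
    moreover have "(norm (a + b))\<^sup>2 = (norm a)\<^sup>2 + (norm b)\<^sup>2 + 2 * inner a b" for a b :: 'a
      by (simp add: power2_norm_eq_inner inner_add_left inner_add_right inner_commute)
    ultimately show ?thesis using norm[OF u] norm[OF v] by simp
  qed
  show ?thesis
    using inner[OF x y] inner[OF x csubspace_scaleC[OF E y, of \<i>]]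
    by (simp add: complex_eq_iff Re_cinner Im_cinner op_scaleC[OF L y])
qed

text \<open>As \<open>norm (w x)\<close> depends on \<open>D x\<close> only, \<open>D x \<mapsto> w x\<close> is well defined and isometric on the range of
  \<open>D\<close>. Its continuous extension inherits the algebraic properties through limits of sequences.\<close>

lemma isometric_extension:
  fixes D w :: "'a::chilbert_space \<Rightarrow> 'a"
  assumes D: "bounded_op_on UNIV D" and w: "bounded_op_on UNIV w"
    and norm: "\<And>x. norm (w x) = norm (D x)" and E: "closed_csubspace E"
    and clD: "closure (range D) = E" and clw: "closure (range w) = E"
  shows "\<exists>L. bounded_op_on E L \<and> (\<forall>x. L (D x) = w x) \<and> (\<forall>x\<in>E. norm (L x) = norm x)"
proof -
  have w_eq: "w x = w y" if "D x = D y" for x y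
    using norm[of "x - y"] that by (simp add: op_diff[OF D] op_diff[OF w])
  define f where "f y = w (SOME x. D x = y)" for y
  have f: "f (D x) = w x" for x
    unfolding f_def by (rule w_eq) (rule someI[of "\<lambda>z. D z = D x" x], simp)
  have "1-lipschitz_on (range D) f"
  proof (rule lipschitz_onI)
    fix u v assume "u \<in> range D" "v \<in> range D"
    then obtain x y where "u = D x" "v = D y" by blast
    then show "dist (f u) (f v) \<le> 1 * dist u v"
      using norm[of "x - y"] by (simp add: f dist_norm op_diff[OF D] op_diff[OF w])
  qed simp
  then have "uniformly_continuous_on (range D) f" by (rule lipschitz_on_uniformly_continuous)
  then obtain L where L: "uniformly_continuous_on (closure (range D)) L" "\<And>y. y \<in> range D \<Longrightarrow> f y = L y"
    using uniformly_continuous_on_extension_on_closure by metis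
  have cont: "continuous_on E L" using uniformly_continuous_imp_continuous[OF L(1)] clD by simp
  have LD: "L (D x) = w x" for x using L(2)[of "D x"] f[of x] by simp
  have DE: "D y \<in> E" for y unfolding clD[symmetric] by (rule subsetD[OF closure_subset rangeI])
  have Llim: "(\<lambda>k. L (D (u k))) \<longlonglongrightarrow> L x" if "x \<in> E" "(\<lambda>k. D (u k)) \<longlonglongrightarrow> x" for u and x :: 'a
    by (rule continuous_on_tendsto_compose[OF cont that(2,1)]) (simp add: DE)
  have approx: "\<exists>u. (\<lambda>k. D (u k)) \<longlonglongrightarrow> x \<and> (\<lambda>k. w (u k)) \<longlonglongrightarrow> L x" if x: "x \<in> E" for x
  proof -
    obtain v where v: "\<And>k. v k \<in> range D" "v \<longlonglongrightarrow> x"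
      using x unfolding clD[symmetric] closure_sequential by blast
    have "\<exists>y. v k = D y" for k using v(1)[of k] by blast
    then obtain u where u: "\<And>k. v k = D (u k)" by metis
    then have "v = (\<lambda>k. D (u k))" by (rule ext)
    with v(2) have "(\<lambda>k. D (u k)) \<longlonglongrightarrow> x" by (rule subst[rotated])
    moreover from this have "(\<lambda>k. L (D (u k))) \<longlonglongrightarrow> L x" by (rule Llim[OF x])
    ultimately show ?thesis unfolding LD by blast
  qed
  have mem: "L x \<in> E" if x: "x \<in> E" for x
  proof -
    obtain u where "(\<lambda>k. w (u k)) \<longlonglongrightarrow> L x" using approx[OF x] by blast
    then show ?thesis unfolding clw[symmetric] by (rule closure_limI[OF rangeI])
  qed
  have add: "L (x + y) = L x + L y" if x: "x \<in> E" and y: "y \<in> E" for x y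
  proof -
    obtain u where u: "(\<lambda>k. D (u k)) \<longlonglongrightarrow> x" "(\<lambda>k. w (u k)) \<longlonglongrightarrow> L x" using approx[OF x] by blast
    obtain v where v: "(\<lambda>k. D (v k)) \<longlonglongrightarrow> y" "(\<lambda>k. w (v k)) \<longlonglongrightarrow> L y" using approx[OF y] by blast
    have "(\<lambda>k. D (u k + v k)) \<longlonglongrightarrow> x + y" using tendsto_add[OF u(1) v(1)] by (simp add: op_add[OF D])
    then have "(\<lambda>k. L (D (u k + v k))) \<longlonglongrightarrow> L (x + y)"
      by (rule Llim[OF csubspace_add[OF E x y]])
    moreover have "(\<lambda>k. L (D (u k + v k))) \<longlonglongrightarrow> L x + L y"
      using tendsto_add[OF u(2) v(2)] by (simp add: LD op_add[OF w])
    ultimately show ?thesis by (rule LIMSEQ_unique)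
  qed
  have scale: "L (c *\<^sub>C x) = c *\<^sub>C L x" if x: "x \<in> E" for c x
  proof -
    obtain u where u: "(\<lambda>k. D (u k)) \<longlonglongrightarrow> x" "(\<lambda>k. w (u k)) \<longlonglongrightarrow> L x" using approx[OF x] by blast
    have "(\<lambda>k. D (c *\<^sub>C u k)) \<longlonglongrightarrow> c *\<^sub>C x"
      using bounded_linear.tendsto[OF bounded_linear_scaleC_right u(1)] by (simp add: op_scaleC[OF D])
    then have "(\<lambda>k. L (D (c *\<^sub>C u k))) \<longlonglongrightarrow> L (c *\<^sub>C x)"
      by (rule Llim[OF csubspace_scaleC[OF E x]])
    moreover have "(\<lambda>k. L (D (c *\<^sub>C u k))) \<longlonglongrightarrow> c *\<^sub>C L x"
      using bounded_linear.tendsto[OF bounded_linear_scaleC_right u(2)] by (simp add: LD op_scaleC[OF w])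
    ultimately show ?thesis by (rule LIMSEQ_unique)
  qed
  have normL: "norm (L x) = norm x" if x: "x \<in> E" for x
  proof -
    obtain u where u: "(\<lambda>k. D (u k)) \<longlonglongrightarrow> x" "(\<lambda>k. w (u k)) \<longlonglongrightarrow> L x" using approx[OF x] by blast
    show ?thesis using tendsto_norm[OF u(1)] tendsto_norm[OF u(2)] norm LIMSEQ_unique by simp
  qed
  have "bounded_op_on E L" unfolding bounded_op_on_def
    using mem add scale normL by (auto intro!: exI[of _ 1])
  then show ?thesis using LD normL by blast
qed

text \<open>The extension and the one with \<open>D\<close> and \<open>w\<close> exchanged are inverse to each other on dense sets.\<close>

lemma unitary_extension:
  fixes D w :: "'a::chilbert_space \<Rightarrow> 'a"
  assumes D: "bounded_op_on UNIV D" and w: "bounded_op_on UNIV w"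
    and norm: "\<And>x. norm (w x) = norm (D x)" and E: "closed_csubspace E"
    and clD: "closure (range D) = E" and clw: "closure (range w) = E"
  shows "\<exists>L. unitary_on E L \<and> (\<forall>x. L (D x) = w x)"
proof -
  obtain L where L: "bounded_op_on E L" "\<And>x. L (D x) = w x" "\<And>x. x \<in> E \<Longrightarrow> norm (L x) = norm x"
    using isometric_extension[OF D w norm E clD clw] by blast
  obtain M where M: "bounded_op_on E M" "\<And>x. M (w x) = D x"
    using isometric_extension[OF w D norm[symmetric] E clw clD] by blast
  have "M (L x) = x" if "x \<in> E" for x
    by (rule op_eq_on_closure[OF op_compose[OF M(1) L(1)] op_id E clD[symmetric] _ that]) (auto simp: L(2) M(2))
  moreover have "L (M x) = x" if "x \<in> E" for x
    by (rule op_eq_on_closure[OF op_compose[OF L(1) M(1)] op_id E clw[symmetric] _ that]) (auto simp: L(2) M(2))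
  ultimately have "unitary_on E L"
    using op_closed[OF M(1)] isometry_cinner[OF L(1) E L(3)] by (intro unitaryI(1)[OF E L(1), where V = M]) auto
  then show ?thesis using L(2) by blast
qed

section \<open>Unitary equivalence of symbol tuples\<close>

context
  fixes E :: "'a::chilbert_space set"
  assumes E: "closed_csubspace E"
begin

context
  fixes L :: "'a \<Rightarrow> 'a"
  assumes L: "unitary_on E L"
begin

abbreviation L_conj :: "('a \<Rightarrow> 'a) \<Rightarrow> 'a \<Rightarrow> 'a"
  where "L_conj A x \<equiv> adj_on E L (A (L x))"

lemma L_mem: "x \<in> E \<Longrightarrow> L x \<in> E" and L_adj_mem: "x \<in> E \<Longrightarrow> adj_on E L x \<in> E"
  using op_closed[OF unitary_op[OF L]] adj_on_mem[OF E unitary_op[OF L]] by auto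

lemma op_conj: "bounded_op_on E A \<Longrightarrow> bounded_op_on E (L_conj A)"
  by (intro op_compose[OF op_adj_on[OF E unitary_op[OF L]]] op_compose[OF _ unitary_op[OF L]])

lemma projection_conj:
  assumes P: "orth_projection_on E P"
  shows "orth_projection_on E (L_conj P)"
  using projection_conjugate[OF E, of "[0]" "\<lambda>_. L" P] L P by simp

lemma unitary_conj:
  assumes U: "unitary_on E U"
  shows "unitary_on E (L_conj U)" "x \<in> E \<Longrightarrow> adj_on E (L_conj U) x = L_conj (adj_on E U) x"
proof -
  have Um: "x \<in> E \<Longrightarrow> U x \<in> E" and Um': "x \<in> E \<Longrightarrow> adj_on E U x \<in> E" for x
    using op_closed[OF unitary_op[OF U]] adj_on_mem[OF E unitary_op[OF U]] by auto
  have op: "bounded_op_on E (L_conj U)" by (rule op_conj[OF unitary_op[OF U]])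
  have 1: "L_conj (adj_on E U) x \<in> E \<and> L_conj (adj_on E U) (L_conj U x) = x \<and> L_conj U (L_conj (adj_on E U) x) = x"
    if "x \<in> E" for x
    using that by (simp add: L_mem L_adj_mem Um Um' unitary_adj_left[OF L] unitary_adj_right[OF L]
      unitary_adj_left[OF U] unitary_adj_right[OF U])
  have 2: "cinner (L_conj U x) (L_conj U y) = cinner x y" if x: "x \<in> E" and y: "y \<in> E" for x y
  proof (rule isometry_cinner[OF op E _ x y])
    show "norm (L_conj U x) = norm x" if "x \<in> E" for x
      using that by (simp add: unitary_norm[OF E unitary_adj_unitary[OF E L]] unitary_norm[OF E U]
        unitary_norm[OF E L] Um L_mem)
  qed
  from unitaryI[OF E op 1 2] show "unitary_on E (L_conj U)" "x \<in> E \<Longrightarrow> adj_on E (L_conj U) x = L_conj (adj_on E U) x"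
    by blast+
qed

lemma perp_conj:
  assumes "bounded_op_on E P" "x \<in> E"
  shows "perp (L_conj P) x = L_conj (perp P) x"
  using assms by (simp add: perp_def op_diff[OF op_adj_on[OF E unitary_op[OF L]] E] L_mem op_closed[OF assms(1)]
    unitary_adj_left[OF L])

lemma symbol_conj:
  assumes P: "orth_projection_on E P" and U: "unitary_on E U" and x: "x \<in> E"
  shows "symbol (L_conj P) (L_conj U) z x = L_conj (symbol P U z) x"
proof -
  have p: "perp P (L x) \<in> E" "P (L x) \<in> E"
    using op_closed[OF op_perp[OF projection_op[OF P] E]] op_closed[OF projection_op[OF P]] L_mem x by auto
  have u: "U (perp P (L x)) \<in> E" "U (P (L x)) \<in> E" using p op_closed[OF unitary_op[OF U]] by auto
  note adjL = op_adj_on[OF E unitary_op[OF L]]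
  show ?thesis
    unfolding symbol_def perp_conj[OF projection_op[OF P] x]
    using u by (simp add: unitary_adj_right[OF L] p op_add[OF adjL] op_scaleC[OF adjL] csubspace_scaleC[OF E])
qed

lemma symbol_tuple_conj:
  assumes tup: "symbol_tuple n E P U"
  shows "symbol_tuple n E (\<lambda>i. L_conj (P i)) (\<lambda>i. L_conj (U i))"
proof -
  have P: "orth_projection_on E (P i)" and U: "unitary_on E (U i)" if "i \<in> {1..n}" for i
    using tup that by (auto simp: symbol_tuple_def)
  have comm: "symbol (P i) (U i) z (symbol (P j) (U j) z x) = symbol (P j) (U j) z (symbol (P i) (U i) z x)"
    if "i \<in> {1..n}" "j \<in> {1..n}" "cmod z < 1" "x \<in> E" for i j z x
    using tup that unfolding symbol_tuple_def by blast
  have m: "symbol (P i) (U i) z x \<in> E" if "i \<in> {1..n}" "x \<in> E" for i z x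
    by (rule symbol_mem[OF E P U]) (use that in auto)
  have step: "symbol (L_conj (P i)) (L_conj (U i)) z x = L_conj (symbol (P i) (U i) z) x"
    if "i \<in> {1..n}" "x \<in> E" for i z x
    by (rule symbol_conj) (use that P U in auto)
  have prod: "foldr (\<lambda>i. symbol (L_conj (P i)) (L_conj (U i)) z) is x
      = L_conj (foldr (\<lambda>i. symbol (P i) (U i) z) is) x" if "set is \<subseteq> {1..n}" and x: "x \<in> E" for z x "is"
    using that(1)
  proof (induction "is")
    case Nil
    then show ?case using x by (simp add: unitary_adj_left[OF L])
  next
    case (Cons i "is")
    have "foldr (\<lambda>i. symbol (P i) (U i) z) is (L x) \<in> E"
      by (rule foldr_mem) (use Cons.prems m L_mem x in auto)
    then show ?case using Cons by (simp add: step L_adj_mem unitary_adj_right[OF L])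
  qed
  show ?thesis
    unfolding symbol_tuple_def
  proof (intro conjI ballI allI impI)
    fix i j z x assume "i \<in> {1..n}" "j \<in> {1..n}" "cmod z < 1" "x \<in> E"
    then show "symbol (L_conj (P i)) (L_conj (U i)) z (symbol (L_conj (P j)) (L_conj (U j)) z x)
        = symbol (L_conj (P j)) (L_conj (U j)) z (symbol (L_conj (P i)) (L_conj (U i)) z x)"
      using comm[of i j z "L x"] by (simp only: step m L_mem L_adj_mem unitary_adj_right[OF L])
  next
    fix z x assume z: "cmod z < 1" and x: "x \<in> E"
    have "foldr (\<lambda>i. symbol (P i) (U i) z) [1..<Suc n] (L x) = z *\<^sub>C L x"
      using tup z L_mem[OF x] by (simp add: symbol_tuple_def)
    moreover have "set [1..<Suc n] \<subseteq> {1..n}" by auto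
    ultimately show "foldr (\<lambda>i. symbol (L_conj (P i)) (L_conj (U i)) z) [1..<Suc n] x = z *\<^sub>C x"
      using prod[of "[1..<Suc n]" x z] op_scaleC[OF op_adj_on[OF E unitary_op[OF L]] L_mem[OF x]] x
      by (simp only: unitary_adj_left[OF L])
  qed (use P U projection_conj unitary_conj in auto)
qed

end

section \<open>Model isometries\<close>

context
  fixes P U :: "'a \<Rightarrow> 'a"
  assumes P: "orth_projection_on E P" and U: "unitary_on E U"
begin

lemma hardy_symbol:
  assumes f: "f \<in> hardy E"
  shows "mult_op (symbol P U) f \<in> hardy E"
    and "hardy_coeff (mult_op (symbol P U) f)
      = (\<lambda>k. U (perp P (hardy_coeff f k)) + shift_seq (\<lambda>k. U (P (hardy_coeff f k))) k)"
proof -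
  have eq: "mult_op (symbol P U) f = (\<lambda>z. U (perp P (f z)) + mult_z (\<lambda>z. U (P (f z))) z)"
    by (simp add: mult_op_def symbol_def)
  note a = hardy_op[OF E op_perp_part[OF E P U] f] and b = hardy_op[OF E op_proj_part[OF E P U] f]
  show "mult_op (symbol P U) f \<in> hardy E"
    "hardy_coeff (mult_op (symbol P U) f)
      = (\<lambda>k. U (perp P (hardy_coeff f k)) + shift_seq (\<lambda>k. U (P (hardy_coeff f k))) k)"
    unfolding eq using hardy_add[OF E a(1) hardy_mult_z(1)[OF E b(1)]] by (simp_all add: a b hardy_mult_z[OF E])
qed

text \<open>The unitary does not change norms, and the parts from \<open>perp P\<close> and from \<open>P\<close> are orthogonal in each
  degree. The shift of the second part loses nothing, so both parts together have the norm of \<open>f\<close>.\<close>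

lemma hardy_norm_symbol:
  assumes f: "f \<in> hardy E"
  shows "hardy_norm (mult_op (symbol P U) f) = hardy_norm f"
proof -
  let ?c = "hardy_coeff f"
  have c: "?c k \<in> E" for k by (rule hardy_coeff_mem[OF f])
  have opP: "bounded_op_on E P" and opp: "bounded_op_on E (perp P)"
    using projection_op[OF P] op_perp[OF projection_op[OF P] E] by auto
  define b where "b = shift_seq ?c"
  have bE: "b k \<in> E" for k using c csubspace_zero[OF E] by (cases k) (auto simp: b_def)
  have sum_p: "summable (\<lambda>k. (norm (perp P (?c k)))\<^sup>2)"
    using square_summable_op[OF E opp hardy_coeff_square_summable[OF f]] by (simp add: square_summable_def)
  have sum_P: "summable (\<lambda>k. (norm (P (?c k)))\<^sup>2)"
    using square_summable_op[OF E opP hardy_coeff_square_summable[OF f]] by (simp add: square_summable_def)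
  have sum_b: "summable (\<lambda>k. (norm (P (b k)))\<^sup>2)"
    using square_summable_op[OF E opP square_summable_shift[OF E hardy_coeff_square_summable[OF f]]]
    by (simp add: square_summable_def b_def)
  have norm_k: "(norm (hardy_coeff (mult_op (symbol P U) f) k))\<^sup>2 = (norm (perp P (?c k)))\<^sup>2 + (norm (P (b k)))\<^sup>2" for k
  proof -
    have "shift_seq (\<lambda>k. U (P (?c k))) k = U (P (b k))"
      by (cases k) (simp_all add: b_def op_zero[OF opP E] op_zero[OF unitary_op[OF U] E])
    then have "hardy_coeff (mult_op (symbol P U) f) k = U (perp P (?c k) + P (b k))"
      by (simp add: hardy_symbol[OF f] op_add[OF unitary_op[OF U]] op_closed[OF opp] op_closed[OF opP] c bE)
    then show ?thesis
      by (simp add: unitary_norm[OF E U] csubspace_add[OF E] op_closed[OF opp] op_closed[OF opP] c bE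
        projection_pythagoras[OF E P])
  qed
  have "(\<Sum>k. (norm (P (b k)))\<^sup>2) = (\<Sum>k. (norm (P (?c k)))\<^sup>2)"
    using suminf_split_head[OF sum_b] by (simp add: b_def op_zero[OF opP E])
  then have "(\<Sum>k. (norm (perp P (?c k)))\<^sup>2 + (norm (P (b k)))\<^sup>2)
      = (\<Sum>k. (norm (perp P (?c k)))\<^sup>2 + (norm (P (?c k)))\<^sup>2)"
    using suminf_add[OF sum_p sum_b] suminf_add[OF sum_p sum_P] by simp
  also have "\<dots> = (\<Sum>k. (norm (?c k))\<^sup>2)" by (simp add: projection_norm_split[OF E P c])
  finally show ?thesis unfolding hardy_norm_def norm_k by simp
qed

lemma hardy_inner_symbol:
  assumes f: "f \<in> hardy E" and g: "g \<in> hardy E" and h: "h \<in> hardy E"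
    and coeff: "\<And>k. hardy_coeff h k = perp P (adj_on E U (hardy_coeff g k)) + P (adj_on E U (hardy_coeff g (Suc k)))"
  shows "hardy_inner (mult_op (symbol P U) f) g = hardy_inner f h"
proof -
  let ?f = "hardy_coeff f" and ?g = "hardy_coeff g"
  have fE: "?f k \<in> E" and gE: "?g k \<in> E" for k by (rule hardy_coeff_mem[OF f] hardy_coeff_mem[OF g])+
  note a = hardy_op[OF E op_perp_part[OF E P U] f] and b = hardy_op[OF E op_proj_part[OF E P U] f]
  let ?s = "\<lambda>k. cinner (shift_seq (\<lambda>k. U (P (?f k))) k) (?g k)"
  have sum_a: "summable (\<lambda>k. cinner (U (perp P (?f k))) (?g k))"
    using hardy_inner_summable[OF E a(1) g] by (simp add: a)
  have sum_s: "summable ?s" using hardy_inner_summable[OF E hardy_mult_z(1)[OF E b(1)] g]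
    by (simp add: hardy_mult_z[OF E b(1)] b)
  have sum_s': "summable (\<lambda>k. ?s (Suc k))" using sum_s by (subst summable_Suc_iff)
  have "hardy_inner (mult_op (symbol P U) f) g = (\<Sum>k. cinner (U (perp P (?f k))) (?g k) + ?s k)"
    by (simp add: hardy_inner_def hardy_symbol[OF f] cinner_add_left)
  also have "\<dots> = (\<Sum>k. cinner (U (perp P (?f k))) (?g k)) + (\<Sum>k. ?s k)"
    by (rule suminf_add[OF sum_a sum_s, symmetric])
  also have "(\<Sum>k. ?s k) = (\<Sum>k. ?s (Suc k))" using suminf_split_head[OF sum_s] by simp
  also have "(\<Sum>k. cinner (U (perp P (?f k))) (?g k)) + (\<Sum>k. ?s (Suc k))
      = (\<Sum>k. cinner (U (perp P (?f k))) (?g k) + ?s (Suc k))"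
    by (rule suminf_add[OF sum_a sum_s'])
  also have "\<dots> = (\<Sum>k. cinner (?f k) (hardy_coeff h k))"
    by (simp add: coeff cinner_add_right cinner_perp_part[OF E P U] cinner_proj_part[OF E P U] fE gE)
  finally show ?thesis by (simp add: hardy_inner_def)
qed

text \<open>The adjoint of multiplication by the symbol is a weighted backward shift.\<close>

lemma hardy_adj_symbol:
  assumes V: "\<And>f. f \<in> hardy E \<Longrightarrow> V f = mult_op (symbol P U) f" and g: "g \<in> hardy E"
  shows "hardy_adj E V g \<in> hardy E"
    and "hardy_coeff (hardy_adj E V g) k
      = perp P (adj_on E U (hardy_coeff g k)) + P (adj_on E U (hardy_coeff g (Suc k)))"
    and "f \<in> hardy E \<Longrightarrow> hardy_inner (V f) g = hardy_inner f (hardy_adj E V g)"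
proof -
  define a where "a k = perp P (adj_on E U (hardy_coeff g k)) + P (adj_on E U (hardy_coeff g (Suc k)))" for k
  have shifted: "square_summable E (\<lambda>k. hardy_coeff g (Suc k))"
    using hardy_coeff_square_summable[OF g]
    by (simp add: square_summable_def summable_Suc_iff[of "\<lambda>k. (norm (hardy_coeff g k))\<^sup>2"])
  have a: "square_summable E a"
    unfolding a_def[abs_def]
    by (rule square_summable_add[OF E square_summable_op[OF E op_perp_part_adj[OF E P U] hardy_coeff_square_summable[OF g]]
      square_summable_op[OF E op_proj_part_adj[OF E P U] shifted]])
  have adjoint: "hardy_inner (V f) g = hardy_inner f (hardy_of_seq a)" if "f \<in> hardy E" for f
    using hardy_inner_symbol[OF that g hardy_of_seq(1)[OF a]] that by (simp add: V hardy_of_seq(2)[OF a] a_def)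
  have *: "hardy_adj E V g = hardy_of_seq a"
    by (rule hardy_adj_eqI[OF E hardy_of_seq(1)[OF a] adjoint])
  then show "hardy_adj E V g \<in> hardy E" "f \<in> hardy E \<Longrightarrow> hardy_inner (V f) g = hardy_inner f (hardy_adj E V g)"
    "hardy_coeff (hardy_adj E V g) k
      = perp P (adj_on E U (hardy_coeff g k)) + P (adj_on E U (hardy_coeff g (Suc k)))"
    using hardy_of_seq[OF a] adjoint by (simp_all add: a_def)
qed

end

lemma foldr_mult_op: "foldr (\<lambda>i. mult_op (\<Phi> i)) is f = (\<lambda>z. foldr (\<lambda>i. \<Phi> i z) is (f z))"
  by (induction "is") (auto simp: mult_op_def)

lemma model_isometry_of_symbol_tuple:
  assumes tup: "symbol_tuple n E P U"
  shows "model_isometry n E (\<lambda>i. mult_op (symbol (P i) (U i)))"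
proof -
  have P: "orth_projection_on E (P i)" and U: "unitary_on E (U i)" if "i \<in> {1..n}" for i
    using tup that by (auto simp: symbol_tuple_def)
  have "hardy_isometry E (mult_op (symbol (P i) (U i)))" if i: "i \<in> {1..n}" for i
    unfolding hardy_isometry_def
    using hardy_symbol(1)[OF P[OF i] U[OF i]] hardy_norm_symbol[OF P[OF i] U[OF i]]
    by (auto simp: mult_op_def symbol_add[OF E P[OF i] U[OF i]] symbol_scaleC[OF E P[OF i] U[OF i]] hardy_mem[OF E])
  moreover have "mult_op (symbol (P i) (U i)) (mult_op (symbol (P j) (U j)) f)
      = mult_op (symbol (P j) (U j)) (mult_op (symbol (P i) (U i)) f)"
    if i: "i \<in> {1..n}" and j: "j \<in> {1..n}" and f: "f \<in> hardy E" for i j f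
  proof
    fix z
    show "mult_op (symbol (P i) (U i)) (mult_op (symbol (P j) (U j)) f) z
        = mult_op (symbol (P j) (U j)) (mult_op (symbol (P i) (U i)) f) z"
    proof (cases "cmod z < 1")
      case True
      then show ?thesis using tup i j hardy_mem[OF E f, of z] unfolding symbol_tuple_def mult_op_def by blast
    next
      case False
      then show ?thesis
        by (simp add: mult_op_def hardy_outside[OF f] symbol_zero[OF E P[OF i] U[OF i]] symbol_zero[OF E P[OF j] U[OF j]])
    qed
  qed
  moreover have "foldr (\<lambda>i. mult_op (symbol (P i) (U i))) [1..<Suc n] f = mult_z f" if f: "f \<in> hardy E" for f
  proof
    fix z
    have zero: "foldr (\<lambda>i. symbol (P i) (U i) z) is 0 = 0" if "set is \<subseteq> {1..n}" for "is"
      using that by (induction "is") (auto simp: symbol_zero[OF E P U])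
    show "foldr (\<lambda>i. mult_op (symbol (P i) (U i))) [1..<Suc n] f z = mult_z f z"
    proof (cases "cmod z < 1")
      case True
      then have "foldr (\<lambda>i. symbol (P i) (U i) z) [1..<Suc n] (f z) = z *\<^sub>C f z"
        using tup hardy_mem[OF E f, of z] unfolding symbol_tuple_def by blast
      then show ?thesis unfolding foldr_mult_op by (simp only: mult_op_def)
    next
      case False
      have "set [1..<Suc n] \<subseteq> {1..n}" by auto
      from zero[OF this] show ?thesis unfolding foldr_mult_op
        by (simp only: mult_op_def hardy_outside[OF f False] scaleC_zero_right)
    qed
  qed
  moreover have "\<exists>P' U'. \<forall>i\<in>{1..n}. orth_projection_on E (P' i) \<and> unitary_on E (U' i) \<and>
      (\<forall>f\<in>hardy E. mult_op (symbol (P i) (U i)) f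
        = mult_op (\<lambda>z x. U' i (perp (P' i) x) + z *\<^sub>C U' i (P' i x)) f)"
    by (rule exI[of _ P], rule exI[of _ U]) (use P U in \<open>auto simp: mult_op_def symbol_def\<close>)
  ultimately show ?thesis unfolding model_isometry_def by blast
qed

text \<open>Evaluating identities between multiplication operators at constant functions gives identities
  between the values of the symbols.\<close>

lemma symbol_tuple_of_model_isometry:
  assumes model: "model_isometry n E V"
  obtains P U where "symbol_tuple n E P U"
    "\<And>i f. i \<in> {1..n} \<Longrightarrow> f \<in> hardy E \<Longrightarrow> V i f = mult_op (symbol (P i) (U i)) f"
proof -
  obtain P U where PU: "\<And>i. i \<in> {1..n} \<Longrightarrow> orth_projection_on E (P i) \<and> unitary_on E (U i)"
    and V: "\<And>i f. i \<in> {1..n} \<Longrightarrow> f \<in> hardy E \<Longrightarrow> V i f = mult_op (symbol (P i) (U i)) f"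
    using model unfolding model_isometry_def symbol_def[abs_def] by blast
  have Vm: "V i f \<in> hardy E" if "i \<in> {1..n}" "f \<in> hardy E" for i f
    using model that unfolding model_isometry_def hardy_isometry_def by blast
  have "symbol (P i) (U i) z (symbol (P j) (U j) z x) = symbol (P j) (U j) z (symbol (P i) (U i) z x)"
    if i: "i \<in> {1..n}" and j: "j \<in> {1..n}" and z: "cmod z < 1" and x: "x \<in> E" for i j z x
  proof -
    have m: "monomial 0 x \<in> hardy E" by (rule monomial(1)[OF E x])
    have "V i (V j (monomial 0 x)) z = V j (V i (monomial 0 x)) z"
      using model i j m unfolding model_isometry_def by metis
    then show ?thesis
      by (simp add: V[OF i Vm[OF j m]] V[OF j Vm[OF i m]]) (simp add: V[OF i m] V[OF j m] mult_op_def monomial_0_apply[OF E x z])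
  qed
  moreover have "foldr (\<lambda>i. symbol (P i) (U i) z) [1..<Suc n] x = z *\<^sub>C x" if z: "cmod z < 1" and x: "x \<in> E" for z x
  proof -
    have m: "monomial 0 x \<in> hardy E" by (rule monomial(1)[OF E x])
    have "foldr V is (monomial 0 x) \<in> hardy E
        \<and> foldr V is (monomial 0 x) = foldr (\<lambda>i. mult_op (symbol (P i) (U i))) is (monomial 0 x)"
      if "set is \<subseteq> {1..n}" for "is"
      using that
    proof (induction "is")
      case (Cons i "is")
      let ?F = "foldr V is (monomial 0 x)"
      have i: "i \<in> {1..n}" and F: "?F \<in> hardy E"
        and eq: "?F = foldr (\<lambda>i. mult_op (symbol (P i) (U i))) is (monomial 0 x)" using Cons by auto
      have "foldr V (i # is) (monomial 0 x) = mult_op (symbol (P i) (U i)) ?F" using V[OF i F] by simp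
      also have "\<dots> = foldr (\<lambda>i. mult_op (symbol (P i) (U i))) (i # is) (monomial 0 x)" unfolding eq by simp
      finally show ?case using Vm[OF i F] by simp
    qed (simp add: m)
    moreover have "set [1..<Suc n] \<subseteq> {1..n}" by auto
    ultimately have "mult_z (monomial 0 x) = foldr (\<lambda>i. mult_op (symbol (P i) (U i))) [1..<Suc n] (monomial 0 x)"
      using model m unfolding model_isometry_def by metis
    then have "mult_z (monomial 0 x) z = foldr (\<lambda>i. symbol (P i) (U i) z) [1..<Suc n] (monomial 0 x z)"
      unfolding foldr_mult_op by metis
    then show ?thesis by (simp only: mult_op_def monomial_0_apply[OF E x z])
  qed
  ultimately have "symbol_tuple n E P U" unfolding symbol_tuple_def using PU by blast
  then show ?thesis using V that by blast
qed

text \<open>A map \<open>W\<close> that intertwines the adjoints of the \<open>V i\<close> with the \<open>A i\<close> intertwines the adjoint of a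
  product with the product of the \<open>A i\<close> in the opposite order.\<close>

lemma hardy_inner_foldr:
  assumes "\<And>i f. i \<in> set is \<Longrightarrow> f \<in> hardy E \<Longrightarrow> V i f \<in> hardy E"
    and "\<And>i f x. i \<in> set is \<Longrightarrow> f \<in> hardy E \<Longrightarrow> hardy_inner (V i f) (W x) = hardy_inner f (W (A i x))"
    and "f \<in> hardy E"
  shows "foldr V is f \<in> hardy E \<and> hardy_inner (foldr V is f) (W x) = hardy_inner f (W (fold A is x))"
  using assms by (induction "is" arbitrary: x) auto

end

section \<open>The canonical embedding\<close>

lemma adj_foldr:
  fixes T :: "nat \<Rightarrow> 'a::chilbert_space \<Rightarrow> 'a"
  assumes T: "\<And>i. i \<in> set is \<Longrightarrow> bounded_op_on UNIV (T i)"
  shows "adj (foldr T is) y = fold (\<lambda>i. adj (T i)) is y"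
proof (rule adj_on_eqI)
  show "cinner (foldr T is x) y = cinner x (fold (\<lambda>i. adj (T i)) is y)" for x
    using T by (induction "is" arbitrary: y) (auto simp: cinner_adj)
qed auto

locale commuting_contractions =
  fixes n :: nat and T :: "nat \<Rightarrow> 'a::chilbert_space \<Rightarrow> 'a"
  assumes n: "1 \<le> n"
    and contr: "\<And>i. i \<in> {1..n} \<Longrightarrow> contraction (T i)"
    and comm: "\<And>i j. i \<in> {1..n} \<Longrightarrow> j \<in> {1..n} \<Longrightarrow> T i \<circ> T j = T j \<circ> T i"
    and pure: "C_dot_0_contraction (foldr T [1..<Suc n])"
begin

definition "S = foldr T [1..<Suc n]"
abbreviation "D \<equiv> defect_op_star S"
abbreviation "E \<equiv> defect_space_star S"

lemma S: "contraction S"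
  using pure unfolding S_def[symmetric] C_dot_0_contraction_def by blast

lemma E: "closed_csubspace E"
  by (rule defect_space_csubspace[OF S])

lemma opD: "bounded_op_on UNIV D"
  by (rule op_defect[OF S])

lemma D_mem: "D x \<in> E"
  by (rule defect_mem[OF S])

lemma D_dense: "E = closure (range D)"
  by (simp add: defect_space_star_def)

lemma op_adjS: "bounded_op_on UNIV (adj S)"
  by (rule op_adj[OF contraction_op[OF S]])

lemma op_adjS_power: "bounded_op_on UNIV (adj S ^^ k)"
  by (rule op_power[OF op_adjS])

lemma op_adjT: "i \<in> {1..n} \<Longrightarrow> bounded_op_on UNIV (adj (T i))"
  by (rule op_adj[OF contraction_op[OF contr]])

lemma adjS_fold: "adj S x = fold (\<lambda>i. adj (T i)) [1..<Suc n] x"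
  unfolding S_def
proof (rule adj_foldr)
  show "bounded_op_on UNIV (T i)" if "i \<in> set [1..<Suc n]" for i
    by (rule contraction_op[OF contr]) (use that in auto)
qed

lemma adjT_commute:
  assumes i: "i \<in> {1..n}" and j: "j \<in> {1..n}"
  shows "adj (T i) (adj (T j) x) = adj (T j) (adj (T i) x)"
proof (rule adjoint_commute[OF closed_csubspace_UNIV contraction_op[OF contr[OF i]] contraction_op[OF contr[OF j]]
    op_adjT[OF i] op_adjT[OF j]])
  show "T i (T j y) = T j (T i y)" for y using comm[OF i j] by (metis comp_apply)
qed (auto intro: cinner_adj contraction_op contr i j)

lemma adjT_adjS: "i \<in> {1..n} \<Longrightarrow> adj (T i) (adj S x) = adj S (adj (T i) x)"
  unfolding adjS_fold by (rule fold_commute_single[where E = UNIV]) (auto intro: adjT_commute)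

lemma adjT_adjS_power: "i \<in> {1..n} \<Longrightarrow> adj (T i) ((adj S ^^ k) x) = (adj S ^^ k) (adj (T i) x)"
  by (induction k) (simp_all add: adjT_adjS)

lemma adjS_power_tendsto: "(\<lambda>k. (adj S ^^ k) x) \<longlonglongrightarrow> 0"
  using pure unfolding S_def[symmetric] C_dot_0_contraction_def by blast

declare upt_Suc [simp del]

text \<open>The series telescopes because \<open>norm (D x) ^ 2 = norm x ^ 2 - norm (adj S x) ^ 2\<close>; that the powers of
  \<open>adj S\<close> tend to zero strongly makes its sum the whole of \<open>norm x ^ 2\<close>.\<close>

lemma defect_orbit_sums: "(\<lambda>k. (norm (D ((adj S ^^ k) x)))\<^sup>2) sums (norm x)\<^sup>2"
proof -
  let ?a = "\<lambda>k. (norm ((adj S ^^ k) x))\<^sup>2"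
  have "?a \<longlonglongrightarrow> (norm (0::'a))\<^sup>2" by (intro tendsto_intros adjS_power_tendsto)
  then have "(\<lambda>k. ?a k - ?a (Suc k)) sums (?a 0 - (norm (0::'a))\<^sup>2)" by (rule telescope_sums')
  then show ?thesis by (simp add: norm_defect[OF S])
qed

text \<open>The Sz.-Nagy--Foias embedding, under which \<open>adj S\<close> becomes the backward shift.\<close>

definition embedding :: "'a \<Rightarrow> complex \<Rightarrow> 'a"
  where "embedding x = hardy_of_seq (\<lambda>k. D ((adj S ^^ k) x))"

lemma embedding:
  shows embedding_mem: "embedding x \<in> hardy E"
    and embedding_coeff: "hardy_coeff (embedding x) k = D ((adj S ^^ k) x)"
proof -
  have "square_summable E (\<lambda>k. D ((adj S ^^ k) x))"
    using defect_orbit_sums[of x] D_mem by (simp add: square_summable_def sums_iff)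
  from hardy_of_seq[OF this] show "embedding x \<in> hardy E" "hardy_coeff (embedding x) k = D ((adj S ^^ k) x)"
    unfolding embedding_def by (simp_all del: funpow.simps)
qed

lemma embedding_isometry: "isometry_into_hardy E embedding"
  unfolding isometry_into_hardy_def
proof (intro conjI allI)
  fix x y :: 'a and c :: complex
  show "embedding x \<in> hardy E" by (rule embedding_mem)
  show "embedding (x + y) = (\<lambda>z. embedding x z + embedding y z)"
    by (rule hardy_eqI[OF embedding_mem hardy_add(1)[OF E embedding_mem embedding_mem]])
      (simp add: hardy_add(2)[OF E embedding_mem embedding_mem] embedding_coeff op_add[OF op_adjS_power] op_add[OF opD])
  show "embedding (c *\<^sub>C x) = (\<lambda>z. c *\<^sub>C embedding x z)"
    by (rule hardy_eqI[OF embedding_mem hardy_scaleC(1)[OF E embedding_mem]])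
      (simp add: hardy_scaleC(2)[OF E embedding_mem] embedding_coeff op_scaleC[OF op_adjS_power] op_scaleC[OF opD])
  show "hardy_norm (embedding x) = norm x"
    using defect_orbit_sums[of x] by (simp add: hardy_norm_def embedding_coeff sums_iff)
qed

text \<open>The constant function \<open>D h\<close> is \<open>embedding h - z * embedding (adj S h)\<close>. Sorting a sum of such terms,
  each multiplied by \<open>z ^ k\<close>, by powers of \<open>z\<close> gives the arguments of \<open>embedding\<close> below. That \<open>h\<close> vanishes
  at \<open>N\<close> lets the sum end there.\<close>

lemma embedding_combination_coeff:
  assumes "h N = 0"
  shows "hardy_coeff (\<lambda>z. \<Sum>k<Suc N. (mult_z ^^ k) (embedding (h k - shift_seq (\<lambda>k. adj S (h k)) k)) z) j
    = (if j < N then D (h j) else 0)"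
proof -
  let ?h = "\<lambda>k. h k - shift_seq (\<lambda>k. adj S (h k)) k"
  have "hardy_coeff (\<lambda>z. \<Sum>k<Suc N. (mult_z ^^ k) (embedding (?h k)) z) j
      = (\<Sum>k<Suc N. hardy_coeff ((mult_z ^^ k) (embedding (?h k))) j)"
    using hardy_sum[OF E, of "{..<Suc N}" "\<lambda>k. (mult_z ^^ k) (embedding (?h k))"]
      hardy_mult_z_power(1)[OF E embedding_mem] by blast
  also have "\<dots> = (\<Sum>k<Suc N. if j < k then 0 else D ((adj S ^^ (j - k)) (?h k)))"
    by (simp only: hardy_mult_z_power(2)[OF E embedding_mem] embedding_coeff)
  also have "\<dots> = (\<Sum>k\<le>min j N. D ((adj S ^^ (j - k)) (?h k)))"
    by (rule sum.mono_neutral_cong_right) auto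
  also have "\<dots> = D ((adj S ^^ (j - min j N)) (h (min j N)))"
  proof -
    have "m \<le> j \<Longrightarrow> (\<Sum>k\<le>m. D ((adj S ^^ (j - k)) (?h k))) = D ((adj S ^^ (j - m)) (h m))" for m
    proof (induction m)
      case (Suc m)
      have "j - m = Suc (j - Suc m)" using Suc.prems by simp
      then have "(adj S ^^ (j - m)) (h m) = (adj S ^^ (j - Suc m)) (adj S (h m))"
        by (simp add: funpow_swap1)
      moreover have "D ((adj S ^^ (j - Suc m)) (?h (Suc m)))
          = D ((adj S ^^ (j - Suc m)) (h (Suc m))) - D ((adj S ^^ (j - Suc m)) (adj S (h m)))"
        by (simp add: op_diff[OF op_adjS_power] op_diff[OF opD])
      ultimately show ?case using Suc by simp
    qed simp
    then show ?thesis by simp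
  qed
  also have "\<dots> = (if j < N then D (h j) else 0)"
    using assms by (auto simp: min_def op_zero[OF op_adjS_power] op_zero[OF opD])
  finally show ?thesis .
qed

text \<open>Up to a small tail, a function of the Hardy space is a polynomial, and its coefficients are
  approximated by elements of the range of \<open>D\<close>.\<close>

lemma embedding_minimal: "minimal_embedding E embedding"
  unfolding minimal_embedding_def
proof (intro ballI allI impI)
  fix f and e :: real assume f: "f \<in> hardy E" and e: "0 < e"
  let ?c = "hardy_coeff f"
  have "0 < e\<^sup>2 / 2" using e by simp
  from suminf_exist_split[OF this hardy_coeff_summable[OF f]] obtain N
    where N: "norm (\<Sum>k. (norm (?c (k + N)))\<^sup>2) < e\<^sup>2 / 2" by blast
  \<comment> \<open>Chosen so that \<open>N * d\<^sup>2 \<le> e\<^sup>2 / 2\<close>, which leaves the other half for the tail.\<close>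
  define d where "d = e / sqrt (2 * (real N + 1))"
  have d: "0 < d" using e by (simp add: d_def)
  have d2: "d\<^sup>2 = (e\<^sup>2 / 2) / (real N + 1)"
    by (simp add: d_def power_divide)
  have "\<exists>h. norm (?c k - D h) < d" for k
  proof -
    have "?c k \<in> closure (range D)" using hardy_coeff_mem[OF f] D_dense by simp
    then obtain y where "y \<in> range D" "dist y (?c k) < d" using d closure_approachable by metis
    then show ?thesis by (auto simp: dist_norm norm_minus_commute)
  qed
  then obtain h' where h': "\<And>k. norm (?c k - D (h' k)) < d" by metis
  define h where "h k = (if k < N then h' k else 0)" for k
  define H where "H k = h k - shift_seq (\<lambda>k. adj S (h k)) k" for k
  let ?s = "\<lambda>z. \<Sum>k<Suc N. (mult_z ^^ k) (embedding (H k)) z"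
  have s: "?s \<in> hardy E"
    using hardy_sum[OF E, of "{..<Suc N}" "\<lambda>k. (mult_z ^^ k) (embedding (H k))"]
      hardy_mult_z_power(1)[OF E embedding_mem] by blast
  define g where "g = (\<lambda>z. f z - ?s z)"
  have g: "g \<in> hardy E" unfolding g_def by (rule hardy_diff(1)[OF E f s])
  have gc: "hardy_coeff g j = (if j < N then ?c j - D (h' j) else ?c j)" for j
    unfolding g_def hardy_diff(2)[OF E f s] using embedding_combination_coeff[of h N j]
    by (simp add: H_def h_def)
  have "(\<Sum>j. (norm (hardy_coeff g j))\<^sup>2)
      = (\<Sum>j. (norm (hardy_coeff g (j + N)))\<^sup>2) + (\<Sum>j<N. (norm (hardy_coeff g j))\<^sup>2)"
    by (rule suminf_split_initial_segment[OF hardy_coeff_summable[OF g]])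
  also have "(\<Sum>j. (norm (hardy_coeff g (j + N)))\<^sup>2) < e\<^sup>2 / 2" using N by (simp add: gc)
  also have "(\<Sum>j<N. (norm (hardy_coeff g j))\<^sup>2) \<le> (\<Sum>j<N. d\<^sup>2)"
    using h' by (intro sum_mono power_mono) (auto simp: gc less_imp_le)
  also have "(\<Sum>j<N. d\<^sup>2) \<le> e\<^sup>2 / 2"
  proof -
    have "real N * d\<^sup>2 = (e\<^sup>2 / 2) * (real N / (real N + 1))" by (simp add: d2)
    also have "\<dots> \<le> (e\<^sup>2 / 2) * 1" by (rule mult_left_mono) auto
    finally show ?thesis by simp
  qed
  finally have "(\<Sum>j. (norm (hardy_coeff g j))\<^sup>2) < e\<^sup>2" by simp
  then have "hardy_norm g < e" unfolding hardy_norm_def using e by (simp add: real_less_lsqrt)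
  then show "\<exists>N h. hardy_norm (\<lambda>z. f z - (\<Sum>k<N. (mult_z ^^ k) (embedding (h k)) z)) < e"
    unfolding g_def by blast
qed

section \<open>Characterization and uniqueness of the model\<close>

definition defect_relations :: "(nat \<Rightarrow> 'a \<Rightarrow> 'a) \<Rightarrow> (nat \<Rightarrow> 'a \<Rightarrow> 'a) \<Rightarrow> bool"
  where "defect_relations P U \<longleftrightarrow> (\<forall>i\<in>{1..n}. \<forall>x.
    D (adj (T i) x) = perp (P i) (adj_on E (U i) (D x)) + P i (adj_on E (U i) (D (adj S x))))"

lemma model_conditions_iff: "model_conditions n T P U \<longleftrightarrow> symbol_tuple n E P U \<and> defect_relations P U"
proof -
  have "model_conditions n T P U \<longleftrightarrow> symbol_relations n E P U \<and> defect_relations P U"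
    unfolding model_conditions_def symbol_relations_def defect_relations_def Let_def S_def by blast
  then show ?thesis
    using symbol_relations_imp_tuple[OF E, of n P U] symbol_tuple_imp_relations[OF E, of n P U] n by blast
qed

lemma embedding_intertwines:
  assumes tup: "symbol_tuple n E P U" and rel: "defect_relations P U" and i: "i \<in> {1..n}"
  shows "hardy_adj E (mult_op (symbol (P i) (U i))) (embedding x) = embedding (adj (T i) x)"
proof -
  have P: "orth_projection_on E (P i)" and U: "unitary_on E (U i)" using tup i by (auto simp: symbol_tuple_def)
  note adjoint = hardy_adj_symbol[OF E P U refl embedding_mem]
  show ?thesis
  proof (rule hardy_eqI[OF adjoint(1) embedding_mem])
    fix k
    have "D (adj (T i) ((adj S ^^ k) x))
        = perp (P i) (adj_on E (U i) (D ((adj S ^^ k) x))) + P i (adj_on E (U i) (D (adj S ((adj S ^^ k) x))))"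
      using rel i by (simp add: defect_relations_def)
    then show "hardy_coeff (hardy_adj E (mult_op (symbol (P i) (U i))) (embedding x)) k
        = hardy_coeff (embedding (adj (T i) x)) k"
      by (simp add: adjoint(2) embedding_coeff adjT_adjS_power[OF i])
  qed
qed

lemma model_of_conditions:
  assumes tup: "symbol_tuple n E P U" and rel: "defect_relations P U"
  shows "model_isometry n E (\<lambda>i. mult_op (symbol (P i) (U i)))" "has_model n T E (\<lambda>i. mult_op (symbol (P i) (U i)))"
  using model_isometry_of_symbol_tuple[OF E tup] embedding_isometry embedding_minimal
    embedding_intertwines[OF tup rel]
  unfolding has_model_def intertwining_isometry_def by blast+

text \<open>Let \<open>V\<close> be the product of the model isometries other than the \<open>i\<close>-th. The \<open>i\<close>-th one maps \<open>V e\<close> to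
  \<open>z e\<close>, for a constant function \<open>e\<close>, and it is injective; so \<open>V e\<close> can be computed without any knowledge
  of the factors of \<open>V\<close>. Pairing \<open>V e\<close> with \<open>embedding x\<close> and moving \<open>V\<close> to the other side gives the
  relation.\<close>

lemma complementary_relation:
  assumes tup: "symbol_tuple n E P U" and rel: "defect_relations P U" and i: "i \<in> {1..n}"
  shows "U i (P i (D x)) + U i (perp (P i) (D (adj S x)))
    = D (fold (\<lambda>j. adj (T j)) ([1..<i] @ [Suc i..<Suc n]) x)"
proof -
  let ?V = "\<lambda>i. mult_op (symbol (P i) (U i))" and ?js = "[1..<i] @ [Suc i..<Suc n]"
  have PU: "orth_projection_on E (P j)" "unitary_on E (U j)" if "j \<in> {1..n}" for j
    using tup that by (auto simp: symbol_tuple_def)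
  note P = PU(1)[OF i] and U = PU(2)[OF i]
  have model: "model_isometry n E ?V" by (rule model_isometry_of_symbol_tuple[OF E tup])
  have js: "set ?js \<subseteq> {1..n}" using i by auto
  have Vm: "?V j f \<in> hardy E" if "j \<in> {1..n}" "f \<in> hardy E" for j f
    by (rule hardy_symbol(1)[OF E PU that(2)]) (rule that(1))+
  have Vcomm: "?V j (?V k f) = ?V k (?V j f)" if "j \<in> {1..n}" "k \<in> {1..n}" "f \<in> hardy E" for j k f
    using model that unfolding model_isometry_def by blast
  have Vadj: "hardy_inner (?V j f) (embedding y) = hardy_inner f (embedding (adj (T j) y))"
    if j: "j \<in> {1..n}" and f: "f \<in> hardy E" for j f y
    using hardy_adj_symbol(3)[OF E PU[OF j] refl embedding_mem f] embedding_intertwines[OF tup rel j] by simp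
  have "cinner e (U i (P i (D x)) + U i (perp (P i) (D (adj S x)))) = cinner e (D (fold (\<lambda>j. adj (T j)) ?js x))"
    if e: "e \<in> E" for e
  proof -
    have m: "monomial 0 e \<in> hardy E" by (rule monomial(1)[OF E e])
    have fm: "foldr ?V ?js (monomial 0 e) \<in> hardy E"
      and inner: "hardy_inner (foldr ?V ?js (monomial 0 e)) (embedding x)
        = hardy_inner (monomial 0 e) (embedding (fold (\<lambda>j. adj (T j)) ?js x))"
      using hardy_inner_foldr[OF E, of ?js ?V embedding "\<lambda>j. adj (T j)" "monomial 0 e" x] Vm Vadj js m by blast+
    define a where "a = adj_on E (U i) e"
    have a: "a \<in> E" unfolding a_def by (rule adj_on_mem[OF E unitary_op[OF U] e])
    have opP: "bounded_op_on E (P i)" and opp: "bounded_op_on E (perp (P i))"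
      using projection_op[OF P] op_perp[OF projection_op[OF P] E] by auto
    have Pa: "P i a \<in> E" and pa: "perp (P i) a \<in> E" using op_closed[OF opP a] op_closed[OF opp a] by auto
    \<comment> \<open>The value at \<open>z e\<close> of the adjoint of the \<open>i\<close>-th model isometry, whence the candidate for \<open>V e\<close>.\<close>
    define g where "g = (\<lambda>z. monomial 0 (P i a) z + monomial (Suc 0) (perp (P i) a) z)"
    note mP = monomial[OF E Pa, of 0] and mp = monomial[OF E pa, of "Suc 0"]
    have g: "g \<in> hardy E" and gc: "hardy_coeff g k = (if k = 0 then P i a else if k = Suc 0 then perp (P i) a else 0)" for k
      unfolding g_def using hardy_add[OF E mP(1) mp(1)] by (auto simp: mP mp)
    have Vg: "?V i g = monomial (Suc 0) e"
    proof (rule hardy_eqI[OF Vm[OF i g] monomial(1)[OF E e]])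
      fix k
      have z: "perp (P i) (P i a) = 0" "P i (perp (P i) a) = 0"
        using a by (simp_all add: perp_def projection_idem[OF P] op_diff[OF opP E a op_closed[OF opP a]])
      have e_eq: "U i (perp (P i) (perp (P i) a)) + U i (P i (P i a)) = e"
        using symbol_parts_add[OF E P U a] a e
        by (simp add: projection_idem[OF P] projection_idem[OF projection_perp[OF E P]] a_def unitary_adj_right[OF U])
      have "U i 0 = 0" "P i 0 = 0" "perp (P i) 0 = 0"
        using op_zero[OF unitary_op[OF U] E] op_zero[OF opP E] op_zero[OF opp E] by auto
      then show "hardy_coeff (?V i g) k = hardy_coeff (monomial (Suc 0) e) k"
        using z e_eq by (cases k) (auto simp: hardy_symbol(2)[OF E P U g] monomial(2)[OF E e] gc)
    qed
    have Vf: "?V i (foldr ?V ?js (monomial 0 e)) = monomial (Suc 0) e"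
    proof -
      have is': "set [1..<i] \<subseteq> {1..n}" "set [Suc i..<Suc n] \<subseteq> {1..n}" using i by auto
      have tail: "foldr ?V [Suc i..<Suc n] (monomial 0 e) \<in> hardy E"
        by (rule foldr_mem) (use Vm m is'(2) in blast)+
      have "?V i (foldr ?V is f) = foldr ?V is (?V i f)" if "set is \<subseteq> {1..n}" and f: "f \<in> hardy E" for "is" f
        using that(1)
      proof (induction "is")
        case (Cons j "is")
        have "foldr ?V is f \<in> hardy E" by (rule foldr_mem) (use Vm f Cons.prems in auto)
        then have "?V i (?V j (foldr ?V is f)) = ?V j (?V i (foldr ?V is f))"
          using Vcomm i Cons.prems by simp
        then show ?case using Cons by simp
      qed simp
      from this[OF is'(1) tail]
      have "?V i (foldr ?V ?js (monomial 0 e)) = foldr ?V ([1..<i] @ i # [Suc i..<Suc n]) (monomial 0 e)"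
        by simp
      also have "[1..<i] @ i # [Suc i..<Suc n] = [1..<Suc n]"
        using i upt_add_eq_append[of 1 i "Suc n - i"] by (simp add: upt_conv_Cons)
      also have "foldr ?V [1..<Suc n] (monomial 0 e) = mult_z (monomial 0 e)"
        using model m unfolding model_isometry_def by blast
      finally show ?thesis using mult_z_monomial[OF E e, of 0] by simp
    qed
    have "foldr ?V ?js (monomial 0 e) = g"
    proof (rule hardy_eqI[OF fm g])
      fix k
      let ?d = "\<lambda>z. foldr ?V ?js (monomial 0 e) z - g z"
      have d: "?d \<in> hardy E" by (rule hardy_diff(1)[OF E fm g])
      have "?V i ?d = (\<lambda>z. 0)"
      proof
        fix z
        have "?V i ?d z = ?V i (foldr ?V ?js (monomial 0 e)) z - ?V i g z"
          using op_diff[OF op_perp_part[OF E P U] E hardy_mem[OF E fm, of z] hardy_mem[OF E g, of z]]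
            op_diff[OF op_proj_part[OF E P U] E hardy_mem[OF E fm, of z] hardy_mem[OF E g, of z]]
          by (simp add: mult_op_def symbol_def scaleC_diff_right)
        then show "?V i ?d z = 0" using Vf Vg by simp
      qed
      moreover have "hardy_norm (?V i ?d) = hardy_norm ?d" by (rule hardy_norm_symbol[OF E P U d])
      moreover have "hardy_norm (\<lambda>z. 0 :: 'a) = 0"
      proof -
        have "square_summable E (\<lambda>k. 0)" by (simp add: square_summable_def csubspace_zero[OF E])
        from hardy_coeffI(2)[OF this, of "\<lambda>z. 0"] show ?thesis by (simp add: hardy_norm_def)
      qed
      ultimately have "hardy_coeff ?d k = 0" using hardy_norm_zero[OF E d] by simp
      then show "hardy_coeff (foldr ?V ?js (monomial 0 e)) k = hardy_coeff g k"
        unfolding hardy_diff(2)[OF E fm g] by (simp only: right_minus_eq)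
    qed
    then have "hardy_inner g (embedding x) = cinner e (D (fold (\<lambda>j. adj (T j)) ?js x))"
      using inner by (simp add: hardy_inner_monomial[OF E e] embedding_coeff)
    moreover have "hardy_inner g (embedding x) = cinner (P i a) (D x) + cinner (perp (P i) a) (D (adj S x))"
      unfolding hardy_inner_def
      by (subst suminf_finite[of "{0, Suc 0}"]) (auto simp: gc embedding_coeff)
    moreover have "cinner (P i a) (D x) = cinner e (U i (P i (D x)))"
      using projection_cinner[OF E P a D_mem] cinner_adj_on_left[OF E unitary_op[OF U] e op_closed[OF opP D_mem]]
      by (simp add: a_def)
    moreover have "cinner (perp (P i) a) (D (adj S x)) = cinner e (U i (perp (P i) (D (adj S x))))"
      using projection_cinner[OF E projection_perp[OF E P] a D_mem]
        cinner_adj_on_left[OF E unitary_op[OF U] e op_closed[OF opp D_mem]]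
      by (simp add: a_def)
    ultimately show ?thesis by (simp add: cinner_add_right)
  qed
  then show ?thesis
    by (rule csubspace_cinner_eqI[OF E csubspace_add[OF E op_closed[OF op_proj_part[OF E P U] D_mem]
      op_closed[OF op_perp_part[OF E P U] D_mem]] D_mem])
qed

text \<open>Let \<open>a\<close> and \<open>b\<close> be the differences of the constant and of the linear coefficients of the two symbols.
  The relations for \<open>T i\<close> give \<open>a\<^sup>* D + b\<^sup>* D S\<^sup>* = 0\<close>, the complementary ones \<open>b D + a D S\<^sup>* = 0\<close>, so the
  form \<open>cinner (a (D x)) (D y)\<close> does not change when \<open>x\<close> and \<open>y\<close> are replaced by \<open>S\<^sup>* x\<close> and \<open>S\<^sup>* y\<close>. As
  the powers of \<open>S\<^sup>*\<close> tend to zero, the form vanishes, and with it first \<open>a\<close> and then \<open>b\<close>.\<close>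

lemma model_conditions_unique:
  assumes c: "symbol_tuple n E P U" "defect_relations P U" and c': "symbol_tuple n E P' U'" "defect_relations P' U'"
    and i: "i \<in> {1..n}" and x: "x \<in> E"
  shows "P' i x = P i x \<and> U' i x = U i x"
proof -
  have P: "orth_projection_on E (P i)" and U: "unitary_on E (U i)"
    and P': "orth_projection_on E (P' i)" and U': "unitary_on E (U' i)"
    using c c' i by (auto simp: symbol_tuple_def)
  define a where "a v = U i (perp (P i) v) - U' i (perp (P' i) v)" for v
  define b where "b v = U i (P i v) - U' i (P' i v)" for v
  define a' where "a' v = perp (P i) (adj_on E (U i) v) - perp (P' i) (adj_on E (U' i) v)" for v
  define b' where "b' v = P i (adj_on E (U i) v) - P' i (adj_on E (U' i) v)" for v
  have opa: "bounded_op_on E a" and opb: "bounded_op_on E b"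
    unfolding a_def[abs_def] b_def[abs_def]
    by (intro op_diff_op[OF _ _ E] op_perp_part[OF E] op_proj_part[OF E] P U P' U')+
  have adj_a: "cinner (a v) w = cinner v (a' w)" and adj_b: "cinner (b v) w = cinner v (b' w)"
    if "v \<in> E" "w \<in> E" for v w
    using that by (simp_all add: a_def a'_def b_def b'_def cinner_diff_left cinner_diff_right
      cinner_perp_part[OF E P U] cinner_perp_part[OF E P' U'] cinner_proj_part[OF E P U] cinner_proj_part[OF E P' U'])
  have rel: "a' (D y) = - b' (D (adj S y))" for y
  proof -
    have "perp (P i) (adj_on E (U i) (D y)) + P i (adj_on E (U i) (D (adj S y)))
        = perp (P' i) (adj_on E (U' i) (D y)) + P' i (adj_on E (U' i) (D (adj S y)))"
      using c(2) c'(2) i unfolding defect_relations_def by metis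
    then show ?thesis by (simp add: a'_def b'_def algebra_simps)
  qed
  have corel: "b (D y) = - a (D (adj S y))" for y
    using complementary_relation[OF c i, of y] complementary_relation[OF c' i, of y]
    by (simp add: a_def b_def algebra_simps)
  have step: "cinner (a (D y)) (D w) = cinner (a (D (adj S y))) (D (adj S w))" for y w
  proof -
    have "cinner (a (D y)) (D w) = - cinner (D y) (b' (D (adj S w)))"
      by (simp add: adj_a D_mem rel cinner_minus_right)
    also have "\<dots> = - cinner (b (D y)) (D (adj S w))" by (simp add: adj_b D_mem)
    also have "\<dots> = cinner (a (D (adj S y))) (D (adj S w))" by (simp add: corel cinner_minus_left)
    finally show ?thesis .
  qed
  have form_zero: "cinner (a (D y)) (D w) = 0" for y w
  proof -
    have "cinner (a (D y)) (D w) = cinner (a (D ((adj S ^^ k) y))) (D ((adj S ^^ k) w))" for k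
      by (induction k) (use step in auto)
    moreover have "(\<lambda>k. cinner (a (D ((adj S ^^ k) y))) (D ((adj S ^^ k) w))) \<longlonglongrightarrow> cinner (a (D 0)) (D 0)"
    proof (rule tendsto_cinner)
      have D_lim: "(\<lambda>k. D ((adj S ^^ k) v)) \<longlonglongrightarrow> D 0" for v
        by (rule bounded_linear.tendsto[OF bounded_op_on_UNIV_linear[OF opD] adjS_power_tendsto])
      show "(\<lambda>k. D ((adj S ^^ k) w)) \<longlonglongrightarrow> D 0" by (rule D_lim)
      show "(\<lambda>k. a (D ((adj S ^^ k) y))) \<longlonglongrightarrow> a (D 0)"
        by (rule continuous_on_tendsto_compose[OF op_continuous_on[OF opa E] D_lim D_mem]) (simp add: D_mem)
    qed
    ultimately have "(\<lambda>k::nat. cinner (a (D y)) (D w)) \<longlonglongrightarrow> cinner (a (D 0)) (D 0)" by simp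
    then have "cinner (a (D y)) (D w) = cinner (a (D 0)) (D 0)" by (simp add: LIMSEQ_const_iff)
    then show ?thesis by (simp add: op_zero[OF opD] op_zero[OF opa E])
  qed
  have zero_op: "bounded_op_on E (\<lambda>v. 0)"
    by (auto simp: bounded_op_on_def csubspace_zero[OF E] intro!: exI[of _ 0])
  have aD: "a (D y) = 0" for y
  proof -
    have aE: "a (D y) \<in> E" by (rule op_closed[OF opa D_mem])
    have "cinner (a (D y)) v = 0" if v: "v \<in> E" for v
    proof -
      obtain u where u: "\<And>k. u k \<in> range D" "u \<longlonglongrightarrow> v"
        using v unfolding D_dense closure_sequential by blast
      have "(\<lambda>k. cinner (a (D y)) (u k)) \<longlonglongrightarrow> cinner (a (D y)) v"
        by (rule tendsto_cinner[OF tendsto_const u(2)])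
      moreover have "cinner (a (D y)) (u k) = 0" for k using u(1)[of k] form_zero by auto
      ultimately show ?thesis by (simp add: LIMSEQ_const_iff)
    qed
    from this[OF aE] show ?thesis by simp
  qed
  have a0: "a v = 0" if "v \<in> E" for v
    by (rule op_eq_on_closure[OF opa zero_op E D_dense _ that]) (auto simp: aD)
  have b0: "b v = 0" if "v \<in> E" for v
    by (rule op_eq_on_closure[OF opb zero_op E D_dense _ that]) (auto simp: corel aD)
  have UU: "U' i v = U i v" if "v \<in> E" for v
    using a0[OF that] b0[OF that] symbol_parts_add[OF E P U that] symbol_parts_add[OF E P' U' that]
    by (simp add: a_def b_def)
  have "U i (P' i x) = U i (P i x)"
    using b0[OF x] UU[OF op_closed[OF projection_op[OF P'] x]] by (simp add: b_def)
  then have "P' i x = P i x"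
    using unitary_adj_left[OF U] op_closed[OF projection_op[OF P'] x] op_closed[OF projection_op[OF P] x] by metis
  then show ?thesis using UU[OF x] by simp
qed

text \<open>The constant coefficient \<open>w\<close> of the embedding satisfies \<open>norm (w x) = norm (D x)\<close>, since the other
  coefficients at \<open>x\<close> are all the coefficients at \<open>adj S x\<close>. Minimality makes the range of \<open>w\<close> dense. So
  \<open>w\<close> is \<open>D\<close> up to a unitary, by which the symbols are conjugated.\<close>

lemma conditions_of_model:
  assumes model: "model_isometry n E V" and has: "has_model n T E V"
  shows "\<exists>P U. symbol_tuple n E P U \<and> defect_relations P U"
proof -
  obtain P U where tup: "symbol_tuple n E P U"
    and V: "\<And>i f. i \<in> {1..n} \<Longrightarrow> f \<in> hardy E \<Longrightarrow> V i f = mult_op (symbol (P i) (U i)) f"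
    using symbol_tuple_of_model_isometry[OF E model] by metis
  have PU: "orth_projection_on E (P i)" "unitary_on E (U i)" if "i \<in> {1..n}" for i
    using tup that by (auto simp: symbol_tuple_def)
  obtain W where iso: "isometry_into_hardy E W"
    and intertw: "\<And>i x. i \<in> {1..n} \<Longrightarrow> hardy_adj E (V i) (W x) = W (adj (T i) x)"
    and minimal: "minimal_embedding E W"
    using has unfolding has_model_def intertwining_isometry_def by blast
  have Wm: "W x \<in> hardy E" and Wadd: "W (x + y) = (\<lambda>z. W x z + W y z)"
    and Wscale: "W (c *\<^sub>C x) = (\<lambda>z. c *\<^sub>C W x z)" and Wnorm: "hardy_norm (W x) = norm x" for x y c
    using iso unfolding isometry_into_hardy_def by blast+
  define w where "w x = hardy_coeff (W x) 0" for x
  have wE: "w x \<in> E" for x unfolding w_def by (rule hardy_coeff_mem[OF Wm])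
  have norm_sums: "(\<lambda>k. (norm (hardy_coeff (W x) k))\<^sup>2) sums (norm x)\<^sup>2" for x
  proof -
    have "0 \<le> (\<Sum>k. (norm (hardy_coeff (W x) k))\<^sup>2)" by (rule suminf_nonneg[OF hardy_coeff_summable[OF Wm]]) simp
    then have "(\<Sum>k. (norm (hardy_coeff (W x) k))\<^sup>2) = (norm x)\<^sup>2"
      using Wnorm[of x] by (simp add: hardy_norm_def) (metis real_sqrt_pow2)
    then show ?thesis using hardy_coeff_summable[OF Wm, of x] by (simp add: sums_iff)
  qed
  have adjoint: "hardy_coeff (W (adj (T i) x)) k
      = perp (P i) (adj_on E (U i) (hardy_coeff (W x) k)) + P i (adj_on E (U i) (hardy_coeff (W x) (Suc k)))"
    if i: "i \<in> {1..n}" for i x k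
    unfolding intertw[OF i, symmetric] by (rule hardy_adj_symbol(2)[OF E PU[OF i] V[OF i] Wm])
  have adjoint_inner: "hardy_inner (V i f) (W x) = hardy_inner f (W (adj (T i) x))"
    if i: "i \<in> {1..n}" and f: "f \<in> hardy E" for i x f
    unfolding intertw[OF i, symmetric] by (rule hardy_adj_symbol(3)[OF E PU[OF i] V[OF i] Wm f])
  have shift: "hardy_coeff (W x) (Suc k) = hardy_coeff (W (adj S x)) k" for x k
  proof (rule csubspace_cinner_eqI[OF E hardy_coeff_mem[OF Wm] hardy_coeff_mem[OF Wm]])
    fix e assume e: "e \<in> E"
    have m: "monomial k e \<in> hardy E" by (rule monomial(1)[OF E e])
    have "set [1..<Suc n] \<subseteq> {1..n}" by auto
    moreover have "V i f \<in> hardy E" if "i \<in> {1..n}" "f \<in> hardy E" for i f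
      using model that unfolding model_isometry_def hardy_isometry_def by blast
    ultimately have "hardy_inner (foldr V [1..<Suc n] (monomial k e)) (W x)
        = hardy_inner (monomial k e) (W (fold (\<lambda>i. adj (T i)) [1..<Suc n] x))"
      using hardy_inner_foldr[OF E, of "[1..<Suc n]" V W "\<lambda>i. adj (T i)" "monomial k e" x] adjoint_inner m by blast
    moreover have "foldr V [1..<Suc n] (monomial k e) = monomial (Suc k) e"
      using model m mult_z_monomial[OF E e] unfolding model_isometry_def by metis
    ultimately show "cinner e (hardy_coeff (W x) (Suc k)) = cinner e (hardy_coeff (W (adj S x)) k)"
      by (simp only: hardy_inner_monomial[OF E e] adjS_fold)
  qed
  have w_norm: "norm (w x) = norm (D x)" for x
  proof -
    have "(\<lambda>k. (norm (hardy_coeff (W x) (Suc k)))\<^sup>2) sums (norm (adj S x))\<^sup>2"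
      unfolding shift by (rule norm_sums)
    then have "(\<lambda>k. (norm (hardy_coeff (W x) k))\<^sup>2) sums ((norm (adj S x))\<^sup>2 + (norm (w x))\<^sup>2)"
      unfolding w_def by (rule sums_Suc)
    then have "(norm (w x))\<^sup>2 = (norm (D x))\<^sup>2"
      using norm_sums[of x] sums_unique2 norm_defect[OF S, of x] by fastforce
    then show ?thesis by (simp add: power2_eq_iff_nonneg)
  qed
  have op_w: "bounded_op_on UNIV w"
  proof -
    have "w (x + y) = w x + w y" for x y by (simp add: w_def Wadd hardy_add(2)[OF E Wm Wm])
    moreover have "w (c *\<^sub>C x) = c *\<^sub>C w x" for c x by (simp add: w_def Wscale hardy_scaleC(2)[OF E Wm])
    moreover have "norm (w x) \<le> 1 * norm x" for x
      using norm_hardy_coeff_le[OF E Wm, of x 0] Wnorm[of x] by (simp add: w_def)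
    ultimately show ?thesis unfolding bounded_op_on_def by blast
  qed
  have w_dense: "closure (range w) = E"
  proof
    show "closure (range w) \<subseteq> E"
      by (rule closure_minimal) (use wE csubspace_closed[OF E] in auto)
    show "E \<subseteq> closure (range w)"
    proof
      fix e assume e: "e \<in> E"
      note m = monomial[OF E e, of 0]
      have "\<exists>y\<in>range w. dist y e < r" if r: "0 < r" for r
      proof -
        obtain N h where h: "hardy_norm (\<lambda>z. monomial 0 e z - (\<Sum>k<N. (mult_z ^^ k) (W (h k)) z)) < r"
          using minimal m(1) r unfolding minimal_embedding_def by blast
        let ?s = "\<lambda>z. \<Sum>k<N. (mult_z ^^ k) (W (h k)) z"
        have s: "?s \<in> hardy E" "hardy_coeff ?s 0 = (\<Sum>k<N. hardy_coeff ((mult_z ^^ k) (W (h k))) 0)"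
          using hardy_sum[OF E, of "{..<N}" "\<lambda>k. (mult_z ^^ k) (W (h k))"] hardy_mult_z_power(1)[OF E Wm] by blast+
        \<comment> \<open>Only the summand without a power of \<open>z\<close> contributes in degree zero.\<close>
        have "hardy_coeff ?s 0 = (\<Sum>k<N. if k = 0 then w (h 0) else 0)"
          unfolding s(2) by (rule sum.cong) (auto simp: hardy_mult_z_power(2)[OF E Wm] w_def)
        then have "hardy_coeff ?s 0 = (if N = 0 then 0 else w (h 0))" by (simp add: sum.delta)
        then have "hardy_coeff ?s 0 \<in> range w" using op_zero[OF op_w closed_csubspace_UNIV] by (auto intro: range_eqI[of _ _ 0])
        moreover have "norm (e - hardy_coeff ?s 0) < r"
          using norm_hardy_coeff_le[OF E hardy_diff(1)[OF E m(1) s(1)], of 0] h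
          by (simp add: hardy_diff(2)[OF E m(1) s(1)] m(2))
        ultimately show ?thesis by (metis dist_norm norm_minus_commute)
      qed
      then show "e \<in> closure (range w)" by (simp add: closure_approachable)
    qed
  qed
  obtain L where L: "unitary_on E L" "\<And>x. L (D x) = w x"
    using unitary_extension[OF opD op_w w_norm E D_dense[symmetric] w_dense] by blast
  define P' where "P' i x = adj_on E L (P i (L x))" for i x
  define U' where "U' i x = adj_on E L (U i (L x))" for i x
  have "symbol_tuple n E P' U'"
    unfolding P'_def[abs_def] U'_def[abs_def] by (rule symbol_tuple_conj[OF E L(1) tup])
  moreover have "defect_relations P' U'"
    unfolding defect_relations_def
  proof (intro ballI allI)
    fix i x assume i: "i \<in> {1..n}"
    note P = PU(1)[OF i] and U = PU(2)[OF i]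
    have opP: "bounded_op_on E (P i)" and opp: "bounded_op_on E (perp (P i))"
      using projection_op[OF P] op_perp[OF projection_op[OF P] E] by auto
    note adjL = op_adj_on[OF E unitary_op[OF L(1)]]
    have Us: "adj_on E (U' i) (D y) = adj_on E L (adj_on E (U i) (w y))" for y
      using unitary_conj(2)[OF E L(1) U D_mem] unfolding U'_def[abs_def] by (simp add: L(2))
    have m: "adj_on E (U i) (w y) \<in> E" "adj_on E L (adj_on E (U i) (w y)) \<in> E" for y
      using adj_on_mem[OF E unitary_op[OF U] wE] adj_on_mem[OF E unitary_op[OF L(1)]] by blast+
    have "D (adj (T i) x) = adj_on E L (w (adj (T i) x))"
      using unitary_adj_left[OF L(1) D_mem] L(2) by metis
    also have "w (adj (T i) x) = perp (P i) (adj_on E (U i) (w x)) + P i (adj_on E (U i) (w (adj S x)))"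
      using adjoint[OF i, of x 0] by (simp add: w_def shift)
    also have "adj_on E L \<dots> = adj_on E L (perp (P i) (adj_on E (U i) (w x)))
        + adj_on E L (P i (adj_on E (U i) (w (adj S x))))"
      by (rule op_add[OF adjL op_closed[OF opp m(1)] op_closed[OF opP m(1)]])
    also have "adj_on E L (perp (P i) (adj_on E (U i) (w x))) = perp (P' i) (adj_on E (U' i) (D x))"
      using perp_conj[OF E L(1) opP m(2)[of x]] unfolding P'_def[abs_def] Us
      by (simp add: unitary_adj_right[OF L(1)] m)
    also have "adj_on E L (P i (adj_on E (U i) (w (adj S x)))) = P' i (adj_on E (U' i) (D (adj S x)))"
      by (simp add: P'_def Us unitary_adj_right[OF L(1)] m)
    finally show "D (adj (T i) x) = perp (P' i) (adj_on E (U' i) (D x)) + P' i (adj_on E (U' i) (D (adj S x)))" .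
  qed
  ultimately show ?thesis by blast
qed

lemma model_iff_conditions:
  "(\<exists>V. model_isometry n E V \<and> has_model n T E V) \<longleftrightarrow>
    (\<exists>P U. model_conditions n T P U \<and> (\<forall>P' U'. model_conditions n T P' U' \<longrightarrow>
      (\<forall>i\<in>{1..n}. \<forall>x\<in>E. P' i x = P i x \<and> U' i x = U i x)))"
proof
  assume "\<exists>V. model_isometry n E V \<and> has_model n T E V"
  then obtain P U where "model_conditions n T P U"
    using conditions_of_model model_conditions_iff by blast
  moreover from this have "\<forall>i\<in>{1..n}. \<forall>x\<in>E. P' i x = P i x \<and> U' i x = U i x"
    if "model_conditions n T P' U'" for P' U'
    using that model_conditions_unique unfolding model_conditions_iff by blast
  ultimately show "\<exists>P U. model_conditions n T P U \<and> (\<forall>P' U'. model_conditions n T P' U' \<longrightarrow>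
      (\<forall>i\<in>{1..n}. \<forall>x\<in>E. P' i x = P i x \<and> U' i x = U i x))" by blast
next
  assume "\<exists>P U. model_conditions n T P U \<and> (\<forall>P' U'. model_conditions n T P' U' \<longrightarrow>
      (\<forall>i\<in>{1..n}. \<forall>x\<in>E. P' i x = P i x \<and> U' i x = U i x))"
  then obtain P U where "symbol_tuple n E P U" "defect_relations P U"
    unfolding model_conditions_iff by blast
  from model_of_conditions[OF this] show "\<exists>V. model_isometry n E V \<and> has_model n T E V" by blast
qed

end

theorem theorem4p5:
  fixes n :: nat and T :: "nat \<Rightarrow> 'a::chilbert_space \<Rightarrow> 'a"
  assumes "1 \<le> n"
    and "\<And>i. i \<in> {1..n} \<Longrightarrow> contraction (T i)"
    and "\<And>i j. i \<in> {1..n} \<Longrightarrow> j \<in> {1..n} \<Longrightarrow> T i \<circ> T j = T j \<circ> T i"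
    and "C_dot_0_contraction (foldr T [1..<Suc n])"
  shows "(\<exists>V. model_isometry n (defect_space_star (foldr T [1..<Suc n])) V \<and>
            has_model n T (defect_space_star (foldr T [1..<Suc n])) V)
     \<longleftrightarrow> (\<exists>P U. model_conditions n T P U \<and>
            (\<forall>P' U'. model_conditions n T P' U' \<longrightarrow>
              (\<forall>i\<in>{1..n}. \<forall>x\<in>defect_space_star (foldr T [1..<Suc n]). P' i x = P i x \<and> U' i x = U i x)))"
proof -
  interpret commuting_contractions n T
    by (unfold_locales; rule assms)
  show ?thesis by (rule model_iff_conditions[unfolded S_def])
qed

end
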